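(* Assume that there exist positive constants $c_0,\kappa_0,c_1,\kappa_1$ such that $\inf_{|\delta|\le c_0}U'(\theta+\delta)\ge\kappa_0$, $\sup_{|\delta|\le c_1}|U''(\theta+\delta)|\le\kappa_1$, and that $\|f\|_\infty=\sup_{t\in\mathbb{R}}|f(t)|<\infty$. Then there are positive constants $C_1,\dots,C_5$ depending only on $c_0,\kappa_0,c_1,\kappa_1$ and $\|f\|_\infty$ such that for any $w=w_n>0$ and $z=z_n>0$ with $w\vee z=o(n)$ (and all sufficiently large $n$), with probability at least $1-C_1\exp(-w)$ we have $$\mathbb{P}^\star\left\{|\hat\theta^\star-\hat\theta|>C_2\left(\frac{w+\log n}{n}+\sqrt{z/n}\right)\right\}\le C_3\exp(-z),$$ $$\mathbb{P}^\star\left\{\left|\hat\theta^\star-\hat\theta-\frac{1}{B_n}\sum_{i\ne j\in[n]}(\omega_i\omega_j-1)V_{ij}\right|>\frac{C_4(z+w+\log n)}{n}\right\}\le C_5\exp(-z).$$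
   Context: For $n\ge2$, $[n]=\{1,\dots,n\}$. Let $X_i=\theta+\xi_i$, $i\in[n]$, be real random variables, where $\theta\in\mathbb{R}$ and $\xi_1,\dots,\xi_n$ are i.i.d. with cumulative distribution function $F$ and density $f=F'$. The distribution of $\xi_1$ has pseudomedian zero, i.e. the median of $(\xi_1+\xi_2)/2$ is $0$. Put $U(t)=\mathbb{P}\{(X_1+X_2)/2\le t\}$, so that $\theta=\inf\{t:U(t)\ge1/2\}$, and $U_n(t)=\{n(n-1)\}^{-1}\sum_{i\ne j\in[n]}\mathbb{I}\{(X_i+X_j)/2\le t\}$. The Hodges–Lehmann estimator is $\hat\theta=\inf\{t:U_n(t)\ge1/2\}$. Bootstrap weights: $\omega_1,\dots,\omega_n$ are i.i.d. with $\mathbb{P}(\omega_i=0)=\mathbb{P}(\omega_i=2)=1/2$ (i.e. $2\cdot\mathrm{Bernoulli}(0.5)$), independent of the data. Let $\mathcal{S}=\{i\in[n]:\omega_i\ne0\}$, $B_n=\sum_{i\ne j\in[n]}\omega_i\omega_j$, and $\hat\theta^\star=\mathrm{median}\{(X_i+X_j)/2:i\ne j\in\mathcal{S}\}$, i.e. $\hat\theta^\star=\inf\{t:B_n^{-1}\sum_{i\ne j}\omega_i\omega_j\mathbb{I}\{(X_i+X_j)/2\le t\}\ge1/2\}$ (with arbitrary values assigned to $\hat\theta^\star$ and $1/B_n$ on the event $|\mathcal{S}|\le1$). For $i\ne j$ put $V_{ij}=[U_n(\theta)-\mathbb{I}\{\xi_i+\xi_j\le0\}]/U'(\theta)$. $\mathbb{P}^\star(\cdot)=\mathbb{P}(\cdot\mid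 X_1,\dots,X_n)$ is the conditional probability given the data, and $a\vee b=\max(a,b)$. *)

theory Defs
  imports "HOL-Probability.Probability" "HOL-Library.Landau_Symbols"
begin

definition cdf_median :: "(real \<Rightarrow> real) \<Rightarrow> real" where
  "cdf_median G = Inf {t. G t \<ge> 1 / 2}"

definition offdiag :: "nat \<Rightarrow> (nat \<times> nat) set" where
  "offdiag n = {(i, j). i \<in> {1..n} \<and> j \<in> {1..n} \<and> i \<noteq> j}"

definition mean_cdf :: "'a measure \<Rightarrow> (nat \<Rightarrow> 'a \<Rightarrow> real) \<Rightarrow> real \<Rightarrow> real" where
  "mean_cdf M Y t = measure M {s \<in> space M. (Y 1 s + Y 2 s) / 2 \<le> t}"

text \<open>Below, \<open>x\<close> is a realisation of the data and \<open>v\<close> a realisation of the bootstrap weights,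
  both indexed by \<open>{1..n}\<close>.\<close>

definition U_stat :: "nat \<Rightarrow> (nat \<Rightarrow> real) \<Rightarrow> real \<Rightarrow> real" where
  "U_stat n x t =
     (1 / (real n * (real n - 1))) * (\<Sum>(i, j)\<in>offdiag n. of_bool ((x i + x j) / 2 \<le> t))"

definition hodges_lehmann :: "nat \<Rightarrow> (nat \<Rightarrow> real) \<Rightarrow> real" where
  "hodges_lehmann n x = cdf_median (U_stat n x)"

definition selected :: "nat \<Rightarrow> (nat \<Rightarrow> real) \<Rightarrow> nat set" where
  "selected n v = {i \<in> {1..n}. v i \<noteq> 0}"

definition weight_total :: "nat \<Rightarrow> (nat \<Rightarrow> real) \<Rightarrow> real" where
  "weight_total n v = (\<Sum>(i, j)\<in>offdiag n. v i * v j)"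

definition U_boot :: "nat \<Rightarrow> (nat \<Rightarrow> real) \<Rightarrow> (nat \<Rightarrow> real) \<Rightarrow> real \<Rightarrow> real" where
  "U_boot n v x t =
     (1 / weight_total n v) *
     (\<Sum>(i, j)\<in>offdiag n. v i * v j * of_bool ((x i + x j) / 2 \<le> t))"

text \<open>\<open>e\<close> is the realised noise; \<open>u\<close> is to be instantiated with the derivative at \<open>\<theta>\<close> of
  the population counterpart \<open>mean_cdf M X\<close> of \<open>U_stat\<close>.\<close>

definition V_term ::
    "nat \<Rightarrow> real \<Rightarrow> real \<Rightarrow> (nat \<Rightarrow> real) \<Rightarrow> (nat \<Rightarrow> real) \<Rightarrow> nat \<Rightarrow> nat \<Rightarrow> real" where
  "V_term n u \<theta> x e i j = (U_stat n x \<theta> - of_bool (e i + e j \<le> 0)) / u"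

definition sample_vec :: "nat \<Rightarrow> (nat \<Rightarrow> 'a \<Rightarrow> real) \<Rightarrow> 'a \<Rightarrow> nat \<Rightarrow> real" where
  "sample_vec n Y s = (\<lambda>i\<in>{1..n}. Y i s)"

definition data_algebra :: "'a measure \<Rightarrow> nat \<Rightarrow> (nat \<Rightarrow> 'a \<Rightarrow> real) \<Rightarrow> 'a measure" where
  "data_algebra M n X = vimage_algebra (space M) (sample_vec n X) (\<Pi>\<^sub>M i\<in>{1..n}. borel)"

definition cond_prob_data ::
    "'a measure \<Rightarrow> nat \<Rightarrow> (nat \<Rightarrow> 'a \<Rightarrow> real) \<Rightarrow> ('a \<Rightarrow> bool) \<Rightarrow> 'a \<Rightarrow> real" where
  "cond_prob_data M n X P =
     real_cond_exp M (data_algebra M n X) (indicator {s \<in> space M. P s})"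

text \<open>The random variables \<open>\<theta>s\<close> (the bootstrap estimator) and \<open>Binv\<close> (the reciprocal of the total
  weight) are prescribed only where at least two observations are selected; elsewhere they take
  arbitrary values.  The density assumption implies that \<open>F\<close> has derivative \<open>f\<close> only almost
  everywhere, so that (say) uniform or Laplace noise is admitted; \<open>cdf_deriv\<close> records this.\<close>

locale hl_bootstrap = prob_space M
  for M :: "'a measure" +
  fixes n :: nat
    and F f :: "real \<Rightarrow> real"
    and \<theta> :: real
    and X \<xi> \<omega> :: "nat \<Rightarrow> 'a \<Rightarrow> real"
    and \<theta>s Binv :: "'a \<Rightarrow> real"
  assumes n_ge_2: "n \<ge> 2"
    and X_eq: "\<And>i s. i \<in> {1..n} \<Longrightarrow> s \<in> space M \<Longrightarrow> X i s = \<theta> + \<xi> i s"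
    and noise_indep: "indep_vars (\<lambda>_. borel) \<xi> {1..n}"
    and noise_cdf: "\<And>i. i \<in> {1..n} \<Longrightarrow> cdf (distr M borel (\<xi> i)) = F"
    and noise_density: "\<And>i. i \<in> {1..n} \<Longrightarrow> distributed M lborel (\<xi> i) (\<lambda>t. ennreal (f t))"
    and density_nonneg: "\<And>t. f t \<ge> 0"
    and cdf_deriv: "AE t in lborel. (F has_real_derivative f t) (at t)"
    and pseudomedian_zero: "cdf_median (mean_cdf M \<xi>) = 0"
    and weights_indep: "indep_vars (\<lambda>_. borel) \<omega> {1..n}"
    and weights_0: "\<And>i. i \<in> {1..n} \<Longrightarrow> prob {s \<in> space M. \<omega> i s = 0} = 1 / 2"
    and weights_2: "\<And>i. i \<in> {1..n} \<Longrightarrow> prob {s \<in> space M. \<omega> i s = 2} = 1 / 2"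
    and data_weights_indep:
      "indep_var (\<Pi>\<^sub>M i\<in>{1..n}. borel) (sample_vec n X) (\<Pi>\<^sub>M i\<in>{1..n}. borel) (sample_vec n \<omega>)"
    and boot_est_measurable: "\<theta>s \<in> borel_measurable M"
    and boot_est_eq: "\<And>s. s \<in> space M \<Longrightarrow> card (selected n (\<lambda>i. \<omega> i s)) \<ge> 2 \<Longrightarrow>
        \<theta>s s = cdf_median (U_boot n (\<lambda>i. \<omega> i s) (\<lambda>i. X i s))"
    and Binv_measurable: "Binv \<in> borel_measurable M"
    and Binv_eq: "\<And>s. s \<in> space M \<Longrightarrow> card (selected n (\<lambda>i. \<omega> i s)) \<ge> 2 \<Longrightarrow>
        Binv s = 1 / weight_total n (\<lambda>i. \<omega> i s)"

end

theory Submission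
  imports Defs "HOL-Real_Asymp.Real_Asymp"
begin

text \<open>Both estimators are medians of step functions, \<open>\<theta>\<^sub>n\<close> of \<open>U_stat\<close> and
\<open>\<theta>\<^sup>*\<close> of \<open>U_boot\<close>, so everything rests on how these step functions move near
\<open>\<theta>\<close>. Write \<open>l = w + log n\<close>, \<open>q\<^sup>2 = l / n\<close>, \<open>p\<^sup>2 = z / n\<close>,
\<open>N = n (n - 1)\<close>, let \<open>B\<close> be the total bootstrap weight and \<open>U\<close> the distribution function of
\<open>(X\<^sub>1 + X\<^sub>2) / 2\<close>.

The rate \<open>1 / n\<close>, rather than the \<open>n powr (- 3 / 4)\<close> of an ordinary sample quantile, comes from the
averaging over pairs. In the Hoeffding decomposition of \<open>U_stat\<close> the linear part is a centred sum of functions that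
are Lipschitz in \<open>t\<close>, because the density is bounded, so its increment over a distance \<open>d\<close> is of order
\<open>d q\<close>; the indicators survive only in the degenerate part, which is of order \<open>l / n\<close>. The increments of
\<open>U_stat - U\<close> on a window around \<open>\<theta>\<close> are therefore of order \<open>d q + q\<^sup>2\<close>,
uniformly after a union bound over a grid of mesh \<open>1 / n\<close>. The degenerate part is controlled by
\<open>degenerate_chaos_tail\<close>: averaging over random bipartitions of the index set decouples the two arguments of the
kernel, and \<open>exp u \<le> u + exp (u\<^sup>2)\<close> reduces the decoupled form to squares of ordinary sums, which
Hoeffding's inequality handles.

Given the data, \<open>\<omega>\<^sub>i = 1 + \<epsilon>\<^sub>i\<close> with independent signs \<open>\<epsilon>\<^sub>i\<close>,
hence \<open>\<omega>\<^sub>i \<omega>\<^sub>j - 1 = \<epsilon>\<^sub>i + \<epsilon>\<^sub>j + \<epsilon>\<^sub>i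
\<epsilon>\<^sub>j\<close>, and the same two inequalities bound the weighted sums \<open>S t = (\<Sum>i\<noteq>j.
(\<omega>\<^sub>i \<omega>\<^sub>j - 1) (of_bool ((X\<^sub>i + X\<^sub>j) / 2 \<le> t) - 1 / 2))\<close>
(\<open>boot_score\<close>). The identity \<open>B (U_boot t - 1 / 2) = N (U_stat t - 1 / 2) + S t\<close> then does the rest. At
the two points \<open>\<theta>\<^sub>n \<plusminus> \<delta>\<close> with \<open>\<delta>\<close> of order \<open>q\<^sup>2 +
p\<close>, the slope of \<open>U\<close> beats \<open>S\<close>, which is the first assertion; no union bound over
\<open>t\<close> enters here, and this is why no \<open>sqrt (log n / n)\<close> appears. Near \<open>\<theta>\<^sup>*\<close> the
identity reads \<open>N U'(\<theta>) (\<theta>\<^sup>* - \<theta>\<^sub>n) + S \<theta> \<approx> 0\<close>, and exchanging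
\<open>1 / N\<close> for \<open>1 / B\<close> and \<open>1 / 2\<close> for \<open>U_stat \<theta>\<close> gives the second
assertion (\<open>bootstrap_comparison\<close>).

The comparison is deterministic for data satisfying \<open>regular_data\<close> and weights satisfying
\<open>regular_weights\<close>. The first property fails with probability at most a multiple of \<open>exp (- w)\<close>
(\<open>regular_data_probability\<close>), the second, for each fixed regular sample, with probability at most a multiple of
\<open>exp (- z)\<close> (\<open>irregular_weights_probability\<close>); since data and weights are independent,
\<open>cond_prob_le_of_indep_section\<close> turns the latter into a bound on the conditional probability.\<close>

section \<open>Exponential moments of bounded sums\<close>

text \<open>For a centred variable this trades \<open>E (exp u)\<close> for \<open>E (exp (u\<^sup>2))\<close>. Unlike Hoeffding's
lemma it keeps the size of \<open>u\<close> in mean square, which for sums over pairs is much smaller than the supremum.\<close>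

lemma exp_le_add_exp_square:
  fixes u :: real
  shows "exp u \<le> u + exp (u\<^sup>2)"
proof -
  have pos: "exp u \<le> u + exp (u\<^sup>2)" if "u \<ge> 0" for u :: real
  proof (cases "u \<le> 1")
    case True
    with that have "exp u \<le> 1 + u + u\<^sup>2" using exp_bound by blast
    moreover have "1 + u\<^sup>2 \<le> exp (u\<^sup>2)" by (rule exp_ge_add_one_self)
    ultimately show ?thesis by linarith
  next
    case False
    hence "u \<le> u\<^sup>2" by (simp add: power2_eq_square)
    hence "exp u \<le> exp (u\<^sup>2)" by simp
    thus ?thesis using that by linarith
  qed
  show ?thesis
  proof (cases "u \<ge> 0")
    case True thus ?thesis by (rule pos)
  next
    case False
    define v where "v = -u"
    have v: "v > 0" using False by (simp add: v_def)
    have "exp (-v) \<le> 1 - v + v\<^sup>2"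
    proof -
      have "(1 + v) * exp (-v) \<le> exp v * exp (-v)"
        by (intro mult_right_mono) (auto simp: exp_ge_add_one_self)
      hence "(1 + v) * exp (-v) \<le> 1" by (simp flip: exp_add)
      also have "1 \<le> (1 + v) * (1 - v + v\<^sup>2)"
        using v by (simp add: algebra_simps power2_eq_square power3_eq_cube)
      finally show ?thesis using v by simp
    qed
    moreover have "1 + v\<^sup>2 \<le> exp (v\<^sup>2)" by (rule exp_ge_add_one_self)
    ultimately have "exp (-v) \<le> -v + exp (v\<^sup>2)" by linarith
    thus ?thesis by (simp only: v_def power2_minus minus_minus)
  qed
qed

text \<open>Hoeffding's inequality for variables whose ranges have a common length, in the inverted form in which the confidence
level \<open>y\<close> is prescribed.\<close>

lemma (in prob_space) hoeffding_tail:
  fixes Y :: "'i \<Rightarrow> 'a \<Rightarrow> real"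
  assumes "finite I" "I \<noteq> {}" "indep_vars (\<lambda>_. borel) Y I"
    and "\<And>i s. i \<in> I \<Longrightarrow> s \<in> space M \<Longrightarrow> Y i s \<in> {a i..a i + D}"
    and "D > 0" "y \<ge> 0" "real (card I) \<le> N"
  shows "prob {s \<in> space M. \<bar>(\<Sum>i\<in>I. Y i s) - (\<Sum>i\<in>I. expectation (Y i))\<bar> \<ge> D * sqrt (N * y)}
           \<le> 2 * exp (- 2 * y)"
proof -
  interpret Hoeffding_ineq M I Y a "\<lambda>i. a i + D" "\<Sum>i\<in>I. expectation (Y i)"
    using assms(1,3,4) by unfold_locales auto
  have c: "card I > 0" using assms(1,2) by (simp add: card_gt_0_iff)
  have N: "N > 0" using c assms(7) by linarith
  have "prob {s \<in> space M. \<bar>(\<Sum>i\<in>I. Y i s) - (\<Sum>i\<in>I. expectation (Y i))\<bar> \<ge> D * sqrt (N * y)}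
      \<le> 2 * exp (-2 * (D * sqrt (N * y))\<^sup>2 / (\<Sum>i\<in>I. ((a i + D) - a i)\<^sup>2))"
    using assms(5,6) N c by (intro Hoeffding_ineq_abs_ge) auto
  also have "(-2 * (D * sqrt (N * y))\<^sup>2 / (\<Sum>i\<in>I. ((a i + D) - a i)\<^sup>2))
      = - 2 * ((N / card I) * y)"
    using assms(5,6) N c by (simp add: power_mult_distrib field_simps)
  also have "2 * exp (- 2 * ((N / card I) * y)) \<le> 2 * exp (- 2 * (1 * y))"
    using assms(6,7) c N by (intro mult_left_mono exp_le_cancel_iff[THEN iffD2] mult_left_mono_neg mult_right_mono) (auto simp: field_simps)
  finally show ?thesis by simp
qed

lemma indep_vars_coordinates:
  assumes "finite J" "\<And>i. prob_space (\<mu> i)"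
  shows "prob_space.indep_vars (PiM J \<mu>) \<mu> (\<lambda>j y. y j) J"
proof (cases "J = {}")
  case True
  interpret P: prob_space "PiM {} \<mu>" using assms(2) by (intro prob_space_PiM) auto
  show ?thesis unfolding True by (simp add: P.indep_vars_def2 P.indep_sets_def)
next
  case False
  interpret prob_space "PiM J \<mu>" using assms(2) by (intro prob_space_PiM) auto
  have "distr (PiM J \<mu>) (PiM J \<mu>) (\<lambda>y. \<lambda>j\<in>J. y j) = distr (PiM J \<mu>) (PiM J \<mu>) (\<lambda>y. y)"
    by (intro distr_cong) (auto simp: space_PiM)
  also have "\<dots> = PiM J \<mu>" by (rule distr_id)
  also have "\<dots> = PiM J (\<lambda>j. distr (PiM J \<mu>) (\<mu> j) (\<lambda>y. y j))"
    by (intro PiM_cong refl) (use assms in \<open>simp add: distr_PiM_component\<close>)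
  finally show ?thesis
    using False by (subst indep_vars_iff_distr_eq_PiM') auto
qed

text \<open>A sum of at most \<open>n\<close> centred variables bounded by 1 has Gaussian tails at scale \<open>sqrt n\<close>, so
the exponential of its square is integrable at a small enough multiple of \<open>1 / n\<close>.\<close>

lemma exp_square_moment:
  fixes h :: "'i \<Rightarrow> 'b \<Rightarrow> real"
  assumes "finite J" and prob: "\<And>i. prob_space (\<mu> i)"
    and meas: "\<And>j. j \<in> J \<Longrightarrow> h j \<in> borel_measurable (\<mu> j)"
    and bound: "\<And>j x. j \<in> J \<Longrightarrow> x \<in> space (\<mu> j) \<Longrightarrow> \<bar>h j x\<bar> \<le> 1"
    and centred: "\<And>j. j \<in> J \<Longrightarrow> (\<integral>x. h j x \<partial>\<mu> j) = 0"
    and n: "card J \<le> n" "n > 0"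
  shows "(\<integral>\<^sup>+y. ennreal (exp ((\<Sum>j\<in>J. h j (y j))\<^sup>2 / (4 * real n))) \<partial>PiM J \<mu>) \<le> 14"
proof (cases "J = {}")
  case True
  interpret P: prob_space "PiM J \<mu>" using prob by (intro prob_space_PiM) auto
  have "(\<integral>\<^sup>+y. 1 \<partial>PiM J \<mu>) \<le> 14"
    using P.emeasure_space_1 by simp
  thus ?thesis by (simp add: True)
next
  case False
  interpret P: prob_space "PiM J \<mu>" using prob by (intro prob_space_PiM) auto
  define Z where "Z = (\<lambda>y. \<Sum>j\<in>J. h j (y j))"
  have [measurable]: "(\<lambda>y. h j (y j)) \<in> borel_measurable (PiM J \<mu>)" if "j \<in> J" for j
    by (rule measurable_compose[OF measurable_component_singleton[of j J \<mu>, OF that] meas[OF that]])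
  have [measurable]: "Z \<in> borel_measurable (PiM J \<mu>)"
    unfolding Z_def by measurable
  have ind: "P.indep_vars (\<lambda>_. borel) (\<lambda>j y. h j (y j)) J"
    using indep_vars_coordinates[OF assms(1) prob] meas
    by (rule P.indep_vars_compose2) auto
  have E0: "P.expectation (\<lambda>y. h j (y j)) = 0" if "j \<in> J" for j
  proof -
    have "P.expectation (\<lambda>y. h j (y j)) = (\<integral>x. h j x \<partial>distr (PiM J \<mu>) (\<mu> j) (\<lambda>y. y j))"
      using that meas[OF that] by (subst integral_distr) auto
    also have "\<dots> = 0" using that centred assms(1) prob by (subst distr_PiM_component) auto
    finally show ?thesis .
  qed
  have Zbd: "\<bar>Z y\<bar> \<le> real n" if "y \<in> space (PiM J \<mu>)" for y
  proof -
    have "\<bar>Z y\<bar> \<le> (\<Sum>j\<in>J. \<bar>h j (y j)\<bar>)" unfolding Z_def by (rule sum_abs)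
    also have "\<dots> \<le> (\<Sum>j\<in>J. 1)" using that by (intro sum_mono bound) (auto simp: space_PiM)
    also have "\<dots> \<le> real n" using n by simp
    finally show ?thesis .
  qed
  have tail: "P.prob {y \<in> space (PiM J \<mu>). (Z y)\<^sup>2 \<ge> real k * real n} \<le> 2 * exp (- real k / 2)" for k
  proof -
    have "P.prob {y \<in> space (PiM J \<mu>). (Z y)\<^sup>2 \<ge> real k * real n}
        \<le> P.prob {y \<in> space (PiM J \<mu>). \<bar>Z y - (\<Sum>j\<in>J. P.expectation (\<lambda>y. h j (y j)))\<bar> \<ge> 2 * sqrt (real n * (k / 4))}"
    proof (rule P.finite_measure_mono)
      show "{y \<in> space (PiM J \<mu>). (Z y)\<^sup>2 \<ge> real k * real n} \<subseteq>
        {y \<in> space (PiM J \<mu>). \<bar>Z y - (\<Sum>j\<in>J. P.expectation (\<lambda>y. h j (y j)))\<bar> \<ge> 2 * sqrt (real n * (k / 4))}"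
      proof safe
        fix y assume "real k * real n \<le> (Z y)\<^sup>2"
        hence "sqrt (real k * real n) \<le> \<bar>Z y\<bar>" by (simp add: real_le_rsqrt real_sqrt_le_iff flip: real_sqrt_abs)
        moreover have "2 * sqrt (real n * (k / 4)) = sqrt (real k * real n)"
          by (simp add: real_sqrt_divide real_sqrt_mult)
        ultimately show "2 * sqrt (real n * (k / 4)) \<le> \<bar>Z y - (\<Sum>j\<in>J. P.expectation (\<lambda>y. h j (y j)))\<bar>"
          by (simp add: E0)
      qed
    qed measurable
    also have "\<dots> \<le> 2 * exp (- 2 * (k / 4))"
      unfolding Z_def
    proof (rule P.hoeffding_tail[OF assms(1) False ind, where a = "\<lambda>_. -1" and D = 2])
      fix i s assume "i \<in> J" "s \<in> space (PiM J \<mu>)"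
      hence "\<bar>h i (s i)\<bar> \<le> 1" by (intro bound) (auto simp: space_PiM)
      thus "h i (s i) \<in> {-1..-1 + 2}" by auto
    qed (use n in auto)
    finally show ?thesis by simp
  qed
  \<comment> \<open>The range of \<open>Z\<^sup>2\<close> is cut into shells of width \<open>n\<close>; the tail \<open>exp (- k /
    2)\<close> of the \<open>k\<close>-th shell beats the value \<open>exp ((k + 1) / 4)\<close> on it.\<close>
  have "(\<integral>\<^sup>+y. ennreal (exp ((Z y)\<^sup>2 / (4 * real n))) \<partial>PiM J \<mu>)
     \<le> (\<integral>\<^sup>+y. (\<Sum>k\<le>n. ennreal (exp ((real k + 1) / 4)) *
            indicator {y \<in> space (PiM J \<mu>). (Z y)\<^sup>2 \<ge> real k * real n} y) \<partial>PiM J \<mu>)"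
  proof (rule nn_integral_mono)
    fix y assume y: "y \<in> space (PiM J \<mu>)"
    define k where "k = nat \<lfloor>(Z y)\<^sup>2 / real n\<rfloor>"
    have k1: "real k \<le> (Z y)\<^sup>2 / real n" "(Z y)\<^sup>2 / real n \<le> real k + 1"
      unfolding k_def using n by (auto simp: nat_le_iff)
    have "(Z y)\<^sup>2 \<le> (real n)\<^sup>2" using Zbd[OF y] by (simp add: abs_le_square_iff[symmetric])
    hence "(Z y)\<^sup>2 / real n \<le> real n" using n by (simp add: field_simps power2_eq_square)
    hence kn: "k \<le> n" using k1 by linarith
    have "ennreal (exp ((Z y)\<^sup>2 / (4 * real n))) \<le> ennreal (exp ((real k + 1) / 4)) *
            indicator {y \<in> space (PiM J \<mu>). (Z y)\<^sup>2 \<ge> real k * real n} y"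
      using k1 y n by (auto simp: field_simps intro!: ennreal_leI)
    also have "\<dots> \<le> (\<Sum>k\<le>n. ennreal (exp ((real k + 1) / 4)) *
            indicator {y \<in> space (PiM J \<mu>). (Z y)\<^sup>2 \<ge> real k * real n} y)"
      using kn by (intro member_le_sum[where f = "\<lambda>k. ennreal (exp ((real k + 1) / 4)) *
            indicator {y \<in> space (PiM J \<mu>). (Z y)\<^sup>2 \<ge> real k * real n} y"]) auto
    finally show "ennreal (exp ((Z y)\<^sup>2 / (4 * real n))) \<le> (\<Sum>k\<le>n. ennreal (exp ((real k + 1) / 4)) *
            indicator {y \<in> space (PiM J \<mu>). (Z y)\<^sup>2 \<ge> real k * real n} y)" .
  qed
  also have "\<dots> = (\<Sum>k\<le>n. ennreal (exp ((real k + 1) / 4)) *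
      emeasure (PiM J \<mu>) {y \<in> space (PiM J \<mu>). (Z y)\<^sup>2 \<ge> real k * real n})"
    by (subst nn_integral_sum) (auto simp: nn_integral_cmult_indicator)
  also have "\<dots> \<le> (\<Sum>k\<le>n. ennreal (exp ((real k + 1) / 4)) * ennreal (2 * exp (- real k / 2)))"
    using tail by (intro sum_mono mult_left_mono) (auto simp: P.emeasure_eq_measure intro!: ennreal_leI)
  also have "\<dots> = ennreal (\<Sum>k\<le>n. exp ((real k + 1) / 4) * (2 * exp (- real k / 2)))"
    by (subst sum_ennreal[symmetric]) (auto simp: ennreal_mult)
  also have "(\<Sum>k\<le>n. exp ((real k + 1) / 4) * (2 * exp (- real k / 2)))
      = 2 * exp (1/4) * (\<Sum>k\<le>n. exp (- 1 / 4) ^ k)"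
    unfolding sum_distrib_left
    by (intro sum.cong refl) (simp add: exp_of_nat_mult[symmetric] exp_add[symmetric] field_simps)
  also have "\<dots> \<le> 14"
  proof -
    have e: "exp (1/4 :: real) \<le> 21/16"
      using exp_bound[of "1/4::real"] by (simp add: power2_eq_square)
    have e': "exp (-1/4 :: real) \<le> 4/5"
    proof -
      have "exp (1/4 :: real) \<ge> 5/4" using exp_ge_add_one_self[of "1/4 :: real"] by simp
      hence "inverse (exp (1/4 :: real)) \<le> inverse (5/4)" by (intro le_imp_inverse_le) auto
      thus ?thesis by (simp add: exp_minus[symmetric])
    qed
    have "(\<Sum>k\<le>n. exp (- 1 / 4 :: real) ^ k) \<le> 1 / (1 - exp (- 1 / 4))"
      by (subst sum_gp0) (auto simp: divide_right_mono)
    also have "\<dots> \<le> 5" using e' by (simp add: field_simps)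
    finally have "2 * exp (1/4) * (\<Sum>k\<le>n. exp (- 1 / 4 :: real) ^ k) \<le> 2 * (21/16) * 5"
      using e by (intro mult_mono mult_left_mono sum_nonneg) auto
    thus ?thesis by simp
  qed
  finally show ?thesis unfolding Z_def by (simp add: ennreal_leI)
qed

section \<open>Tails of degenerate quadratic forms\<close>

lemma finite_offdiag [simp]: "finite (offdiag n)"
  by (rule finite_subset[of _ "{1..n} \<times> {1..n}"]) (auto simp: offdiag_def)

lemma sum_offdiag:
  fixes a :: "nat \<Rightarrow> nat \<Rightarrow> 'b::comm_monoid_add"
  shows "(\<Sum>(i, j)\<in>offdiag n. a i j) = (\<Sum>i\<in>{1..n}. \<Sum>j\<in>{1..n} - {i}. a i j)"
proof -
  have "offdiag n = (SIGMA i:{1..n}. {1..n} - {i})" by (auto simp: offdiag_def)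
  thus ?thesis by (simp add: sum.Sigma)
qed

lemma measurable_sum_offdiag:
  assumes "\<And>i j. i \<in> {1..n} \<Longrightarrow> j \<in> {1..n} \<Longrightarrow> f i j \<in> borel_measurable N"
  shows "(\<lambda>s. \<Sum>(i, j)\<in>offdiag n. f i j s :: real) \<in> borel_measurable N"
  unfolding case_prod_unfold
  by (intro borel_measurable_sum assms) (auto simp: offdiag_def)

lemma card_subsets_separating:
  assumes "i \<in> K" "j \<in> K" "i \<noteq> j" "finite K"
  shows "4 * card {I \<in> Pow K. i \<in> I \<and> j \<notin> I} = 2 ^ card K"
proof -
  have "{I \<in> Pow K. i \<in> I \<and> j \<notin> I} = insert i ` Pow (K - {i, j})"
  proof (intro equalityI subsetI)
    fix I assume "I \<in> {I \<in> Pow K. i \<in> I \<and> j \<notin> I}"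
    thus "I \<in> insert i ` Pow (K - {i, j})" by (intro image_eqI[of _ _ "I - {i}"]) auto
  qed (use assms in auto)
  moreover have "inj_on (insert i) (Pow (K - {i, j}))"
    by (rule inj_onI) (auto simp: set_eq_iff)
  ultimately have "card {I \<in> Pow K. i \<in> I \<and> j \<notin> I} = 2 ^ card (K - {i, j})"
    using assms by (simp add: card_image card_Pow)
  moreover have "card K = card (K - {i, j}) + 2"
  proof -
    have "card {i, j} \<le> card K" using assms by (intro card_mono) auto
    moreover have "card (K - {i, j}) = card K - card {i, j}" using assms by (intro card_Diff_subset) auto
    ultimately show ?thesis using assms(3) by simp
  qed
  ultimately show ?thesis by (simp add: power_add)
qed

text \<open>Decoupling: an ordered pair of distinct indices is separated, first index inside and second outside, by a quarter of
all subsets. On each term of the average the two arguments of a kernel range over disjoint, hence independent, groups of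
variables.\<close>

lemma sum_offdiag_eq_average_bipartite:
  fixes a :: "nat \<Rightarrow> nat \<Rightarrow> real"
  shows "(\<Sum>(i, j)\<in>offdiag n. a i j)
           = (\<Sum>I\<in>Pow {1..n}. 1 / 2 ^ n * (4 * (\<Sum>i\<in>I. \<Sum>j\<in>{1..n} - I. a i j)))"
proof -
  have "(\<Sum>I\<in>Pow {1..n}. \<Sum>i\<in>I. \<Sum>j\<in>{1..n} - I. a i j)
      = (\<Sum>I\<in>Pow {1..n}. \<Sum>(i, j)\<in>offdiag n. of_bool (i \<in> I \<and> j \<notin> I) * a i j)"
  proof (rule sum.cong[OF refl])
    fix I assume I: "I \<in> Pow {1..n}"
    hence "finite I" using finite_subset by auto
    hence "(\<Sum>i\<in>I. \<Sum>j\<in>{1..n} - I. a i j) = (\<Sum>(i, j)\<in>I \<times> ({1..n} - I). a i j)"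
      by (simp add: sum.cartesian_product)
    also have "\<dots> = (\<Sum>(i, j)\<in>offdiag n. of_bool (i \<in> I \<and> j \<notin> I) * a i j)"
      using I by (intro sum.mono_neutral_cong_left finite_offdiag) (auto simp: offdiag_def)
    finally show "(\<Sum>i\<in>I. \<Sum>j\<in>{1..n} - I. a i j)
      = (\<Sum>(i, j)\<in>offdiag n. of_bool (i \<in> I \<and> j \<notin> I) * a i j)" .
  qed
  also have "\<dots> = (\<Sum>(i, j)\<in>offdiag n. \<Sum>I\<in>Pow {1..n}. of_bool (i \<in> I \<and> j \<notin> I) * a i j)"
    unfolding case_prod_unfold by (rule sum.swap)
  also have "\<dots> = (\<Sum>(i, j)\<in>offdiag n. 2 ^ n / 4 * a i j)"
  proof (intro sum.cong refl, clarify)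
    fix i j assume ij: "(i, j) \<in> offdiag n"
    hence "4 * card {I \<in> Pow {1..n}. i \<in> I \<and> j \<notin> I} = 2 ^ n"
      by (subst card_subsets_separating) (auto simp: offdiag_def)
    hence "4 * real (card {I \<in> Pow {1..n}. i \<in> I \<and> j \<notin> I}) = 2 ^ n"
      using arg_cong[of _ _ real] by fastforce
    moreover have "(\<Sum>I\<in>Pow {1..n}. of_bool (i \<in> I \<and> j \<notin> I) :: real)
        = real (card {I \<in> Pow {1..n}. i \<in> I \<and> j \<notin> I})"
      by (subst sum_of_bool_eq) (auto intro: arg_cong[of _ _ card])
    ultimately have "(\<Sum>I\<in>Pow {1..n}. of_bool (i \<in> I \<and> j \<notin> I) :: real) = 2 ^ n / 4" by simp
    thus "(\<Sum>I\<in>Pow {1..n}. of_bool (i \<in> I \<and> j \<notin> I) * a i j) = 2 ^ n / 4 * a i j"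
      by (simp flip: sum_distrib_right)
  qed
  also have "\<dots> = 2 ^ n / 4 * (\<Sum>(i, j)\<in>offdiag n. a i j)"
    by (simp only: sum_distrib_left case_prod_unfold)
  finally have "(\<Sum>(i, j)\<in>offdiag n. a i j)
      = 4 / 2 ^ n * (\<Sum>I\<in>Pow {1..n}. \<Sum>i\<in>I. \<Sum>j\<in>{1..n} - I. a i j)"
    by (simp add: field_simps case_prod_unfold)
  thus ?thesis by (simp only: sum_distrib_left) (simp add: mult.assoc)
qed

text \<open>Jensen's inequality for the uniform weights on \<open>I\<close>.\<close>

lemma exp_sum_le_average:
  fixes u :: "'i \<Rightarrow> real"
  assumes "finite I" "I \<noteq> {}"
  shows "exp (\<Sum>i\<in>I. u i) \<le> (\<Sum>i\<in>I. 1 / real (card I) * exp (real (card I) * u i))"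
proof -
  have c: "real (card I) > 0" using assms by (simp add: card_gt_0_iff)
  have "convex_on UNIV (\<lambda>x::real. exp x)"
    using convex_on_exp[of 1] by simp
  from convex_on_sum[OF assms this, of "\<lambda>_. 1 / real (card I)" "\<lambda>i. real (card I) * u i"]
  show ?thesis using c assms by (simp add: sum_distrib_left)
qed

text \<open>Fix the variables outside \<open>I\<close>. The sum then splits into independent terms, one for each \<open>i \<in>
I\<close>, which are centred by degeneracy in the first argument; \<open>exp u \<le> u + exp (u\<^sup>2)\<close> and Jensen's
inequality replace the product of their exponential moments by an average of exponentials of single squares. Now fix instead the
variable at \<open>i\<close>: by degeneracy in the second argument each square is the square of a sum of centred bounded
variables, and \<open>exp_square_moment\<close> applies.\<close>

lemma decoupled_chaos_exp_moment:
  fixes g :: "'i \<Rightarrow> 'i \<Rightarrow> 'b \<Rightarrow> 'b \<Rightarrow> real"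
  assumes prob: "\<And>i. prob_space (\<mu> i)"
    and IJ: "I \<inter> J = {}" "finite I" "finite J" "card I \<le> n" "card J \<le> n" "n > 0"
    and meas: "\<And>i j. i \<in> I \<Longrightarrow> j \<in> J \<Longrightarrow> (\<lambda>(x, y). g i j x y) \<in> borel_measurable (\<mu> i \<Otimes>\<^sub>M \<mu> j)"
    and bound: "\<And>i j x y. i \<in> I \<Longrightarrow> j \<in> J \<Longrightarrow> \<bar>g i j x y\<bar> \<le> 1"
    and deg1: "\<And>i j y. i \<in> I \<Longrightarrow> j \<in> J \<Longrightarrow> y \<in> space (\<mu> j) \<Longrightarrow> (\<integral>x. g i j x y \<partial>\<mu> i) = 0"
    and deg2: "\<And>i j x. i \<in> I \<Longrightarrow> j \<in> J \<Longrightarrow> x \<in> space (\<mu> i) \<Longrightarrow> (\<integral>y. g i j x y \<partial>\<mu> j) = 0"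
  shows "(\<integral>\<^sup>+x. ennreal (exp ((\<Sum>i\<in>I. \<Sum>j\<in>J. g i j (x i) (x j)) / (2 * real n))) \<partial>PiM (I \<union> J) \<mu>) \<le> 14"
proof (cases "I = {}")
  case True
  interpret P: prob_space "PiM J \<mu>" using prob by (intro prob_space_PiM) auto
  show ?thesis using P.emeasure_space_1 True by simp
next
  case False
  interpret product_sigma_finite \<mu>
    by (intro product_sigma_finite.intro prob_space_imp_sigma_finite prob)
  interpret PI: prob_space "PiM I \<mu>" using prob by (intro prob_space_PiM) auto
  define m where "m = real (card I)"
  have m: "m > 0" "m \<le> real n" using False IJ by (auto simp: m_def card_gt_0_iff)
  define G where "G = (\<lambda>i a y. \<Sum>j\<in>J. g i j a (y j))"
  define u where "u = (\<lambda>i a y. G i a y / (2 * real n))"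
  \<comment> \<open>The average over \<open>i\<close> that results from Jensen's inequality, as a function of all variables, so that it can
    be integrated in either order.\<close>
  define \<Phi> where "\<Phi> = (\<lambda>x. \<Sum>i\<in>I. ennreal (1 / m * exp ((G i (x i) x)\<^sup>2 / (4 * real n))))"
  have g_meas: "(\<lambda>z. g i j (p z) (q z)) \<in> borel_measurable N"
    if "i \<in> I" "j \<in> J" "p \<in> measurable N (\<mu> i)" "q \<in> measurable N (\<mu> j)" for i j p q and N :: "'b measure"
    using measurable_compose[OF measurable_Pair[OF that(3,4)] meas[OF that(1,2)]] by simp
  have g_meas_PiM: "(\<lambda>z. g i j (p z) (q z)) \<in> borel_measurable N"
    if "i \<in> I" "j \<in> J" "p \<in> measurable N (\<mu> i)" "q \<in> measurable N (\<mu> j)" for i j p q and N :: "('i \<Rightarrow> 'b) measure"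
    using measurable_compose[OF measurable_Pair[OF that(3,4)] meas[OF that(1,2)]] by simp
  have mG: "(\<lambda>x. G i (x i) x) \<in> borel_measurable (PiM (I \<union> J) \<mu>)" if "i \<in> I" for i
    unfolding G_def using that by (intro borel_measurable_sum g_meas_PiM measurable_component_singleton) auto
  have mG1: "(\<lambda>a. G i a y) \<in> borel_measurable (\<mu> i)" if "i \<in> I" "y \<in> space (PiM J \<mu>)" for i y
    unfolding G_def using that
    by (intro borel_measurable_sum g_meas measurable_ident_sets measurable_const) (auto simp: space_PiM)
  have mG2: "(\<lambda>x. G i (x i) y) \<in> borel_measurable (PiM I \<mu>)" if "i \<in> I" "y \<in> space (PiM J \<mu>)" for i y
    unfolding G_def using that
    by (intro borel_measurable_sum g_meas_PiM measurable_component_singleton measurable_const) (auto simp: space_PiM)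
  have Gbd: "\<bar>G i a y\<bar> \<le> real n" if "i \<in> I" for i a y
  proof -
    have "\<bar>G i a y\<bar> \<le> (\<Sum>j\<in>J. \<bar>g i j a (y j)\<bar>)" unfolding G_def by (rule sum_abs)
    also have "\<dots> \<le> (\<Sum>j\<in>J. 1)" using that by (intro sum_mono bound) auto
    finally show ?thesis using IJ by simp
  qed
  have merge_JI: "G i (merge J I (y, x) i) (merge J I (y, x)) = G i (x i) y" if "i \<in> I" for i x y
    unfolding G_def using that IJ by (intro sum.cong) (auto simp: merge_def)
  have merge_IJ: "G i (merge I J (x, y) i) (merge I J (x, y)) = G i (x i) y" if "i \<in> I" for i x y
    unfolding G_def using that IJ by (intro sum.cong) (auto simp: merge_def)
  have one: "(\<integral>\<^sup>+a. ennreal (exp (u i a y)) \<partial>\<mu> i) \<le> (\<integral>\<^sup>+a. ennreal (exp ((u i a y)\<^sup>2)) \<partial>\<mu> i)"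
    if i: "i \<in> I" and y: "y \<in> space (PiM J \<mu>)" for i y
  proof -
    interpret pi: prob_space "\<mu> i" by (rule prob)
    have [measurable]: "(\<lambda>a. u i a y) \<in> borel_measurable (\<mu> i)"
      unfolding u_def using mG1[OF i y] by measurable
    have ub: "\<bar>u i a y\<bar> \<le> 1" for a
      using Gbd[OF i, of a y] IJ(6) by (simp add: u_def abs_divide)
    have int1: "integrable (\<mu> i) (\<lambda>a. u i a y)"
      by (rule pi.integrable_const_bound[where B = 1]) (use ub in auto)
    have int2: "integrable (\<mu> i) (\<lambda>a. exp (u i a y))"
      by (rule pi.integrable_const_bound[where B = "exp 1"]) (use ub in \<open>auto simp: abs_le_iff\<close>)
    have int3: "integrable (\<mu> i) (\<lambda>a. exp ((u i a y)\<^sup>2))"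
      by (rule pi.integrable_const_bound[where B = "exp 1"]) (use ub in \<open>auto simp: abs_square_le_1\<close>)
    have gint: "integrable (\<mu> i) (\<lambda>a. g i j a (y j))" if "j \<in> J" for j
    proof (rule pi.integrable_const_bound[where B = 1])
      show "(\<lambda>a. g i j a (y j)) \<in> borel_measurable (\<mu> i)"
        using i that y by (intro g_meas measurable_ident_sets measurable_const) (auto simp: space_PiM)
    qed (use i that bound in auto)
    have "(\<integral>a. u i a y \<partial>\<mu> i) = (\<Sum>j\<in>J. \<integral>a. g i j a (y j) \<partial>\<mu> i) / (2 * real n)"
      unfolding u_def G_def using gint by simp
    also have "\<dots> = 0" using i y deg1 by (simp add: space_PiM PiE_iff)
    finally have z: "(\<integral>a. u i a y \<partial>\<mu> i) = 0" .
    have "(\<integral>a. exp (u i a y) \<partial>\<mu> i) \<le> (\<integral>a. u i a y + exp ((u i a y)\<^sup>2) \<partial>\<mu> i)"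
      using int1 int2 int3 by (intro integral_mono exp_le_add_exp_square) auto
    also have "\<dots> = (\<integral>a. exp ((u i a y)\<^sup>2) \<partial>\<mu> i)" using int1 int3 z by simp
    finally show ?thesis
      by (simp add: nn_integral_eq_integral int2 int3 ennreal_leI)
  qed
  have inner: "(\<integral>\<^sup>+x. ennreal (exp (\<Sum>i\<in>I. u i (x i) y)) \<partial>PiM I \<mu>)
       \<le> (\<integral>\<^sup>+x. \<Phi> (merge J I (y, x)) \<partial>PiM I \<mu>)" if y: "y \<in> space (PiM J \<mu>)" for y
  proof -
    have mu [measurable]: "(\<lambda>a. u i a y) \<in> borel_measurable (\<mu> i)" if "i \<in> I" for i
      unfolding u_def using mG1[OF that y] by measurable
    have "(\<integral>\<^sup>+x. ennreal (exp (\<Sum>i\<in>I. u i (x i) y)) \<partial>PiM I \<mu>)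
        = (\<integral>\<^sup>+x. (\<Prod>i\<in>I. ennreal (exp (u i (x i) y))) \<partial>PiM I \<mu>)"
      using IJ by (simp add: exp_sum prod_ennreal)
    also have "\<dots> = (\<Prod>i\<in>I. \<integral>\<^sup>+a. ennreal (exp (u i a y)) \<partial>\<mu> i)"
      using IJ by (subst product_nn_integral_prod) auto
    also have "\<dots> \<le> (\<Prod>i\<in>I. \<integral>\<^sup>+a. ennreal (exp ((u i a y)\<^sup>2)) \<partial>\<mu> i)"
      using one y by (intro prod_mono_ennreal) auto
    also have "\<dots> = (\<integral>\<^sup>+x. (\<Prod>i\<in>I. ennreal (exp ((u i (x i) y)\<^sup>2))) \<partial>PiM I \<mu>)"
      using IJ by (subst product_nn_integral_prod) auto
    also have "\<dots> = (\<integral>\<^sup>+x. ennreal (exp (\<Sum>i\<in>I. (u i (x i) y)\<^sup>2)) \<partial>PiM I \<mu>)"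
      using IJ by (simp add: exp_sum prod_ennreal)
    also have "\<dots> \<le> (\<integral>\<^sup>+x. \<Phi> (merge J I (y, x)) \<partial>PiM I \<mu>)"
    proof (rule nn_integral_mono)
      fix x
      have "exp (\<Sum>i\<in>I. (u i (x i) y)\<^sup>2) \<le> (\<Sum>i\<in>I. 1 / m * exp (m * (u i (x i) y)\<^sup>2))"
        unfolding m_def using IJ False by (intro exp_sum_le_average)
      also have "\<dots> \<le> (\<Sum>i\<in>I. 1 / m * exp ((G i (x i) y)\<^sup>2 / (4 * real n)))"
      proof (intro sum_mono mult_left_mono)
        fix i assume "i \<in> I"
        have "m * (u i (x i) y)\<^sup>2 \<le> real n * (u i (x i) y)\<^sup>2"
          using m by (intro mult_right_mono) auto
        also have "\<dots> = (G i (x i) y)\<^sup>2 / (4 * real n)"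
          using IJ(6) by (simp add: u_def power_divide power_mult_distrib field_simps power2_eq_square)
        finally show "exp (m * (u i (x i) y)\<^sup>2) \<le> exp ((G i (x i) y)\<^sup>2 / (4 * real n))" by simp
      qed (use m in auto)
      also have "\<dots> = (\<Sum>i\<in>I. 1 / m * exp ((G i (merge J I (y, x) i) (merge J I (y, x)))\<^sup>2 / (4 * real n)))"
        by (intro sum.cong refl) (simp add: merge_JI)
      finally show "ennreal (exp (\<Sum>i\<in>I. (u i (x i) y)\<^sup>2)) \<le> \<Phi> (merge J I (y, x))"
        unfolding \<Phi>_def using m by (subst sum_ennreal) (auto intro: ennreal_leI)
    qed
    finally show ?thesis .
  qed
  have m\<Phi>: "\<Phi> \<in> borel_measurable (PiM (I \<union> J) \<mu>)"
    unfolding \<Phi>_def using mG by measurable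
  have m\<Phi>': "\<Phi> \<in> borel_measurable (PiM (J \<union> I) \<mu>)"
    using m\<Phi> by (simp only: Un_commute)
  have mG': "(\<lambda>x. ennreal (exp (\<Sum>i\<in>I. G i (x i) x / (2 * real n)))) \<in> borel_measurable (PiM (J \<union> I) \<mu>)"
    unfolding Un_commute[of J I] using mG by measurable
  have "(\<integral>\<^sup>+x. ennreal (exp ((\<Sum>i\<in>I. \<Sum>j\<in>J. g i j (x i) (x j)) / (2 * real n))) \<partial>PiM (I \<union> J) \<mu>)
      = (\<integral>\<^sup>+x. ennreal (exp (\<Sum>i\<in>I. G i (x i) x / (2 * real n))) \<partial>PiM (J \<union> I) \<mu>)"
    unfolding G_def sum_divide_distrib Un_commute[of J I] ..
  also have "\<dots> = (\<integral>\<^sup>+y. \<integral>\<^sup>+x. ennreal (exp (\<Sum>i\<in>I. G i (merge J I (y, x) i) (merge J I (y, x)) / (2 * real n)))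
       \<partial>PiM I \<mu> \<partial>PiM J \<mu>)"
    using IJ mG' by (intro product_nn_integral_fold) auto
  also have "\<dots> = (\<integral>\<^sup>+y. \<integral>\<^sup>+x. ennreal (exp (\<Sum>i\<in>I. u i (x i) y)) \<partial>PiM I \<mu> \<partial>PiM J \<mu>)"
    by (intro nn_integral_cong arg_cong[of _ _ ennreal] arg_cong[of _ _ exp] sum.cong) (auto simp: merge_JI u_def)
  also have "\<dots> \<le> (\<integral>\<^sup>+y. \<integral>\<^sup>+x. \<Phi> (merge J I (y, x)) \<partial>PiM I \<mu> \<partial>PiM J \<mu>)"
    by (intro nn_integral_mono inner)
  also have "\<dots> = (\<integral>\<^sup>+x. \<Phi> x \<partial>PiM (I \<union> J) \<mu>)"
    unfolding Un_commute[of I J] using IJ m\<Phi>' by (intro product_nn_integral_fold[symmetric]) auto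
  also have "\<dots> = (\<integral>\<^sup>+x. \<integral>\<^sup>+y. \<Phi> (merge I J (x, y)) \<partial>PiM J \<mu> \<partial>PiM I \<mu>)"
    using IJ m\<Phi> by (intro product_nn_integral_fold) auto
  also have "\<dots> \<le> (\<integral>\<^sup>+x. 14 \<partial>PiM I \<mu>)"
  proof (rule nn_integral_mono)
    fix x assume x: "x \<in> space (PiM I \<mu>)"
    have mG3: "(\<lambda>y. G i (x i) y) \<in> borel_measurable (PiM J \<mu>)" if "i \<in> I" for i
      unfolding G_def using that x
      by (intro borel_measurable_sum g_meas_PiM measurable_component_singleton measurable_const) (auto simp: space_PiM)
    have e: "ennreal (1 / m * v) = ennreal (1 / m) * ennreal v" if "v \<ge> 0" for v
      using m that by (intro ennreal_mult) auto
    have "(\<integral>\<^sup>+y. \<Phi> (merge I J (x, y)) \<partial>PiM J \<mu>)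
        = (\<integral>\<^sup>+y. (\<Sum>i\<in>I. ennreal (1 / m) * ennreal (exp ((G i (x i) y)\<^sup>2 / (4 * real n)))) \<partial>PiM J \<mu>)"
      unfolding \<Phi>_def using m by (intro nn_integral_cong sum.cong refl) (simp only: merge_IJ e exp_ge_zero)
    also have "\<dots> = (\<Sum>i\<in>I. ennreal (1 / m) * (\<integral>\<^sup>+y. ennreal (exp ((G i (x i) y)\<^sup>2 / (4 * real n))) \<partial>PiM J \<mu>))"
      using mG3 by (subst nn_integral_sum) (auto simp: nn_integral_cmult)
    also have "\<dots> \<le> (\<Sum>i\<in>I. ennreal (1 / m) * 14)"
    proof (intro sum_mono mult_left_mono)
      fix i assume i: "i \<in> I"
      have xi: "x i \<in> space (\<mu> i)" using x i by (auto simp: space_PiM)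
      show "(\<integral>\<^sup>+y. ennreal (exp ((G i (x i) y)\<^sup>2 / (4 * real n))) \<partial>PiM J \<mu>) \<le> 14"
        unfolding G_def
      proof (rule exp_square_moment)
        fix j assume j: "j \<in> J"
        show "g i j (x i) \<in> borel_measurable (\<mu> j)"
          using i j xi g_meas[of i j "\<lambda>_. x i" "\<mu> j" "\<lambda>z. z"] by simp
      qed (use i IJ prob bound deg2 xi in auto)
    qed auto
    also have "\<dots> = (\<Sum>i\<in>I. ennreal (14 / m))"
      using e[of 14] by simp
    also have "\<dots> = 14" using m by (subst sum_ennreal) (auto simp: m_def)
    finally show "(\<integral>\<^sup>+y. \<Phi> (merge I J (x, y)) \<partial>PiM J \<mu>) \<le> 14" .
  qed
  also have "\<dots> = 14" by (simp add: PI.emeasure_space_1)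
  finally show ?thesis .
qed

lemma (in prob_space) degenerate_chaos_exp_moment:
  fixes X :: "nat \<Rightarrow> 'a \<Rightarrow> real" and g :: "nat \<Rightarrow> nat \<Rightarrow> real \<Rightarrow> real \<Rightarrow> real"
  assumes n: "n > 0" and ind: "indep_vars (\<lambda>_. borel) X {1..n}"
    and meas: "\<And>i j. (\<lambda>(x, y). g i j x y) \<in> borel_measurable (borel \<Otimes>\<^sub>M borel)"
    and bound: "\<And>i j x y. \<bar>g i j x y\<bar> \<le> 1"
    and deg1: "\<And>i j y. (i, j) \<in> offdiag n \<Longrightarrow> expectation (\<lambda>s. g i j (X i s) y) = 0"
    and deg2: "\<And>i j x. (i, j) \<in> offdiag n \<Longrightarrow> expectation (\<lambda>s. g i j x (X j s)) = 0"
  shows "(\<integral>\<^sup>+s. ennreal (exp ((\<Sum>(i, j)\<in>offdiag n. g i j (X i s) (X j s)) / (8 * real n))) \<partial>M) \<le> 14"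
proof -
  define \<mu> where "\<mu> = (\<lambda>i. if i \<in> {1..n} then distr M borel (X i) else return borel 0)"
  have X [measurable]: "X i \<in> borel_measurable M" if "i \<in> {1..n}" for i
    using ind that by (auto simp: indep_vars_def)
  have prob\<mu>: "prob_space (\<mu> i)" for i
    using X by (auto simp: \<mu>_def prob_space_distr prob_space_return)
  have [measurable_cong, simp]: "sets (\<mu> i) = sets borel" for i by (auto simp: \<mu>_def)
  have [simp]: "space (\<mu> i) = UNIV" for i by (auto simp: \<mu>_def)
  have g: "(\<lambda>z. g i j (p z) (q z)) \<in> borel_measurable N"
    if "p \<in> borel_measurable N" "q \<in> borel_measurable N" for i j p q and N :: "(nat \<Rightarrow> real) measure"
    using measurable_compose[OF measurable_Pair[OF that] meas[of i j]] by simp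
  have g1: "(\<lambda>x. g i j x y) \<in> borel_measurable borel" for i j y
    using measurable_compose[OF measurable_Pair[OF measurable_ident measurable_const] meas[of i j]] by simp
  have g2: "(\<lambda>y. g i j x y) \<in> borel_measurable borel" for i j x
    using measurable_compose[OF measurable_Pair[OF measurable_const measurable_ident] meas[of i j]] by simp
  have distr: "distr M (PiM {1..n} (\<lambda>_. borel)) (\<lambda>s. \<lambda>i\<in>{1..n}. X i s) = PiM {1..n} \<mu>"
  proof -
    have "distr M (PiM {1..n} (\<lambda>_. borel)) (\<lambda>s. \<lambda>i\<in>{1..n}. X i s) = PiM {1..n} (\<lambda>i. distr M borel (X i))"
      using n ind X by (subst indep_vars_iff_distr_eq_PiM'[symmetric]) auto
    also have "\<dots> = PiM {1..n} \<mu>" by (intro PiM_cong) (auto simp: \<mu>_def)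
    finally show ?thesis .
  qed
  have mS: "(\<lambda>x. \<Sum>(i, j)\<in>offdiag n. g i j (x i) (x j)) \<in> borel_measurable (Pi\<^sub>M {1..n} (\<lambda>_. borel))"
    by (rule measurable_sum_offdiag) (intro g measurable_component_singleton)
  \<comment> \<open>The factor 4 of the decoupling turns the scale \<open>8 n\<close> into \<open>2 n\<close>.\<close>
  define B where "B = (\<lambda>I x. (\<Sum>i\<in>I. \<Sum>j\<in>{1..n} - I. g i j (x i) (x j)) / (2 * real n))"
  have B: "B I \<in> borel_measurable (PiM {1..n} \<mu>)" if "I \<subseteq> {1..n}" for I
    unfolding B_def using that by (intro borel_measurable_divide borel_measurable_sum g) auto
  define E where "E = (\<lambda>x. ennreal (exp ((\<Sum>(i, j)\<in>offdiag n. g i j (x i) (x j)) / (8 * real n))))"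
  have mE: "E \<in> borel_measurable (Pi\<^sub>M {1..n} (\<lambda>_. borel))"
    unfolding E_def using mS by measurable
  have "(\<integral>\<^sup>+s. ennreal (exp ((\<Sum>(i, j)\<in>offdiag n. g i j (X i s) (X j s)) / (8 * real n))) \<partial>M)
      = (\<integral>\<^sup>+s. E (\<lambda>i\<in>{1..n}. X i s) \<partial>M)"
    unfolding E_def
    by (intro nn_integral_cong arg_cong[of _ _ ennreal] arg_cong[of _ _ exp] arg_cong2[of _ _ _ _ "(/)"] sum.cong refl)
       (auto simp: offdiag_def)
  also have "\<dots> = (\<integral>\<^sup>+x. E x \<partial>PiM {1..n} \<mu>)"
    unfolding distr[symmetric] using mE X
    by (intro nn_integral_distr[symmetric] measurable_restrict) auto
  also have "\<dots> \<le> (\<integral>\<^sup>+x. (\<Sum>I\<in>Pow {1..n}. ennreal (1 / 2 ^ n) * ennreal (exp (B I x))) \<partial>PiM {1..n} \<mu>)"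
    unfolding E_def
  proof (rule nn_integral_mono)
    fix x
    have "(\<Sum>(i, j)\<in>offdiag n. g i j (x i) (x j)) / (8 * real n) = (\<Sum>I\<in>Pow {1..n}. 1 / 2 ^ n * B I x)"
      using n by (subst sum_offdiag_eq_average_bipartite) (simp add: B_def sum_divide_distrib field_simps)
    also have "exp \<dots> \<le> (\<Sum>I\<in>Pow {1..n}. 1 / 2 ^ n * exp (B I x))"
    proof -
      have "Pow {1..n} \<noteq> {}" by blast
      from exp_sum_le_average[OF _ this, of "\<lambda>I. 1 / 2 ^ n * B I x"]
      show ?thesis by (simp add: card_Pow)
    qed
    finally show "ennreal (exp ((\<Sum>(i, j)\<in>offdiag n. g i j (x i) (x j)) / (8 * real n)))
        \<le> (\<Sum>I\<in>Pow {1..n}. ennreal (1 / 2 ^ n) * ennreal (exp (B I x)))"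
      by (simp flip: ennreal_mult' add: sum_ennreal ennreal_leI)
  qed
  also have "\<dots> = (\<Sum>I\<in>Pow {1..n}. ennreal (1 / 2 ^ n) * (\<integral>\<^sup>+x. ennreal (exp (B I x)) \<partial>PiM {1..n} \<mu>))"
    using B by (subst nn_integral_sum) (auto simp: nn_integral_cmult)
  also have "\<dots> \<le> (\<Sum>I\<in>Pow {1..n}. ennreal (1 / 2 ^ n) * 14)"
  proof (intro sum_mono mult_left_mono)
    fix I assume I: "I \<in> Pow {1..n}"
    have un: "I \<union> ({1..n} - I) = {1..n}" using I by auto
    have fin: "finite I" using I finite_subset by auto
    have off: "(i, j) \<in> offdiag n" if "i \<in> I" "j \<in> {1..n} - I" for i j
      using that I by (auto simp: offdiag_def)
    have "(\<integral>\<^sup>+x. ennreal (exp ((\<Sum>i\<in>I. \<Sum>j\<in>{1..n} - I. g i j (x i) (x j)) / (2 * real n)))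
        \<partial>PiM (I \<union> ({1..n} - I)) \<mu>) \<le> 14"
    proof (rule decoupled_chaos_exp_moment[OF prob\<mu>])
      show "card I \<le> n" using I card_mono[of "{1..n}" I] by auto
      show "card ({1..n} - I) \<le> n" using card_mono[of "{1..n}" "{1..n} - I"] by auto
    next
      fix i j assume "i \<in> I" "j \<in> {1..n} - I"
      show "(\<lambda>(x, y). g i j x y) \<in> borel_measurable (\<mu> i \<Otimes>\<^sub>M \<mu> j)"
        using meas[of i j] by (simp cong: measurable_cong_sets)
    next
      fix i j and y :: real assume ij: "i \<in> I" "j \<in> {1..n} - I"
      hence "i \<in> {1..n}" using I by auto
      thus "(\<integral>x. g i j x y \<partial>\<mu> i) = 0"
        using deg1[OF off[OF ij]] g1 by (simp add: \<mu>_def integral_distr)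
    next
      fix i j and x :: real assume ij: "i \<in> I" "j \<in> {1..n} - I"
      thus "(\<integral>y. g i j x y \<partial>\<mu> j) = 0"
        using deg2[OF off[OF ij]] g2 by (simp add: \<mu>_def integral_distr)
    qed (use fin n bound in auto)
    thus "(\<integral>\<^sup>+x. ennreal (exp (B I x)) \<partial>PiM {1..n} \<mu>) \<le> 14"
      unfolding B_def un .
  qed auto
  also have "\<dots> = (\<Sum>I\<in>Pow {1..n}. ennreal (14 / 2 ^ n))"
    by (intro sum.cong refl) (simp flip: ennreal_mult' ennreal_numeral)
  also have "\<dots> = 14" by (subst sum_ennreal) (auto simp: card_Pow)
  finally show ?thesis .
qed

text \<open>The tail is exponential in \<open>y\<close> at scale \<open>n y\<close>, whereas for a form that is not degenerate the
scale would be \<open>n * sqrt (n y)\<close>. The kernels may depend on the pair of indices, so that the statement covers both the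
degenerate part of a U-statistic and quadratic forms in random signs with fixed coefficients.\<close>

lemma (in prob_space) degenerate_chaos_tail:
  fixes X :: "nat \<Rightarrow> 'a \<Rightarrow> real" and g :: "nat \<Rightarrow> nat \<Rightarrow> real \<Rightarrow> real \<Rightarrow> real"
  assumes n: "n > 0" and ind: "indep_vars (\<lambda>_. borel) X {1..n}"
    and meas: "\<And>i j. (\<lambda>(x, y). g i j x y) \<in> borel_measurable (borel \<Otimes>\<^sub>M borel)"
    and bound: "\<And>i j x y. \<bar>g i j x y\<bar> \<le> 1"
    and deg1: "\<And>i j y. (i, j) \<in> offdiag n \<Longrightarrow> expectation (\<lambda>s. g i j (X i s) y) = 0"
    and deg2: "\<And>i j x. (i, j) \<in> offdiag n \<Longrightarrow> expectation (\<lambda>s. g i j x (X j s)) = 0"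
  shows "prob {s \<in> space M. \<bar>\<Sum>(i, j)\<in>offdiag n. g i j (X i s) (X j s)\<bar> \<ge> 8 * real n * y} \<le> 28 * exp (- y)"
proof -
  have X [measurable]: "X i \<in> borel_measurable M" if "i \<in> {1..n}" for i
    using ind that by (auto simp: indep_vars_def)
  have one: "{s \<in> space M. (\<Sum>(i, j)\<in>offdiag n. h i j (X i s) (X j s)) \<ge> 8 * real n * y} \<in> events \<and>
     prob {s \<in> space M. (\<Sum>(i, j)\<in>offdiag n. h i j (X i s) (X j s)) \<ge> 8 * real n * y} \<le> 14 * exp (- y)"
    if meas: "\<And>i j. (\<lambda>(x, y). h i j x y) \<in> borel_measurable (borel \<Otimes>\<^sub>M borel)"
    and bound: "\<And>i j x y. \<bar>h i j x y\<bar> \<le> 1"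
    and deg1: "\<And>i j y. (i, j) \<in> offdiag n \<Longrightarrow> expectation (\<lambda>s. h i j (X i s) y) = 0"
    and deg2: "\<And>i j x. (i, j) \<in> offdiag n \<Longrightarrow> expectation (\<lambda>s. h i j x (X j s)) = 0"
    for h :: "nat \<Rightarrow> nat \<Rightarrow> real \<Rightarrow> real \<Rightarrow> real"
  proof -
    define Q where "Q = (\<lambda>s. \<Sum>(i, j)\<in>offdiag n. h i j (X i s) (X j s))"
    have [measurable]: "Q \<in> borel_measurable M"
      unfolding Q_def
    proof (rule measurable_sum_offdiag)
      fix i j assume "i \<in> {1..n}" "j \<in> {1..n}"
      thus "(\<lambda>s. h i j (X i s) (X j s)) \<in> borel_measurable M"
        using measurable_compose[OF measurable_Pair[of "X i" M borel "X j" borel] meas[of i j]] X by auto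
    qed
    have set_eq: "{s \<in> space M. 1 \<le> ennreal (exp (- y)) * ennreal (exp (Q s / (8 * real n)))}
        = {s \<in> space M. Q s \<ge> 8 * real n * y}"
    proof (intro Collect_cong conj_cong refl)
      fix s
      have "ennreal (exp (- y)) * ennreal (exp (Q s / (8 * real n))) = ennreal (exp (- y + Q s / (8 * real n)))"
        by (simp only: exp_add ennreal_mult' exp_ge_zero)
      moreover have "0 \<le> - y + Q s / (8 * real n) \<longleftrightarrow> 8 * real n * y \<le> Q s"
        using n by (simp add: field_simps)
      ultimately show "1 \<le> ennreal (exp (- y)) * ennreal (exp (Q s / (8 * real n))) \<longleftrightarrow> 8 * real n * y \<le> Q s"
        by (simp only: ennreal_ge_1 one_le_exp_iff)
    qed
    have "(\<integral>\<^sup>+s. ennreal (exp (Q s / (8 * real n))) * indicator (space M) s \<partial>M)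
        = (\<integral>\<^sup>+s. ennreal (exp (Q s / (8 * real n))) \<partial>M)"
      by (intro nn_integral_cong) simp
    also have "\<dots> \<le> ennreal 14" unfolding Q_def
      using degenerate_chaos_exp_moment[OF n ind that] by simp
    finally have le: "(\<integral>\<^sup>+s. ennreal (exp (Q s / (8 * real n))) * indicator (space M) s \<partial>M) \<le> ennreal 14" .
    have "emeasure M {s \<in> space M. 1 \<le> ennreal (exp (- y)) * ennreal (exp (Q s / (8 * real n)))}
        \<le> ennreal (exp (- y)) * (\<integral>\<^sup>+s. ennreal (exp (Q s / (8 * real n))) * indicator (space M) s \<partial>M)"
      by (rule nn_integral_Markov_inequality) auto
    also have "\<dots> \<le> ennreal (exp (- y)) * ennreal 14" by (rule mult_left_mono[OF le]) simp
    also have "\<dots> = ennreal (exp (- y) * 14)" by (rule ennreal_mult[symmetric]) auto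
    finally have "prob {s \<in> space M. Q s \<ge> 8 * real n * y} \<le> 14 * exp (- y)"
      unfolding set_eq emeasure_eq_measure by (simp add: mult.commute)
    moreover have "{s \<in> space M. Q s \<ge> 8 * real n * y} \<in> events" by measurable
    ultimately show ?thesis unfolding Q_def by (intro conjI)
  qed
  define Q where "Q = (\<lambda>s. \<Sum>(i, j)\<in>offdiag n. g i j (X i s) (X j s))"
  have 1: "{s \<in> space M. Q s \<ge> 8 * real n * y} \<in> events \<and> prob {s \<in> space M. Q s \<ge> 8 * real n * y} \<le> 14 * exp (- y)"
    unfolding Q_def by (rule one[OF meas bound deg1 deg2])
  have 2: "{s \<in> space M. - Q s \<ge> 8 * real n * y} \<in> events \<and> prob {s \<in> space M. - Q s \<ge> 8 * real n * y} \<le> 14 * exp (- y)"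
  proof -
    have neg: "- Q s = (\<Sum>(i, j)\<in>offdiag n. - g i j (X i s) (X j s))" for s
      unfolding Q_def case_prod_unfold by (rule sum_negf[symmetric])
    have m: "(\<lambda>(x, y). - g i j x y) \<in> borel_measurable (borel \<Otimes>\<^sub>M borel)" for i j
      using borel_measurable_uminus[OF meas[of i j]] by (simp add: case_prod_unfold)
    show ?thesis unfolding neg by (rule one[OF m]) (simp_all add: bound deg1 deg2)
  qed
  have "{s \<in> space M. \<bar>Q s\<bar> \<ge> 8 * real n * y}
      = {s \<in> space M. Q s \<ge> 8 * real n * y} \<union> {s \<in> space M. - Q s \<ge> 8 * real n * y}" by auto
  also have "prob \<dots> \<le> prob {s \<in> space M. Q s \<ge> 8 * real n * y} + prob {s \<in> space M. - Q s \<ge> 8 * real n * y}"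
    using 1 2 by (intro measure_Un_le conjunct1[OF 1] conjunct1[OF 2])
  finally have "prob {s \<in> space M. \<bar>Q s\<bar> \<ge> 8 * real n * y} \<le> 28 * exp (- y)" using 1 2 by linarith
  thus ?thesis unfolding Q_def .
qed

section \<open>Regular samples\<close>

definition incr_const :: "real \<Rightarrow> real" where
  "incr_const L = 64 + 16 * L"

text \<open>What the analysis of the bootstrap uses about a sample. The first clause bounds the increments of \<open>U_stat -
U\<close> on the window of radius \<open>c\<close>, the second the error at its centre, and the third says that for each
\<open>i\<close> the number of pair means \<open>(x\<^sub>i + x\<^sub>j) / 2\<close> in an interval is at most of the order of its
expectation plus the fluctuation \<open>n q\<close> of the empirical distribution function.\<close>

definition regular_data ::
    "nat \<Rightarrow> (real \<Rightarrow> real) \<Rightarrow> real \<Rightarrow> real \<Rightarrow> real \<Rightarrow> real \<Rightarrow> (nat \<Rightarrow> real) \<Rightarrow> bool" where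
  "regular_data n U \<theta> c L q x \<longleftrightarrow>
     (\<forall>s t. \<theta> - c \<le> s \<longrightarrow> s \<le> t \<longrightarrow> t \<le> \<theta> + c \<longrightarrow>
        \<bar>U_stat n x t - U_stat n x s - (U t - U s)\<bar> \<le> incr_const L * ((t - s) * q + q\<^sup>2)) \<and>
     \<bar>U_stat n x \<theta> - 1 / 2\<bar> \<le> 34 * q \<and>
     (\<forall>i\<in>{1..n}. \<forall>s t. s \<le> t \<longrightarrow>
        (\<Sum>j\<in>{1..n} - {i}. of_bool ((x i + x j) / 2 \<le> t) - of_bool ((x i + x j) / 2 \<le> s))
          \<le> 2 * L * real n * (t - s) + 4 * real n * q)"

definition window_grid :: "nat \<Rightarrow> real \<Rightarrow> real \<Rightarrow> nat \<Rightarrow> real" where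
  "window_grid n \<theta> c k = \<theta> + c * (real k - real n) / real n"

lemma window_grid_mono:
  assumes "c > 0" "n > 0" "k \<le> l"
  shows "window_grid n \<theta> c k \<le> window_grid n \<theta> c l"
  using assms by (simp add: window_grid_def divide_right_mono)

lemma window_grid_Suc:
  "window_grid n \<theta> c (Suc k) = window_grid n \<theta> c k + c / real n"
  by (simp add: window_grid_def add_divide_distrib[symmetric] diff_divide_distrib[symmetric] algebra_simps)

lemma window_grid_bracket:
  assumes "c > 0" "n > 0" "\<theta> - c \<le> t" "t \<le> \<theta> + c"
  obtains k where "k < 2 * n" "window_grid n \<theta> c k \<le> t" "t \<le> window_grid n \<theta> c (Suc k)"
proof -
  define r where "r = (t - \<theta> + c) * real n / c"
  have "0 \<le> (t - \<theta> + c) * real n" using assms by simp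
  moreover have "(t - \<theta> + c) * real n \<le> (2 * c) * real n" using assms by (intro mult_right_mono) auto
  ultimately have r: "0 \<le> r" "r \<le> 2 * real n" using assms by (auto simp: r_def field_simps)
  have t: "t = \<theta> + c * (r - real n) / real n" using assms by (simp add: r_def field_simps)
  show ?thesis
  proof (cases "r < 2 * real n")
    case True
    define k where "k = nat \<lfloor>r\<rfloor>"
    have k: "real k \<le> r" "r \<le> real (Suc k)" unfolding k_def using r by linarith+
    have "k < 2 * n" using True k(1) by linarith
    moreover have "window_grid n \<theta> c k \<le> t" "t \<le> window_grid n \<theta> c (Suc k)"
      unfolding window_grid_def t using k assms
      by (auto intro!: divide_right_mono mult_left_mono)
    ultimately show ?thesis using that by blast
  next
    case False
    hence "r = 2 * real n" using r by simp
    hence "t = window_grid n \<theta> c (Suc (2 * n - 1))"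
      using assms t by (simp add: window_grid_def)
    moreover have "window_grid n \<theta> c (2 * n - 1) \<le> window_grid n \<theta> c (Suc (2 * n - 1))"
      using assms by (intro window_grid_mono) auto
    ultimately show ?thesis using that[of "2 * n - 1"] assms by auto
  qed
qed

text \<open>An empirical distribution function and a distribution function \<open>G\<close> are both monotone, so closeness at the
quantiles of \<open>G\<close> of order \<open>k / n\<close> spreads to the whole line at the price of one further unit of
count.\<close>

lemma count_close_of_quantiles:
  fixes G :: "real \<Rightarrow> real" and x :: "nat \<Rightarrow> real"
  assumes n: "n > 0" and G: "mono G" "\<And>t. 0 \<le> G t" "\<And>t. G t \<le> 1"
    and a: "\<And>k. k \<in> {1..<n} \<Longrightarrow> G (a k) = real k / real n"
    and close: "\<And>k. k \<in> {1..<n} \<Longrightarrow> \<bar>(\<Sum>j\<in>{1..n}. of_bool (x j \<le> a k)) - real k\<bar> \<le> e"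
    and e: "e \<ge> 0"
  shows "\<bar>(\<Sum>j\<in>{1..n}. of_bool (x j \<le> t)) - real n * G t\<bar> \<le> e + 1"
proof -
  define C where "C = (\<lambda>t. \<Sum>j\<in>{1..n}. of_bool (x j \<le> t) :: real)"
  have Cmono: "C s \<le> C t" if "s \<le> t" for s t
    unfolding C_def using that by (intro sum_mono) auto
  have C0: "0 \<le> C t" for t unfolding C_def by (intro sum_nonneg) auto
  have Cn: "C t \<le> real n" for t
    unfolding C_def using sum_mono[of "{1..n}" "\<lambda>j. of_bool (x j \<le> t) :: real" "\<lambda>_. 1"] by simp
  have less: "s < t" if "G s < G t" for s t
    using that G(1) by (meson leD leI monoD)
  have nG: "0 \<le> real n * G t" "real n * G t \<le> real n" using G(2,3)[of t] by (auto simp: mult_left_le)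
  have "C t \<le> real n * G t + 1 + e"
  proof (cases "real n * G t < real n - 1")
    case True
    \<comment> \<open>the next quantile to the right of \<open>t\<close>\<close>
    define m where "m = nat \<lfloor>real n * G t\<rfloor> + 1"
    have m: "real m \<le> real n * G t + 1" "real n * G t < real m" unfolding m_def using nG by linarith+
    hence mn: "m \<in> {1..<n}" using True by (auto simp: m_def)
    have "G t < G (a m)" using m n by (simp add: a[OF mn] field_simps)
    hence "C t \<le> C (a m)" using less Cmono by (simp add: less_imp_le)
    also have "\<dots> \<le> real m + e" using close[OF mn] by (simp add: C_def)
    finally show ?thesis using m by linarith
  next
    case False thus ?thesis using Cn[of t] e by linarith
  qed
  moreover have "C t \<ge> real n * G t - 1 - e"
  proof (cases "real n * G t \<le> 1")
    case True thus ?thesis using C0[of t] e by linarith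
  next
    case False
    \<comment> \<open>the last quantile strictly to the left of \<open>t\<close>; the rounding keeps it strict when \<open>G t\<close> is a
      multiple of \<open>1 / n\<close>\<close>
    define m where "m = nat (\<lceil>real n * G t\<rceil> - 1)"
    have m: "real m \<ge> real n * G t - 1" "real m < real n * G t" unfolding m_def using False by linarith+
    hence mn: "m \<in> {1..<n}" using False nG by (auto simp: Suc_le_eq) 
    have "G (a m) < G t" using m n by (simp add: a[OF mn] field_simps)
    hence "C (a m) \<le> C t" using less Cmono by (simp add: less_imp_le)
    moreover have "C (a m) \<ge> real m - e" using close[OF mn] by (simp add: C_def)
    ultimately show ?thesis using m by linarith
  qed
  ultimately show ?thesis unfolding C_def by linarith
qed

text \<open>The degenerate part of the indicator kernel: with \<open>G\<close> the distribution function of one observation and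
\<open>U\<close> that of the mean of two, its expectation over either argument vanishes.\<close>

definition hoeffding_kernel :: "(real \<Rightarrow> real) \<Rightarrow> (real \<Rightarrow> real) \<Rightarrow> real \<Rightarrow> real \<Rightarrow> real \<Rightarrow> real" where
  "hoeffding_kernel G U t x y = of_bool ((x + y) / 2 \<le> t) - G (2 * t - x) - G (2 * t - y) + U t"

lemma hoeffding_decomposition:
  assumes "n \<ge> 2"
  shows "real n * (real n - 1) * (U_stat n x t - U t)
    = (\<Sum>(i, j)\<in>offdiag n. hoeffding_kernel G U t (x i) (x j))
      + 2 * (real n - 1) * ((\<Sum>i\<in>{1..n}. G (2 * t - x i)) - real n * U t)"
proof -
  have swap: "(\<Sum>(i, j)\<in>offdiag n. G (2 * t - x j)) = (\<Sum>(i, j)\<in>offdiag n. G (2 * t - x i))"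
    by (rule sum.reindex_bij_witness[of _ prod.swap prod.swap]) (auto simp: offdiag_def)
  have one: "(\<Sum>(i, j)\<in>offdiag n. G (2 * t - x i)) = (real n - 1) * (\<Sum>i\<in>{1..n}. G (2 * t - x i))"
    using assms by (simp add: sum_offdiag sum_distrib_left of_nat_diff)
  have const: "(\<Sum>(i, j)\<in>offdiag n. U t) = real n * (real n - 1) * U t"
    using assms sum_offdiag[of "\<lambda>_ _. U t" n] by (simp add: of_nat_diff)
  have sum: "(\<Sum>(i, j)\<in>offdiag n. hoeffding_kernel G U t (x i) (x j))
     = (\<Sum>(i, j)\<in>offdiag n. of_bool ((x i + x j) / 2 \<le> t)) - (\<Sum>(i, j)\<in>offdiag n. G (2 * t - x i))
       - (\<Sum>(i, j)\<in>offdiag n. G (2 * t - x j)) + (\<Sum>(i, j)\<in>offdiag n. U t)"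
    by (simp only: hoeffding_kernel_def case_prod_unfold sum.distrib sum_subtractf)
  have hits: "(\<Sum>(i, j)\<in>offdiag n. of_bool ((x i + x j) / 2 \<le> t)) = real n * (real n - 1) * U_stat n x t"
    using assms by (simp add: U_stat_def)
  show ?thesis unfolding sum hits swap one const
    by (simp only: algebra_simps)
qed

lemma U_stat_mono: "s \<le> t \<Longrightarrow> U_stat n x s \<le> U_stat n x t"
proof -
  assume st: "s \<le> t"
  have "(\<Sum>(i, j)\<in>offdiag n. of_bool ((x i + x j) / 2 \<le> s) :: real) \<le> (\<Sum>(i, j)\<in>offdiag n. of_bool ((x i + x j) / 2 \<le> t))"
    using st by (intro sum_mono) auto
  moreover have "0 \<le> 1 / (real n * (real n - 1))" by (cases n) auto
  ultimately show ?thesis unfolding U_stat_def by (rule mult_left_mono)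
qed

text \<open>Finitely many inequalities suffice. On the grid the Hoeffding decomposition splits an increment of \<open>U_stat -
U\<close> into two degenerate parts and a linear part of the size of the grid distance; between grid points monotonicity of
\<open>U_stat\<close> and the Lipschitz bound on \<open>U\<close> lose at most the mesh \<open>c / n \<le> q\<^sup>2\<close>. The
counts are read off the empirical distribution function, because \<open>(x\<^sub>i + x\<^sub>j) / 2 \<le> t\<close> means
\<open>x\<^sub>j \<le> 2 t - x\<^sub>i\<close>.\<close>

lemma regular_dataI:
  fixes G U :: "real \<Rightarrow> real"
  assumes n: "n \<ge> 2" and c: "0 < c" "c \<le> 1" and q: "0 < q" "q \<le> 1" "real n * q\<^sup>2 \<ge> 1" and L: "L \<ge> 1"
    and G: "mono G" "\<And>t. 0 \<le> G t" "\<And>t. G t \<le> 1" "\<And>s t. s \<le> t \<Longrightarrow> G t - G s \<le> L * (t - s)"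
    and U: "\<And>s t. s \<le> t \<Longrightarrow> U s \<le> U t" "\<And>s t. s \<le> t \<Longrightarrow> U t - U s \<le> 2 * L * (t - s)" "U \<theta> = 1 / 2"
    and a: "\<And>k. k \<in> {1..<n} \<Longrightarrow> G (a k) = real k / real n"
    and deg: "\<And>k. k \<le> 2 * n \<Longrightarrow>
      \<bar>\<Sum>(i, j)\<in>offdiag n. hoeffding_kernel G U (window_grid n \<theta> c k) (x i) (x j)\<bar> \<le> 16 * (real n)\<^sup>2 * q\<^sup>2"
    and lin: "\<And>k l. k < l \<Longrightarrow> l \<le> 2 * n \<Longrightarrow>
      \<bar>(\<Sum>i\<in>{1..n}. G (2 * window_grid n \<theta> c l - x i) - G (2 * window_grid n \<theta> c k - x i))
         - real n * (U (window_grid n \<theta> c l) - U (window_grid n \<theta> c k))\<bar>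
      \<le> 2 * L * (window_grid n \<theta> c l - window_grid n \<theta> c k) * (real n * q)"
    and centre: "\<bar>(\<Sum>i\<in>{1..n}. G (2 * \<theta> - x i)) - real n / 2\<bar> \<le> real n * q"
    and quant: "\<And>k. k \<in> {1..<n} \<Longrightarrow> \<bar>(\<Sum>j\<in>{1..n}. of_bool (x j \<le> a k)) - real k\<bar> \<le> real n * q"
  shows "regular_data n U \<theta> c L q x"
proof -
  let ?g = "window_grid n \<theta> c"
  define N where "N = real n * (real n - 1)"
  have N: "N > 0" "(real n)\<^sup>2 \<le> 2 * N" using n by (auto simp: N_def power2_eq_square algebra_simps)
  have n1: "1 / real n \<le> q\<^sup>2" using q n by (simp add: field_simps)
  have step: "c / real n \<le> q\<^sup>2" using n1 c n by (smt (verit) divide_right_mono of_nat_0_le_iff)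
  have grid: "\<bar>U_stat n x (?g l) - U_stat n x (?g k) - (U (?g l) - U (?g k))\<bar>
      \<le> 64 * q\<^sup>2 + 4 * L * (?g l - ?g k) * q" if kl: "k \<le> l" "l \<le> 2 * n" for k l
  proof (cases "k = l")
    case True thus ?thesis by simp
  next
    case False
    hence kl': "k < l" using kl by simp
    define D where "D = U_stat n x (?g l) - U_stat n x (?g k) - (U (?g l) - U (?g k))"
    define A where "A = (\<lambda>k. \<Sum>(i, j)\<in>offdiag n. hoeffding_kernel G U (?g k) (x i) (x j))"
    define B where "B = (\<Sum>i\<in>{1..n}. G (2 * ?g l - x i) - G (2 * ?g k - x i)) - real n * (U (?g l) - U (?g k))"
    have "N * D = A l - A k + 2 * (real n - 1) * B"
      using hoeffding_decomposition[OF n, of x "?g l" U G] hoeffding_decomposition[OF n, of x "?g k" U G]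
      by (simp add: A_def B_def D_def N_def sum_subtractf algebra_simps)
    hence "\<bar>N * D\<bar> \<le> \<bar>A l\<bar> + \<bar>A k\<bar> + \<bar>2 * (real n - 1) * B\<bar>" by linarith
    also have "\<dots> = \<bar>A l\<bar> + \<bar>A k\<bar> + 2 * (real n - 1) * \<bar>B\<bar>" using n by (simp add: abs_mult)
    also have "\<dots> \<le> 16 * (real n)\<^sup>2 * q\<^sup>2 + 16 * (real n)\<^sup>2 * q\<^sup>2
        + 2 * (real n - 1) * (2 * L * (?g l - ?g k) * (real n * q))"
      using deg[of l] deg[of k] lin[OF kl' kl(2)] kl n
      unfolding A_def B_def by (intro add_mono mult_left_mono) auto
    also have "\<dots> = 32 * q\<^sup>2 * (real n)\<^sup>2 + N * (4 * L * (?g l - ?g k) * q)"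
      by (simp add: N_def algebra_simps)
    also have "\<dots> \<le> 32 * q\<^sup>2 * (2 * N) + N * (4 * L * (?g l - ?g k) * q)"
      using N by (intro add_right_mono mult_left_mono) auto
    also have "\<dots> = N * (64 * q\<^sup>2 + 4 * L * (?g l - ?g k) * q)" by (simp add: algebra_simps)
    finally show ?thesis using N by (simp add: abs_mult D_def)
  qed
  have incr: "\<bar>U_stat n x t - U_stat n x s - (U t - U s)\<bar> \<le> (64 + 16 * L) * ((t - s) * q + q\<^sup>2)"
    if st: "\<theta> - c \<le> s" "s \<le> t" "t \<le> \<theta> + c" for s t
  proof -
    obtain k where k: "k < 2 * n" "?g k \<le> s" "s \<le> ?g (Suc k)"
      using window_grid_bracket[of c n \<theta> s] st c n by auto
    obtain l where l: "l < 2 * n" "?g l \<le> t" "t \<le> ?g (Suc l)"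
      using window_grid_bracket[of c n \<theta> t] st c n by auto
    note Suc = window_grid_Suc[of n \<theta> c]
    define h where "h = c / real n"
    have h: "0 < h" "h \<le> q\<^sup>2" using step c n by (auto simp: h_def)
    have gk: "?g (Suc k) = ?g k + h" "?g (Suc l) = ?g l + h" by (auto simp: Suc h_def)
    have fin: "(64 + 12 * L) * q\<^sup>2 + 4 * L * (t - s) * q \<le> (64 + 16 * L) * ((t - s) * q + q\<^sup>2)"
    proof -
      have "0 \<le> (t - s) * q" using st q by simp
      hence "0 \<le> (64 + 12 * L) * ((t - s) * q) + 4 * L * q\<^sup>2" using L q st by (intro add_nonneg_nonneg mult_nonneg_nonneg) auto
      thus ?thesis by (simp add: algebra_simps)
    qed
    have Lhq: "L * h * q \<le> L * q\<^sup>2"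
    proof -
      have "h * q \<le> q\<^sup>2 * 1" using h q by (intro mult_mono) auto
      thus ?thesis using L by simp
    qed
    have Lh: "L * h \<le> L * q\<^sup>2" using h L by simp
    have up: "U_stat n x t - U_stat n x s - (U t - U s) \<le> (64 + 12 * L) * q\<^sup>2 + 4 * L * (t - s) * q"
    proof -
      have kl: "k \<le> Suc l"
      proof (rule ccontr)
        assume "\<not> k \<le> Suc l"
        hence "Suc (Suc l) \<le> k" by simp
        hence "?g (Suc (Suc l)) \<le> ?g k" using c n by (intro window_grid_mono) auto
        thus False using k l st h Suc[of "Suc l"] by (simp add: h_def)
      qed
      have "U_stat n x t - U_stat n x s \<le> U_stat n x (?g (Suc l)) - U_stat n x (?g k)"
        using U_stat_mono[OF l(3), of n x] U_stat_mono[OF k(2), of n x] by linarith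
      also have "\<dots> \<le> U (?g (Suc l)) - U (?g k) + 64 * q\<^sup>2 + 4 * L * (?g (Suc l) - ?g k) * q"
        using grid[OF kl] l by auto
      also have "\<dots> \<le> (U t + 2 * L * h) - (U s - 2 * L * h) + 64 * q\<^sup>2 + 4 * L * (t - s + 2 * h) * q"
      proof (intro add_mono diff_mono mult_right_mono mult_left_mono)
        have "U (?g (Suc l)) - U t \<le> 2 * L * (?g (Suc l) - t)" using l by (intro U)
        also have "\<dots> \<le> 2 * L * h" using l gk L by (intro mult_left_mono) auto
        finally show "U (?g (Suc l)) \<le> U t + 2 * L * h" by simp
        have "U s - U (?g k) \<le> 2 * L * (s - ?g k)" using k by (intro U)
        also have "\<dots> \<le> 2 * L * h" using k gk L by (intro mult_left_mono) auto
        finally show "U s - 2 * L * h \<le> U (?g k)" by simp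
      qed (use k l gk L q h in auto)
      also have "\<dots> = U t - U s + 64 * q\<^sup>2 + 4 * L * (t - s) * q + 4 * (L * h) + 8 * (L * h * q)"
        by (simp add: algebra_simps)
      finally show ?thesis using Lhq Lh by (simp add: algebra_simps)
    qed
    have lo: "U t - U s - (U_stat n x t - U_stat n x s) \<le> (64 + 12 * L) * q\<^sup>2 + 4 * L * (t - s) * q"
    proof (cases "Suc k \<le> l")
      case True
      have "U_stat n x t - U_stat n x s \<ge> U_stat n x (?g l) - U_stat n x (?g (Suc k))"
        using U_stat_mono[OF l(2), of n x] U_stat_mono[OF k(3), of n x] by linarith
      moreover have "U_stat n x (?g l) - U_stat n x (?g (Suc k))
          \<ge> U (?g l) - U (?g (Suc k)) - 64 * q\<^sup>2 - 4 * L * (?g l - ?g (Suc k)) * q"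
        using grid[OF True] l by auto
      moreover have "4 * L * (?g l - ?g (Suc k)) * q \<le> 4 * L * (t - s) * q"
        using k l L q by (intro mult_right_mono mult_left_mono) auto
      moreover have "U t - U (?g l) \<le> 2 * L * h"
      proof -
        have "U t - U (?g l) \<le> 2 * L * (t - ?g l)" using l by (intro U)
        also have "\<dots> \<le> 2 * L * h" using l gk L by (intro mult_left_mono) auto
        finally show ?thesis .
      qed
      moreover have "U (?g (Suc k)) - U s \<le> 2 * L * h"
      proof -
        have "U (?g (Suc k)) - U s \<le> 2 * L * (?g (Suc k) - s)" using k by (intro U)
        also have "\<dots> \<le> 2 * L * h" using k gk L by (intro mult_left_mono) auto
        finally show ?thesis .
      qed
      moreover have "0 \<le> L * q\<^sup>2" using L by simp
      ultimately show ?thesis using Lh by (simp add: algebra_simps)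
    next
      case False
      \<comment> \<open>\<open>s\<close> and \<open>t\<close> are within one mesh, where the increment of \<open>U\<close> alone is negligible\<close>
      hence "?g (Suc l) \<le> ?g (Suc k)" using c n by (intro window_grid_mono) auto
      hence "t - s \<le> h" using k l gk by linarith
      hence "2 * L * (t - s) \<le> 2 * L * h" using L by (intro mult_left_mono) auto
      hence "U t - U s \<le> 2 * (L * h)" using U(2)[OF st(2)] by simp
      moreover have "U_stat n x s \<le> U_stat n x t" using st by (intro U_stat_mono)
      moreover have "0 \<le> 4 * L * (t - s) * q" using L st q by simp
      moreover have "0 \<le> L * q\<^sup>2" using L by simp
      moreover have "0 \<le> q\<^sup>2" by simp
      ultimately have "U t - U s - (U_stat n x t - U_stat n x s) \<le> 64 * q\<^sup>2 + 12 * (L * q\<^sup>2) + 4 * L * (t - s) * q"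
        using Lh by linarith
      thus ?thesis by (simp add: algebra_simps)
    qed
    show ?thesis using up lo fin by linarith
  qed
  have cent: "\<bar>U_stat n x \<theta> - 1 / 2\<bar> \<le> 34 * q"
  proof -
    have gn: "?g n = \<theta>" by (simp add: window_grid_def)
    define A where "A = (\<Sum>(i, j)\<in>offdiag n. hoeffding_kernel G U \<theta> (x i) (x j))"
    define B where "B = (\<Sum>i\<in>{1..n}. G (2 * \<theta> - x i)) - real n / 2"
    have "N * (U_stat n x \<theta> - 1 / 2) = A + 2 * (real n - 1) * B"
      using hoeffding_decomposition[OF n, of x \<theta> U G] by (simp add: A_def B_def N_def U)
    hence "\<bar>N * (U_stat n x \<theta> - 1 / 2)\<bar> \<le> \<bar>A\<bar> + \<bar>2 * (real n - 1) * B\<bar>" by linarith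
    also have "\<dots> = \<bar>A\<bar> + 2 * (real n - 1) * \<bar>B\<bar>" using n by (simp add: abs_mult)
    also have "\<dots> \<le> 16 * (real n)\<^sup>2 * q\<^sup>2 + 2 * (real n - 1) * (real n * q)"
      using deg[of n] centre n unfolding A_def B_def gn by (intro add_mono mult_left_mono) auto
    also have "\<dots> = 16 * q\<^sup>2 * (real n)\<^sup>2 + N * (2 * q)" by (simp add: N_def algebra_simps)
    also have "\<dots> \<le> 16 * q * (2 * N) + N * (2 * q)"
      using N q by (intro add_mono mult_mono) (auto simp: power2_eq_square mult_left_le)
    also have "\<dots> = N * (34 * q)" by simp
    finally show ?thesis using N by (simp add: abs_mult)
  qed
  have count: "(\<Sum>j\<in>{1..n} - {i}. of_bool ((x i + x j) / 2 \<le> t) - of_bool ((x i + x j) / 2 \<le> s))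
          \<le> 2 * L * real n * (t - s) + 4 * real n * q" if i: "i \<in> {1..n}" and st: "s \<le> t" for i s t
  proof -
    define C where "C = (\<lambda>t. \<Sum>j\<in>{1..n}. of_bool (x j \<le> t) :: real)"
    have Cclose: "\<bar>C t - real n * G t\<bar> \<le> real n * q + 1" for t
      unfolding C_def using n q by (intro count_close_of_quantiles[where a = a] G a quant) auto
    have "(\<Sum>j\<in>{1..n} - {i}. of_bool ((x i + x j) / 2 \<le> t) - of_bool ((x i + x j) / 2 \<le> s) :: real)
        \<le> (\<Sum>j\<in>{1..n}. of_bool ((x i + x j) / 2 \<le> t) - of_bool ((x i + x j) / 2 \<le> s))"
      using st by (intro sum_mono2) auto
    also have "\<dots> = C (2 * t - x i) - C (2 * s - x i)"
      unfolding C_def sum_subtractf by (intro arg_cong2[of _ _ _ _ "(-)"] sum.cong refl arg_cong[of _ _ of_bool]) auto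
    also have "\<dots> \<le> real n * (G (2 * t - x i) - G (2 * s - x i)) + 2 * (real n * q) + 2"
      using Cclose[of "2 * t - x i"] Cclose[of "2 * s - x i"] by (simp add: algebra_simps abs_le_iff)
    also have "\<dots> \<le> real n * (L * ((2 * t - x i) - (2 * s - x i))) + 2 * (real n * q) + 2 * (real n * q)"
    proof (intro add_mono mult_left_mono G(4))
      have "1 \<le> real n * q\<^sup>2" by fact
      also have "\<dots> \<le> real n * q" using q by (intro mult_left_mono) (auto simp: power2_eq_square mult_left_le)
      finally show "2 \<le> 2 * (real n * q)" by simp
    qed (use st in auto)
    finally show ?thesis by (simp add: algebra_simps)
  qed
  show ?thesis unfolding regular_data_def incr_const_def using incr cent count by blast
qed

section \<open>Regular samples are typical\<close>

lemma (in prob_space) indep_var_of_indep_vars: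
  assumes "indep_vars (\<lambda>_. N) X I" "i \<in> I" "j \<in> I" "i \<noteq> j"
  shows "indep_var N (X i) N (X j)"
proof -
  have "indep_var (PiM {i} (\<lambda>_. N)) (\<lambda>s. restrict (\<lambda>k. X k s) {i}) (PiM {j} (\<lambda>_. N)) (\<lambda>s. restrict (\<lambda>k. X k s) {j})"
    using assms by (intro indep_var_restrict[where I = I]) auto
  from indep_var_compose[OF this, of "\<lambda>f. f i" N "\<lambda>f. f j" N]
  show ?thesis by (simp add: comp_def)
qed

lemma (in prob_space) prob_mean_le_eq_integral_cdf:
  fixes Y Z :: "'a \<Rightarrow> real"
  assumes "indep_var borel Y borel Z"
  shows "prob {s \<in> space M. (Y s + Z s) / 2 \<le> t} = expectation (\<lambda>s. cdf (distr M borel Z) (2 * t - Y s))"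
proof -
  have [measurable]: "Y \<in> borel_measurable M" "Z \<in> borel_measurable M"
    and pair: "distr M borel Y \<Otimes>\<^sub>M distr M borel Z = distr M (borel \<Otimes>\<^sub>M borel) (\<lambda>s. (Y s, Z s))"
    using assms unfolding indep_var_distribution_eq by auto
  interpret Y: real_distribution "distr M borel Y" by simp
  interpret Z: real_distribution "distr M borel Z" by simp
  define S where "S = {p \<in> space (borel \<Otimes>\<^sub>M borel). (fst p + snd p) / 2 \<le> (t::real)}"
  have S [measurable]: "S \<in> sets (borel \<Otimes>\<^sub>M borel)" unfolding S_def by measurable
  have cm [measurable]: "cdf (distr M borel Z) \<in> borel_measurable borel"
    by (intro borel_measurable_mono monoI Z.cdf_nondecreasing)
  have "ennreal (prob {s \<in> space M. (Y s + Z s) / 2 \<le> t}) = emeasure (distr M borel Y \<Otimes>\<^sub>M distr M borel Z) S"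
  proof -
    have "{s \<in> space M. (Y s + Z s) / 2 \<le> t} = (\<lambda>s. (Y s, Z s)) -` S \<inter> space M"
      by (auto simp: S_def space_pair_measure)
    moreover have "(\<lambda>s. (Y s, Z s)) \<in> measurable M (borel \<Otimes>\<^sub>M borel)" by measurable
    ultimately show ?thesis unfolding pair by (simp only: emeasure_distr[OF _ S] emeasure_eq_measure)
  qed
  also have "\<dots> = (\<integral>\<^sup>+y. emeasure (distr M borel Z) (Pair y -` S) \<partial>distr M borel Y)"
    by (intro Z.emeasure_pair_measure_alt) (use S in \<open>simp cong: sets_pair_measure_cong\<close>)
  also have "\<dots> = (\<integral>\<^sup>+y. ennreal (cdf (distr M borel Z) (2 * t - y)) \<partial>distr M borel Y)"
  proof (intro nn_integral_cong)
    fix y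
    have "Pair y -` S = {..2 * t - y}" by (auto simp: S_def space_pair_measure)
    thus "emeasure (distr M borel Z) (Pair y -` S) = ennreal (cdf (distr M borel Z) (2 * t - y))"
      by (simp add: cdf_def2 Z.emeasure_eq_measure)
  qed
  also have "\<dots> = (\<integral>\<^sup>+s. ennreal (cdf (distr M borel Z) (2 * t - Y s)) \<partial>M)"
    by (subst nn_integral_distr) auto
  also have "\<dots> = ennreal (expectation (\<lambda>s. cdf (distr M borel Z) (2 * t - Y s)))"
    by (intro nn_integral_eq_integral integrable_const_bound[where B = 1] AE_I2)
       (auto simp: Z.cdf_nonneg Z.cdf_bounded_prob)
  finally show ?thesis
    by (subst (asm) ennreal_inj) (auto intro!: integral_nonneg_AE simp: Z.cdf_nonneg)
qed

lemma (in real_distribution) cdf_quantile_exists: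
  assumes "\<And>s t. s \<le> t \<Longrightarrow> cdf M t - cdf M s \<le> L * (t - s)" "0 < p" "p < 1"
  shows "\<exists>a. cdf M a = p"
proof -
  have "eventually (\<lambda>x. cdf M x < p) at_bot" using order_tendstoD(2)[OF cdf_lim_at_bot] assms by simp
  then obtain u where u: "cdf M u < p" using eventually_happens'[OF trivial_limit_at_bot_linorder] by blast
  have "eventually (\<lambda>x. p < cdf M x) at_top" using order_tendstoD(1)[OF cdf_lim_at_top_prob] assms by simp
  then obtain v where v: "p < cdf M v" using eventually_happens'[OF trivial_limit_at_top_linorder] by blast
  have uv: "u \<le> v" using u v cdf_nondecreasing[of v u] by linarith
  have "isCont (cdf M) x" for x
  proof -
    have "\<bar>cdf M y - cdf M x\<bar> \<le> \<bar>L\<bar> * \<bar>y - x\<bar>" for y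
    proof (cases "x \<le> y")
      case True
      have "cdf M y - cdf M x \<le> L * (y - x)" using assms(1)[OF True] .
      also have "\<dots> \<le> \<bar>L\<bar> * (y - x)" using True by (intro mult_right_mono) auto
      finally show ?thesis using True cdf_nondecreasing[OF True] by simp
    next
      case False
      have "cdf M x - cdf M y \<le> L * (x - y)" using assms(1)[of y x] False by simp
      also have "\<dots> \<le> \<bar>L\<bar> * (x - y)" using False by (intro mult_right_mono) auto
      finally show ?thesis using False cdf_nondecreasing[of y x] by simp
    qed
    moreover have "((\<lambda>y. \<bar>L\<bar> * \<bar>y - x\<bar>) \<longlongrightarrow> \<bar>L\<bar> * \<bar>x - x\<bar>) (at x)" by (intro tendsto_intros)
    ultimately have "((\<lambda>y. cdf M y - cdf M x) \<longlongrightarrow> 0) (at x)"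
      by (intro Lim_null_comparison[of "\<lambda>y. cdf M y - cdf M x" "\<lambda>y. \<bar>L\<bar> * \<bar>y - x\<bar>"]) auto
    thus ?thesis by (simp add: isCont_def LIM_zero_iff)
  qed
  thus ?thesis using IVT[of "cdf M" u p v] u v uv by auto
qed

lemma (in prob_space) prob_finite_union_le:
  assumes "finite K" "\<And>k. k \<in> K \<Longrightarrow> B k \<in> events" "\<And>k. k \<in> K \<Longrightarrow> prob (B k) \<le> p" "real (card K) \<le> N" "p \<ge> 0"
  shows "prob (\<Union>k\<in>K. B k) \<le> N * p"
proof -
  have "prob (\<Union>k\<in>K. B k) \<le> (\<Sum>k\<in>K. prob (B k))"
    using assms by (intro finite_measure_subadditive_finite) auto
  also have "\<dots> \<le> real (card K) * p" using assms by (intro sum_bounded_above) auto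
  also have "\<dots> \<le> N * p" using assms by (intro mult_right_mono) auto
  finally show ?thesis .
qed

text \<open>Each hypothesis of \<open>regular_dataI\<close> holds up to probability of order \<open>exp (- n q\<^sup>2)\<close> or
its square: the degenerate sums by \<open>degenerate_chaos_tail\<close>, and the linear sums and the counts by Hoeffding's
inequality. There are of order \<open>n\<close> inequalities of the first kind and \<open>n\<^sup>2\<close> of the second, so the
union bound costs the factor \<open>n\<close>, which the \<open>log n\<close> inside \<open>n q\<^sup>2\<close> absorbs
later.\<close>

lemma (in prob_space) regular_data_probability:
  fixes X :: "nat \<Rightarrow> 'a \<Rightarrow> real" and U :: "real \<Rightarrow> real"
  defines "U \<equiv> mean_cdf M X"
  assumes n: "n \<ge> 2" and ind: "indep_vars (\<lambda>_. borel) X {1..n}"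
    and distr: "\<And>i. i \<in> {1..n} \<Longrightarrow> distr M borel (X i) = \<nu>"
    and lip: "\<And>s t. s \<le> t \<Longrightarrow> cdf \<nu> t - cdf \<nu> s \<le> L * (t - s)" and L: "L \<ge> 1"
    and c: "0 < c" "c \<le> 1" and q: "0 < q" "q \<le> 1" "real n * q\<^sup>2 \<ge> 1"
    and small: "real n * exp (- (real n * q\<^sup>2)) \<le> 1"
    and median: "U \<theta> = 1 / 2"
  obtains A where "A \<in> sets (PiM {1..n} (\<lambda>_. borel))"
    "\<And>x. x \<in> A \<Longrightarrow> regular_data n U \<theta> c L q x"
    "prob {s \<in> space M. sample_vec n X s \<in> A} \<ge> 1 - 106 * (real n * exp (- (real n * q\<^sup>2)))"
proof -
  define G where "G = cdf \<nu>"
  have X [measurable]: "X i \<in> borel_measurable M" if "i \<in> {1..n}" for i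
    using ind that by (auto simp: indep_vars_def)
  have one_in: "(1::nat) \<in> {1..n}" "(2::nat) \<in> {1..n}" using n by auto
  interpret \<nu>: real_distribution \<nu>
    using distr[OF one_in(1)] X[OF one_in(1)] real_distribution_distr[of "X 1"] by simp
  have G: "mono G" "\<And>t. 0 \<le> G t" "\<And>t. G t \<le> 1"
    by (auto simp: G_def \<nu>.cdf_nonneg \<nu>.cdf_bounded_prob intro!: monoI \<nu>.cdf_nondecreasing)
  have Gm [measurable]: "G \<in> borel_measurable borel" by (intro borel_measurable_mono G)
  have Glip: "\<And>s t. s \<le> t \<Longrightarrow> G t - G s \<le> L * (t - s)" using lip by (simp add: G_def)
  have EG: "expectation (\<lambda>s. G (2 * t - X i s)) = U t" if i: "i \<in> {1..n}" for i t
  proof -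
    have ref: "expectation (\<lambda>s. G (2 * t - X k s)) = (\<integral>x. G (2 * t - x) \<partial>\<nu>)" if "k \<in> {1..n}" for k
      using that distr[OF that, symmetric] by (simp add: integral_distr)
    have "U t = expectation (\<lambda>s. cdf (distr M borel (X 2)) (2 * t - X 1 s))"
      unfolding U_def mean_cdf_def using one_in
      by (intro prob_mean_le_eq_integral_cdf indep_var_of_indep_vars[OF ind]) auto
    also have "\<dots> = expectation (\<lambda>s. G (2 * t - X 1 s))"
      using distr[OF one_in(2)] by (simp add: G_def)
    finally show ?thesis using ref[OF i] ref[OF one_in(1)] by simp
  qed
  have Gint: "integrable M (\<lambda>s. G (r - X i s))" if "i \<in> {1..n}" for i r
    using that G by (intro integrable_const_bound[where B = 1] AE_I2) auto
  have U01: "0 \<le> U t" "U t \<le> 1" for t by (auto simp: U_def mean_cdf_def)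
  have Umono: "U s \<le> U t" if "s \<le> t" for s t
    unfolding EG[OF one_in(1), symmetric] using that
    by (intro integral_mono Gint one_in monoD[OF G(1)]) auto
  have Ulip: "U t - U s \<le> 2 * L * (t - s)" if "s \<le> t" for s t
  proof -
    have "U t - U s = expectation (\<lambda>u. G (2 * t - X 1 u) - G (2 * s - X 1 u))"
      unfolding EG[OF one_in(1), symmetric] by (subst Bochner_Integration.integral_diff[OF Gint[OF one_in(1)] Gint[OF one_in(1)]]) simp
    also have "\<dots> \<le> expectation (\<lambda>u. 2 * L * (t - s))"
    proof (intro integral_mono)
      fix u
      show "G (2 * t - X 1 u) - G (2 * s - X 1 u) \<le> 2 * L * (t - s)"
        using Glip[of "2 * s - X 1 u" "2 * t - X 1 u"] that by (simp add: algebra_simps)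
    qed (use Gint[OF one_in(1)] in simp_all)
    finally show ?thesis by (simp add: prob_space)
  qed
  have "\<exists>a. \<forall>k\<in>{1..<n}. G (a k) = real k / real n"
    using \<nu>.cdf_quantile_exists[OF lip] unfolding G_def by (intro bchoice ballI) auto
  then obtain a where a: "\<And>k. k \<in> {1..<n} \<Longrightarrow> G (a k) = real k / real n" by blast
  let ?g = "window_grid n \<theta> c"
  let ?P = "PiM {1..n} (\<lambda>_. borel :: real measure)"
  define D where "D = (\<lambda>k x. \<Sum>(i, j)\<in>offdiag n. hoeffding_kernel G U (?g k) (x i) (x j))"
  define E where "E = (\<lambda>k l x. (\<Sum>i\<in>{1..n}. G (2 * ?g l - x i) - G (2 * ?g k - x i))
         - real n * (U (?g l) - U (?g k)))"
  define T where "T = (\<lambda>x. (\<Sum>i\<in>{1..n}. G (2 * \<theta> - x i)) - real n / 2)"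
  define Q where "Q = (\<lambda>k x. (\<Sum>j\<in>{1..n}. of_bool (x j \<le> a k)) - real k)"
  have Dm [measurable]: "D k \<in> borel_measurable ?P" for k
    unfolding D_def hoeffding_kernel_def by (rule measurable_sum_offdiag) measurable
  have Em [measurable]: "E k l \<in> borel_measurable ?P" for k l unfolding E_def by measurable
  have Tm [measurable]: "T \<in> borel_measurable ?P" unfolding T_def by measurable
  have Qm [measurable]: "Q k \<in> borel_measurable ?P" for k unfolding Q_def by measurable
  define J where "J = {(k, l). k < l \<and> l \<le> 2 * n}"
  have finJ: "finite J" by (rule finite_subset[of _ "{..2 * n} \<times> {..2 * n}"]) (auto simp: J_def)
  have cJ: "real (card J) \<le> 9 * (real n)\<^sup>2"
  proof -
    have "card J \<le> card ({..2 * n} \<times> {..2 * n})" by (intro card_mono) (auto simp: J_def)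
    also have "\<dots> = (2 * n + 1) * (2 * n + 1)" by simp
    also have "\<dots> \<le> (3 * n) * (3 * n)" using n by (intro mult_mono) auto
    finally have "real (card J) \<le> real ((3 * n) * (3 * n))" by (simp only: of_nat_le_iff)
    thus ?thesis by (simp add: power2_eq_square)
  qed
  define A where "A = {x \<in> space ?P. (\<forall>k\<in>{..2 * n}. \<bar>D k x\<bar> \<le> 16 * (real n)\<^sup>2 * q\<^sup>2) \<and>
     (\<forall>p\<in>J. \<bar>E (fst p) (snd p) x\<bar> \<le> 2 * L * (?g (snd p) - ?g (fst p)) * (real n * q)) \<and>
     \<bar>T x\<bar> \<le> real n * q \<and> (\<forall>k\<in>{1..<n}. \<bar>Q k x\<bar> \<le> real n * q)}"
  have Am: "A \<in> sets ?P" unfolding A_def using finJ by measurable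
  have reg: "regular_data n U \<theta> c L q x" if "x \<in> A" for x
  proof (rule regular_dataI[OF n c q L G Glip Umono Ulip median a])
    fix k assume "k \<le> 2 * n"
    thus "\<bar>\<Sum>(i, j)\<in>offdiag n. hoeffding_kernel G U (?g k) (x i) (x j)\<bar> \<le> 16 * (real n)\<^sup>2 * q\<^sup>2"
      using that by (simp add: A_def D_def)
  next
    fix k l assume "k < l" "l \<le> 2 * n"
    hence "(k, l) \<in> J" by (simp add: J_def)
    thus "\<bar>(\<Sum>i\<in>{1..n}. G (2 * ?g l - x i) - G (2 * ?g k - x i)) - real n * (U (?g l) - U (?g k))\<bar>
      \<le> 2 * L * (?g l - ?g k) * (real n * q)"
      using that unfolding A_def E_def by force
  next
    show "\<bar>(\<Sum>i\<in>{1..n}. G (2 * \<theta> - x i)) - real n / 2\<bar> \<le> real n * q"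
      using that by (simp add: A_def T_def)
  next
    fix k assume "k \<in> {1..<n}"
    thus "\<bar>(\<Sum>j\<in>{1..n}. of_bool (x j \<le> a k)) - real k\<bar> \<le> real n * q"
      using that unfolding A_def Q_def by blast
  qed
  define v where "v = sample_vec n X"
  have vi: "v s i = X i s" if "i \<in> {1..n}" for s i using that by (simp add: v_def sample_vec_def)
  have vm [measurable]: "v \<in> measurable M ?P"
    unfolding v_def sample_vec_def by (intro measurable_restrict X)
  define e where "e = exp (- (real n * q\<^sup>2))"
  have e: "0 < e" "real n * e \<le> 1" using small by (auto simp: e_def)
  have ee: "exp (- 2 * (real n * q\<^sup>2)) = e\<^sup>2" by (simp add: e_def power2_eq_square flip: exp_add)
  have sq: "sqrt (real n * (real n * q\<^sup>2)) = real n * q"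
    using q by (intro real_sqrt_unique) (auto simp: power2_eq_square)
  define BD where "BD = (\<lambda>k. {s \<in> space M. \<bar>D k (v s)\<bar> > 16 * (real n)\<^sup>2 * q\<^sup>2})"
  define BE where "BE = (\<lambda>p. {s \<in> space M. \<bar>E (fst p) (snd p) (v s)\<bar> > 2 * L * (?g (snd p) - ?g (fst p)) * (real n * q)})"
  define BT where "BT = {s \<in> space M. \<bar>T (v s)\<bar> > real n * q}"
  define BQ where "BQ = (\<lambda>k. {s \<in> space M. \<bar>Q k (v s)\<bar> > real n * q})"
  have [measurable]: "BD k \<in> events" "BE p \<in> events" "BT \<in> events" "BQ k \<in> events" for k p
    unfolding BD_def BE_def BT_def BQ_def by measurable
  have pD: "prob (BD k) \<le> 28 * e" for k
  proof -
    \<comment> \<open>The kernel takes values in \<open>[-2, 2]\<close>, whence the normalisation by 2.\<close>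
    let ?h = "\<lambda>x y. hoeffding_kernel G U (?g k) x y / 2"
    have "prob {s \<in> space M. \<bar>\<Sum>(i, j)\<in>offdiag n. ?h (X i s) (X j s)\<bar> \<ge> 8 * real n * (real n * q\<^sup>2)}
        \<le> 28 * exp (- (real n * q\<^sup>2))"
    proof (rule degenerate_chaos_tail[OF _ ind, where g = "\<lambda>_ _. ?h"])
      show "n > 0" using n by simp
      show "(\<lambda>(x, y). ?h x y) \<in> borel_measurable (borel \<Otimes>\<^sub>M borel)"
        unfolding hoeffding_kernel_def by measurable
      show "\<bar>?h x y\<bar> \<le> 1" for x y
        using G(2)[of "2 * ?g k - x"] G(3)[of "2 * ?g k - x"] G(2)[of "2 * ?g k - y"] G(3)[of "2 * ?g k - y"] U01[of "?g k"]
        by (auto simp: hoeffding_kernel_def)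
    next
      fix i j :: nat and y :: real assume "(i, j) \<in> offdiag n"
      hence i: "i \<in> {1..n}" by (auto simp: offdiag_def)
      have "expectation (\<lambda>s. of_bool ((X i s + y) / 2 \<le> ?g k)) = G (2 * ?g k - y)"
      proof -
        have "expectation (\<lambda>s. of_bool ((X i s + y) / 2 \<le> ?g k)) = (\<integral>x. (indicator {..2 * ?g k - y} x :: real) \<partial>distr M borel (X i))"
          using i by (subst integral_distr) (auto intro!: Bochner_Integration.integral_cong simp: indicator_def)
        thus ?thesis by (simp add: distr[OF i] G_def cdf_def2)
      qed
      moreover have "integrable M (\<lambda>s. of_bool ((X i s + y) / 2 \<le> ?g k) :: real)"
        using i by (intro integrable_const_bound[where B = 1]) auto
      ultimately show "expectation (\<lambda>s. ?h (X i s) y) = 0"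
        unfolding hoeffding_kernel_def using Gint[OF i] EG[OF i] by (simp add: prob_space)
    next
      fix i j :: nat and x :: real assume "(i, j) \<in> offdiag n"
      hence j: "j \<in> {1..n}" by (auto simp: offdiag_def)
      have "expectation (\<lambda>s. of_bool ((x + X j s) / 2 \<le> ?g k)) = G (2 * ?g k - x)"
      proof -
        have "expectation (\<lambda>s. of_bool ((x + X j s) / 2 \<le> ?g k)) = (\<integral>y. (indicator {..2 * ?g k - x} y :: real) \<partial>distr M borel (X j))"
          using j by (subst integral_distr) (auto intro!: Bochner_Integration.integral_cong simp: indicator_def)
        thus ?thesis by (simp add: distr[OF j] G_def cdf_def2)
      qed
      moreover have "integrable M (\<lambda>s. of_bool ((x + X j s) / 2 \<le> ?g k) :: real)"
        using j by (intro integrable_const_bound[where B = 1]) auto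
      ultimately show "expectation (\<lambda>s. ?h x (X j s)) = 0"
        unfolding hoeffding_kernel_def using Gint[OF j] EG[OF j] by (simp add: prob_space)
    qed
    moreover have "BD k \<subseteq> {s \<in> space M. \<bar>\<Sum>(i, j)\<in>offdiag n. ?h (X i s) (X j s)\<bar> \<ge> 8 * real n * (real n * q\<^sup>2)}"
    proof
      fix s assume s: "s \<in> BD k"
      have "D k (v s) = (\<Sum>(i, j)\<in>offdiag n. hoeffding_kernel G U (?g k) (X i s) (X j s))"
        unfolding D_def by (intro sum.cong refl) (auto simp: offdiag_def vi)
      hence eq: "(\<Sum>(i, j)\<in>offdiag n. ?h (X i s) (X j s)) = D k (v s) / 2"
        by (simp add: sum_divide_distrib case_prod_unfold)
      have "s \<in> space M" "16 * (real n)\<^sup>2 * q\<^sup>2 < \<bar>D k (v s)\<bar>" using s by (auto simp: BD_def)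
      thus "s \<in> {s \<in> space M. \<bar>\<Sum>(i, j)\<in>offdiag n. ?h (X i s) (X j s)\<bar> \<ge> 8 * real n * (real n * q\<^sup>2)}"
        unfolding mem_Collect_eq eq by (simp add: power2_eq_square)
    qed
    moreover have "{s \<in> space M. \<bar>\<Sum>(i, j)\<in>offdiag n. ?h (X i s) (X j s)\<bar> \<ge> 8 * real n * (real n * q\<^sup>2)} \<in> events"
    proof -
      have [measurable]: "(\<lambda>s. \<Sum>(i, j)\<in>offdiag n. ?h (X i s) (X j s)) \<in> borel_measurable M"
        unfolding hoeffding_kernel_def by (rule measurable_sum_offdiag) measurable
      show ?thesis by measurable
    qed
    ultimately have "prob (BD k) \<le> 28 * exp (- (real n * q\<^sup>2))"
      using finite_measure_mono order_trans by blast
    thus ?thesis by (simp add: e_def)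
  qed
  have hoeff: "prob {s \<in> space M. \<bar>(\<Sum>i\<in>{1..n}. h (X i s)) - real n * m\<bar> > H * (real n * q)} \<le> 2 * e\<^sup>2"
    if h [measurable]: "h \<in> borel_measurable borel" and H: "H > 0" "\<And>x. 0 \<le> h x" "\<And>x. h x \<le> H"
      and m: "\<And>i. i \<in> {1..n} \<Longrightarrow> expectation (\<lambda>s. h (X i s)) = m" for h :: "real \<Rightarrow> real" and H m
  proof -
    have "indep_vars (\<lambda>_. borel) (\<lambda>i s. h (X i s)) {1..n}"
      by (rule indep_vars_compose2[OF ind]) simp
    hence "prob {s \<in> space M. \<bar>(\<Sum>i\<in>{1..n}. h (X i s)) - (\<Sum>i\<in>{1..n}. expectation (\<lambda>s. h (X i s)))\<bar>
        \<ge> H * sqrt (real n * (real n * q\<^sup>2))} \<le> 2 * exp (- 2 * (real n * q\<^sup>2))"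
      using n H by (intro hoeffding_tail[where a = "\<lambda>_. 0"]) auto
    hence le: "prob {s \<in> space M. \<bar>(\<Sum>i\<in>{1..n}. h (X i s)) - real n * m\<bar> \<ge> H * (real n * q)} \<le> 2 * e\<^sup>2"
      unfolding ee sq using m by simp
    have "prob {s \<in> space M. \<bar>(\<Sum>i\<in>{1..n}. h (X i s)) - real n * m\<bar> > H * (real n * q)}
        \<le> prob {s \<in> space M. \<bar>(\<Sum>i\<in>{1..n}. h (X i s)) - real n * m\<bar> \<ge> H * (real n * q)}"
      by (intro finite_measure_mono) auto
    with le show ?thesis by linarith
  qed
  have pE: "prob (BE p) \<le> 2 * e\<^sup>2" if p: "p \<in> J" for p
  proof -
    obtain k l where kl: "p = (k, l)" "k < l" "l \<le> 2 * n" using p by (auto simp: J_def)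
    have less: "?g k < ?g l" using kl c n by (simp add: window_grid_def divide_strict_right_mono)
    define h where "h = (\<lambda>x. G (2 * ?g l - x) - G (2 * ?g k - x))"
    have "prob {s \<in> space M. \<bar>(\<Sum>i\<in>{1..n}. h (X i s)) - real n * (U (?g l) - U (?g k))\<bar>
        > 2 * L * (?g l - ?g k) * (real n * q)} \<le> 2 * e\<^sup>2"
    proof (rule hoeff)
      show "h \<in> borel_measurable borel" unfolding h_def by measurable
      show "0 < 2 * L * (?g l - ?g k)" using less L by simp
      show "0 \<le> h x" for x unfolding h_def using less by (simp add: monoD[OF G(1)])
      show "h x \<le> 2 * L * (?g l - ?g k)" for x
        unfolding h_def using Glip[of "2 * ?g k - x" "2 * ?g l - x"] less by (simp add: algebra_simps)
      show "expectation (\<lambda>s. h (X i s)) = U (?g l) - U (?g k)" if "i \<in> {1..n}" for i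
        unfolding h_def using Gint[OF that] EG[OF that] by simp
    qed
    moreover have "BE p = {s \<in> space M. \<bar>(\<Sum>i\<in>{1..n}. h (X i s)) - real n * (U (?g l) - U (?g k))\<bar>
        > 2 * L * (?g l - ?g k) * (real n * q)}"
      unfolding BE_def E_def h_def by (simp add: kl(1) vi)
    ultimately show ?thesis by simp
  qed
  have pT: "prob BT \<le> 2 * e\<^sup>2"
  proof -
    have "prob {s \<in> space M. \<bar>(\<Sum>i\<in>{1..n}. G (2 * \<theta> - X i s)) - real n * (1 / 2)\<bar> > 1 * (real n * q)} \<le> 2 * e\<^sup>2"
      by (rule hoeff) (use G EG median in auto)
    thus ?thesis by (simp add: BT_def T_def vi)
  qed
  have pQ: "prob (BQ k) \<le> 2 * e\<^sup>2" if k: "k \<in> {1..<n}" for k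
  proof -
    have "prob {s \<in> space M. \<bar>(\<Sum>i\<in>{1..n}. of_bool (X i s \<le> a k)) - real n * G (a k)\<bar> > 1 * (real n * q)} \<le> 2 * e\<^sup>2"
    proof (rule hoeff)
      fix i assume i: "i \<in> {1..n}"
      have "expectation (\<lambda>s. of_bool (X i s \<le> a k)) = (\<integral>x. (indicator {..a k} x :: real) \<partial>distr M borel (X i))"
        using i by (subst integral_distr) (auto intro!: Bochner_Integration.integral_cong simp: indicator_def)
      thus "expectation (\<lambda>s. of_bool (X i s \<le> a k)) = G (a k)"
        by (simp add: distr[OF i] G_def cdf_def2)
    qed auto
    moreover have "Q k (v s) = (\<Sum>i\<in>{1..n}. of_bool (X i s \<le> a k)) - real n * G (a k)" for s
      unfolding Q_def a[OF k] using n by (auto intro!: sum.cong simp: vi)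
    ultimately show ?thesis by (simp only: BQ_def mult_1)
  qed
  define Bad where "Bad = ((\<Union>k\<in>{..2 * n}. BD k) \<union> (\<Union>p\<in>J. BE p)) \<union> (BT \<union> (\<Union>k\<in>{1..<n}. BQ k))"
  have Badm: "Bad \<in> events" unfolding Bad_def using finJ by (intro sets.Un sets.finite_UN) auto
  have "prob Bad \<le> (3 * real n * (28 * e) + 9 * (real n)\<^sup>2 * (2 * e\<^sup>2)) + (2 * e\<^sup>2 + real n * (2 * e\<^sup>2))"
    unfolding Bad_def
  proof (intro order_trans[OF measure_Un_le] add_mono)
    show "prob (\<Union>k\<in>{..2 * n}. BD k) \<le> 3 * real n * (28 * e)"
      using pD e n by (intro prob_finite_union_le) auto
    show "prob (\<Union>p\<in>J. BE p) \<le> 9 * (real n)\<^sup>2 * (2 * e\<^sup>2)"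
      using pE finJ cJ by (intro prob_finite_union_le) auto
    show "prob (\<Union>k\<in>{1..<n}. BQ k) \<le> real n * (2 * e\<^sup>2)"
      using pQ by (intro prob_finite_union_le) auto
  qed (use pT finJ in \<open>auto intro!: sets.finite_UN sets.Un\<close>)
  also have "\<dots> \<le> 106 * (real n * e)"
  proof -
    have e1: "e \<le> real n * e" using n e by simp
    have "(real n * e) * (real n * e) \<le> (real n * e) * 1" using e by (intro mult_left_mono) auto
    hence 1: "(real n)\<^sup>2 * e\<^sup>2 \<le> real n * e" by (simp add: power2_eq_square algebra_simps)
    have 2: "real n * e\<^sup>2 \<le> (real n)\<^sup>2 * e\<^sup>2" using n by (intro mult_right_mono) (auto simp: power2_eq_square)
    have 3: "e\<^sup>2 \<le> real n * e\<^sup>2" using n e by simp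
    show ?thesis using 1 2 3 by (simp add: algebra_simps)
  qed
  finally have Bad: "prob Bad \<le> 106 * (real n * e)" .
  have "space M - Bad \<subseteq> {s \<in> space M. v s \<in> A}"
  proof
    fix s assume s: "s \<in> space M - Bad"
    hence "v s \<in> space ?P" using measurable_space[OF vm] by simp
    thus "s \<in> {s \<in> space M. v s \<in> A}"
      using s by (auto simp: A_def Bad_def BD_def BE_def BT_def BQ_def not_less)
  qed
  moreover have "{s \<in> space M. v s \<in> A} \<in> events"
  proof -
    have "{s \<in> space M. v s \<in> A} = v -` A \<inter> space M" by auto
    thus ?thesis using measurable_sets[OF vm Am] by simp
  qed
  ultimately have "prob (space M - Bad) \<le> prob {s \<in> space M. v s \<in> A}"
    by (intro finite_measure_mono)
  hence "prob {s \<in> space M. v s \<in> A} \<ge> 1 - 106 * (real n * e)"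
    using prob_compl[OF Badm] Bad by linarith
  thus ?thesis using that[OF Am reg] by (simp add: v_def e_def)
qed

section \<open>Quadratic forms in the bootstrap weights\<close>

lemma (in prob_space) doubled_bernoulli_AE:
  fixes W :: "'a \<Rightarrow> real"
  assumes [measurable]: "W \<in> borel_measurable M"
    and "prob {s \<in> space M. W s = 0} = 1 / 2" "prob {s \<in> space M. W s = 2} = 1 / 2"
  shows "AE s in M. W s = 0 \<or> W s = 2"
proof -
  have "{s \<in> space M. W s = 0 \<or> W s = 2} = {s \<in> space M. W s = 0} \<union> {s \<in> space M. W s = 2}" by auto
  also have "prob \<dots> = prob {s \<in> space M. W s = 0} + prob {s \<in> space M. W s = 2}"
    by (rule finite_measure_Union) auto
  finally have "prob {s \<in> space M. W s = 0 \<or> W s = 2} = 1" using assms by simp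
  thus ?thesis by (subst (asm) prob_Collect_eq_1) auto
qed

text \<open>The splitting \<open>v\<^sub>i v\<^sub>j - 1 = \<epsilon>\<^sub>i + \<epsilon>\<^sub>j + \<epsilon>\<^sub>i
\<epsilon>\<^sub>j\<close> separates a linear form, whose coefficients are the row sums of \<open>a\<close>, from a degenerate
quadratic one.\<close>

lemma weighted_pair_sum_expansion:
  fixes a :: "nat \<Rightarrow> nat \<Rightarrow> real" and \<epsilon> v :: "nat \<Rightarrow> real"
  assumes "\<And>i. i \<in> {1..n} \<Longrightarrow> v i = 1 + \<epsilon> i" "\<And>i j. a i j = a j i"
  shows "(\<Sum>(i, j)\<in>offdiag n. (v i * v j - 1) * a i j)
    = 2 * (\<Sum>i\<in>{1..n}. \<epsilon> i * (\<Sum>j\<in>{1..n} - {i}. a i j)) + (\<Sum>(i, j)\<in>offdiag n. a i j * \<epsilon> i * \<epsilon> j)"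
proof -
  have swap: "(\<Sum>(i, j)\<in>offdiag n. \<epsilon> j * a i j) = (\<Sum>(i, j)\<in>offdiag n. \<epsilon> i * a i j)"
    by (rule sum.reindex_bij_witness[of _ prod.swap prod.swap]) (auto simp: offdiag_def assms(2))
  have "(\<Sum>(i, j)\<in>offdiag n. (v i * v j - 1) * a i j)
     = (\<Sum>(i, j)\<in>offdiag n. \<epsilon> i * a i j + \<epsilon> j * a i j + a i j * \<epsilon> i * \<epsilon> j)"
    by (intro sum.cong refl) (auto simp: offdiag_def assms(1) algebra_simps)
  also have "\<dots> = (\<Sum>(i, j)\<in>offdiag n. \<epsilon> i * a i j) + (\<Sum>(i, j)\<in>offdiag n. \<epsilon> j * a i j)
      + (\<Sum>(i, j)\<in>offdiag n. a i j * \<epsilon> i * \<epsilon> j)"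
    unfolding case_prod_unfold sum.distrib ..
  also have "(\<Sum>(i, j)\<in>offdiag n. \<epsilon> i * a i j) = (\<Sum>i\<in>{1..n}. \<epsilon> i * (\<Sum>j\<in>{1..n} - {i}. a i j))"
    by (simp only: sum_offdiag sum_distrib_left)
  finally show ?thesis unfolding swap by (simp only: sum_offdiag sum_distrib_left mult_2 sum.distrib)
qed

text \<open>The linear form is controlled by Hoeffding's inequality through the bound \<open>\<beta>\<close> on the row sums, and
the quadratic form by \<open>degenerate_chaos_tail\<close>; small row sums make the whole form small.\<close>

lemma (in prob_space) weighted_pair_sum_tail:
  fixes \<omega> :: "nat \<Rightarrow> 'a \<Rightarrow> real" and a :: "nat \<Rightarrow> nat \<Rightarrow> real"
  assumes n: "n > 0" and ind: "indep_vars (\<lambda>_. borel) \<omega> {1..n}"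
    and w0: "\<And>i. i \<in> {1..n} \<Longrightarrow> prob {s \<in> space M. \<omega> i s = 0} = 1 / 2"
    and w2: "\<And>i. i \<in> {1..n} \<Longrightarrow> prob {s \<in> space M. \<omega> i s = 2} = 1 / 2"
    and bound: "\<And>i j. \<bar>a i j\<bar> \<le> 1" and sym: "\<And>i j. a i j = a j i"
    and rows: "\<And>i. i \<in> {1..n} \<Longrightarrow> \<bar>\<Sum>j\<in>{1..n} - {i}. a i j\<bar> \<le> \<beta>" and pos: "\<beta> > 0" "y \<ge> 0"
  shows "prob {s \<in> space M. \<bar>\<Sum>(i, j)\<in>offdiag n. (\<omega> i s * \<omega> j s - 1) * a i j\<bar>
            > 2 * \<beta> * sqrt (2 * real n * y) + 8 * real n * y} \<le> 30 * exp (- y)"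
proof -
  \<comment> \<open>A version of \<open>\<omega> - 1\<close> that is \<open>\<plusminus>1\<close> everywhere and not merely almost surely.\<close>
  define sg :: "real \<Rightarrow> real" where "sg = (\<lambda>v. if v = 0 then - 1 else 1)"
  have sgm [measurable]: "sg \<in> borel_measurable borel" unfolding sg_def by measurable
  have \<omega> [measurable]: "\<omega> i \<in> borel_measurable M" if "i \<in> {1..n}" for i
    using ind that by (auto simp: indep_vars_def)
  have E0: "expectation (\<lambda>s. sg (\<omega> i s)) = 0" if i: "i \<in> {1..n}" for i
  proof -
    have "expectation (\<lambda>s. sg (\<omega> i s)) = expectation (\<lambda>s. 1 - 2 * indicator {s \<in> space M. \<omega> i s = 0} s)"
      by (intro Bochner_Integration.integral_cong) (auto simp: sg_def indicator_def)
    also have "\<dots> = 1 - 2 * prob {s \<in> space M. \<omega> i s = 0}"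
    proof -
      have [measurable]: "{s \<in> space M. \<omega> i s = 0} \<in> events" using i by measurable
      have "integrable M (indicator {s \<in> space M. \<omega> i s = 0} :: 'a \<Rightarrow> real)"
        by (intro integrable_real_indicator) (auto simp: emeasure_eq_measure)
      moreover have "{s \<in> space M. \<omega> i s = 0} \<inter> space M = {s \<in> space M. \<omega> i s = 0}" by auto
      ultimately show ?thesis by (simp add: prob_space)
    qed
    finally show ?thesis using w0[OF i] by simp
  qed
  define b where "b = (\<lambda>i. \<Sum>j\<in>{1..n} - {i}. a i j)"
  define Li where "Li = {s \<in> space M. \<bar>(\<Sum>i\<in>{1..n}. sg (\<omega> i s) * b i)\<bar> \<ge> \<beta> * sqrt (2 * real n * y)}"
  define Ch where "Ch = {s \<in> space M. \<bar>\<Sum>(i, j)\<in>offdiag n. a i j * sg (\<omega> i s) * sg (\<omega> j s)\<bar> \<ge> 8 * real n * y}"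
  define Nu where "Nu = {s \<in> space M. \<not> (\<forall>i\<in>{1..n}. \<omega> i s = 0 \<or> \<omega> i s = 2)}"
  have [measurable]: "Li \<in> events" unfolding Li_def by measurable
  have [measurable]: "Ch \<in> events"
  proof -
    have [measurable]: "(\<lambda>s. \<Sum>(i, j)\<in>offdiag n. a i j * sg (\<omega> i s) * sg (\<omega> j s)) \<in> borel_measurable M"
      by (rule measurable_sum_offdiag) measurable
    show ?thesis unfolding Ch_def by measurable
  qed
  have [measurable]: "Nu \<in> events" unfolding Nu_def by measurable
  have pN: "prob Nu = 0"
  proof -
    have "AE s in M. \<forall>i\<in>{1..n}. \<omega> i s = 0 \<or> \<omega> i s = 2"
      using w0 w2 \<omega> by (intro AE_finite_allI doubled_bernoulli_AE) auto
    hence "AE s in M. s \<notin> Nu" by eventually_elim (simp add: Nu_def)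
    thus ?thesis by (simp add: prob_eq_0)
  qed
  have pL: "prob Li \<le> 2 * exp (- y)"
  proof -
    have ind': "indep_vars (\<lambda>_. borel) (\<lambda>i s. sg (\<omega> i s) * b i) {1..n}"
      by (rule indep_vars_compose2[OF ind]) simp
    have tail: "prob {s \<in> space M. \<bar>(\<Sum>i\<in>{1..n}. sg (\<omega> i s) * b i) - (\<Sum>i\<in>{1..n}. expectation (\<lambda>s. sg (\<omega> i s) * b i))\<bar>
        \<ge> (2 * \<beta>) * sqrt (real n * (y / 2))} \<le> 2 * exp (- 2 * (y / 2))"
    proof (rule hoeffding_tail[OF _ _ ind', where a = "\<lambda>_. - \<beta>"])
      fix i s assume i: "i \<in> {1..n}"
      have "\<bar>sg (\<omega> i s) * b i\<bar> \<le> \<beta>" using rows[OF i] by (simp add: sg_def b_def)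
      thus "sg (\<omega> i s) * b i \<in> {- \<beta>..- \<beta> + 2 * \<beta>}" by (auto simp: abs_le_iff)
    qed (use n pos in auto)
    have eq: "(2 * \<beta>) * sqrt (real n * (y / 2)) = \<beta> * sqrt (2 * real n * y)"
    proof -
      have "2 * sqrt (real n * (y / 2)) = sqrt (4 * (real n * (y / 2)))" by (simp only: real_sqrt_mult real_sqrt_four)
      also have "4 * (real n * (y / 2)) = 2 * real n * y" by simp
      finally show ?thesis by simp
    qed
    have "(\<Sum>i\<in>{1..n}. expectation (\<lambda>s. sg (\<omega> i s) * b i)) = 0" using E0 by simp
    thus ?thesis using tail unfolding eq Li_def by simp
  qed
  have pC: "prob Ch \<le> 28 * exp (- y)"
    unfolding Ch_def
  proof (rule degenerate_chaos_tail[OF n ind, where g = "\<lambda>i j u v. a i j * sg u * sg v"])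
    show "(\<lambda>(u, v). a i j * sg u * sg v) \<in> borel_measurable (borel \<Otimes>\<^sub>M borel)" for i j
      by measurable
    show "\<bar>a i j * sg u * sg v\<bar> \<le> 1" for i j u v
      using bound[of i j] by (simp add: sg_def)
  next
    fix i j :: nat and v :: real assume "(i, j) \<in> offdiag n"
    hence "i \<in> {1..n}" by (auto simp: offdiag_def)
    thus "expectation (\<lambda>s. a i j * sg (\<omega> i s) * sg v) = 0" using E0 by simp
  next
    fix i j :: nat and u :: real assume "(i, j) \<in> offdiag n"
    hence "j \<in> {1..n}" by (auto simp: offdiag_def)
    thus "expectation (\<lambda>s. a i j * sg u * sg (\<omega> j s)) = 0" using E0 by simp
  qed
  have "{s \<in> space M. \<bar>\<Sum>(i, j)\<in>offdiag n. (\<omega> i s * \<omega> j s - 1) * a i j\<bar>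
            > 2 * \<beta> * sqrt (2 * real n * y) + 8 * real n * y} \<subseteq> (Li \<union> Ch) \<union> Nu"
  proof
    fix s assume s: "s \<in> {s \<in> space M. \<bar>\<Sum>(i, j)\<in>offdiag n. (\<omega> i s * \<omega> j s - 1) * a i j\<bar>
            > 2 * \<beta> * sqrt (2 * real n * y) + 8 * real n * y}"
    show "s \<in> (Li \<union> Ch) \<union> Nu"
    proof (rule ccontr)
      assume not: "s \<notin> (Li \<union> Ch) \<union> Nu"
      have "\<omega> i s = 1 + sg (\<omega> i s)" if "i \<in> {1..n}" for i
        using not s that by (auto simp: Nu_def sg_def)
      from weighted_pair_sum_expansion[of n "\<lambda>i. \<omega> i s" "\<lambda>i. sg (\<omega> i s)" a, OF this sym]
      have "(\<Sum>(i, j)\<in>offdiag n. (\<omega> i s * \<omega> j s - 1) * a i j)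
          = 2 * (\<Sum>i\<in>{1..n}. sg (\<omega> i s) * b i) + (\<Sum>(i, j)\<in>offdiag n. a i j * sg (\<omega> i s) * sg (\<omega> j s))"
        by (simp only: b_def)
      moreover have "\<bar>\<Sum>i\<in>{1..n}. sg (\<omega> i s) * b i\<bar> < \<beta> * sqrt (2 * real n * y)"
        using not s by (auto simp: Li_def)
      moreover have "\<bar>\<Sum>(i, j)\<in>offdiag n. a i j * sg (\<omega> i s) * sg (\<omega> j s)\<bar> < 8 * real n * y"
        using not s by (auto simp: Ch_def)
      ultimately show False using s by auto
    qed
  qed
  hence "prob {s \<in> space M. \<bar>\<Sum>(i, j)\<in>offdiag n. (\<omega> i s * \<omega> j s - 1) * a i j\<bar>
            > 2 * \<beta> * sqrt (2 * real n * y) + 8 * real n * y} \<le> prob ((Li \<union> Ch) \<union> Nu)"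
    by (intro finite_measure_mono) auto
  also have "\<dots> \<le> prob (Li \<union> Ch) + prob Nu" by (intro measure_Un_le) auto
  also have "\<dots> \<le> (prob Li + prob Ch) + prob Nu" by (intro add_right_mono measure_Un_le) auto
  also have "\<dots> \<le> 30 * exp (- y)" using pL pC pN by simp
  finally show ?thesis .
qed

section \<open>Medians of monotone functions\<close>

lemma cdf_median_ge:
  assumes "mono G" "G a < 1 / 2" "G b \<ge> 1 / 2"
  shows "a \<le> cdf_median G"
  unfolding cdf_median_def
proof (rule cInf_greatest)
  show "{t. 1 / 2 \<le> G t} \<noteq> {}" using assms(3) by blast
  fix t assume "t \<in> {t. 1 / 2 \<le> G t}"
  hence "G a < G t" using assms(2) by simp
  thus "a \<le> t" using monoD[OF assms(1), of t a] by (cases "a \<le> t") auto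
qed

lemma bdd_below_upper_half:
  assumes "mono G" "G a < (1 / 2 :: real)"
  shows "bdd_below {t :: real. 1 / 2 \<le> G t}"
proof (rule bdd_belowI)
  fix t assume "t \<in> {t. 1 / 2 \<le> G t}"
  hence "G a < G t" using assms(2) by simp
  thus "a \<le> t" using monoD[OF assms(1), of t a] by (cases "a \<le> t") auto
qed

lemma cdf_median_le:
  assumes "mono G" "G a < 1 / 2" "G b \<ge> 1 / 2"
  shows "cdf_median G \<le> b"
  unfolding cdf_median_def
  using assms by (intro cInf_lower bdd_below_upper_half) auto

lemma above_cdf_median:
  assumes "mono G" "G a < 1 / 2" "G b \<ge> 1 / 2" "cdf_median G < t"
  shows "G t \<ge> 1 / 2"
proof -
  obtain s where "G s \<ge> 1 / 2" "s < t"
    using assms cInf_lessD[of "{t. 1 / 2 \<le> G t}" t] unfolding cdf_median_def by blast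
  thus ?thesis using monoD[OF assms(1), of s t] by simp
qed

lemma below_cdf_median:
  assumes "mono G" "G a < 1 / 2" "t < cdf_median G"
  shows "G t < 1 / 2"
proof (rule ccontr)
  assume "\<not> G t < 1 / 2"
  hence "cdf_median G \<le> t" using assms by (intro cdf_median_le) auto
  thus False using assms by simp
qed

section \<open>The score of the bootstrap weights\<close>

definition boot_score :: "nat \<Rightarrow> (nat \<Rightarrow> real) \<Rightarrow> (nat \<Rightarrow> real) \<Rightarrow> real \<Rightarrow> real" where
  "boot_score n v x t = (\<Sum>(i, j)\<in>offdiag n. (v i * v j - 1) * (of_bool ((x i + x j) / 2 \<le> t) - 1 / 2))"

lemma sum_offdiag_const: "(\<Sum>(i, j)\<in>offdiag n. c) = real n * (real n - 1) * (c :: real)"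
proof -
  have "(\<Sum>(i, j)\<in>offdiag n. c) = (\<Sum>i\<in>{1..n}. \<Sum>j\<in>{1..n} - {i}. c)"
    by (rule sum_offdiag)
  also have "\<dots> = (\<Sum>i\<in>{1..n}. (real n - 1) * c)"
    by (intro sum.cong refl) (auto simp: of_nat_diff)
  finally show ?thesis by simp
qed

text \<open>The median of \<open>U_boot\<close> is where the right-hand side changes sign, so that the weights act on the median
only through the score.\<close>

lemma U_boot_score:
  assumes "n \<ge> 2" "weight_total n v \<noteq> 0"
  shows "weight_total n v * (U_boot n v x t - 1 / 2) = real n * (real n - 1) * (U_stat n x t - 1 / 2) + boot_score n v x t"
proof -
  define V where "V = (\<Sum>(i, j)\<in>offdiag n. v i * v j * of_bool ((x i + x j) / 2 \<le> t))"
  define H where "H = (\<Sum>(i, j)\<in>offdiag n. of_bool ((x i + x j) / 2 \<le> t) :: real)"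
  have "boot_score n v x t = (\<Sum>(i, j)\<in>offdiag n. v i * v j * of_bool ((x i + x j) / 2 \<le> t)
      - of_bool ((x i + x j) / 2 \<le> t) - 1 / 2 * (v i * v j) + 1 / 2)"
    unfolding boot_score_def by (intro sum.cong refl) (auto simp: algebra_simps)
  also have "\<dots> = V - H - 1 / 2 * weight_total n v + (\<Sum>(i, j)\<in>offdiag n. 1 / 2)"
    by (simp only: V_def H_def weight_total_def case_prod_unfold sum.distrib sum_subtractf sum_distrib_left)
  finally have "boot_score n v x t = V - H - 1 / 2 * weight_total n v + real n * (real n - 1) * (1 / 2)"
    by (simp only: sum_offdiag_const)
  moreover have "weight_total n v * U_boot n v x t = V" using assms by (simp add: U_boot_def V_def)
  moreover have "real n * (real n - 1) * U_stat n x t = H" using assms by (simp add: U_stat_def H_def)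
  ultimately show ?thesis by (simp add: right_diff_distrib)
qed

lemma U_boot_mono:
  assumes "\<And>i. i \<in> {1..n} \<Longrightarrow> v i \<ge> 0" "weight_total n v > 0" "s \<le> t"
  shows "U_boot n v x s \<le> U_boot n v x t"
proof -
  have "(\<Sum>(i, j)\<in>offdiag n. v i * v j * of_bool ((x i + x j) / 2 \<le> s))
      \<le> (\<Sum>(i, j)\<in>offdiag n. v i * v j * of_bool ((x i + x j) / 2 \<le> t))"
  proof (intro sum_mono, clarify)
    fix i j assume "(i, j) \<in> offdiag n"
    hence "0 \<le> v i * v j" using assms(1) by (auto simp: offdiag_def)
    thus "v i * v j * of_bool ((x i + x j) / 2 \<le> s) \<le> v i * v j * of_bool ((x i + x j) / 2 \<le> t)"
      using assms(3) by (intro mult_left_mono) auto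
  qed
  thus ?thesis unfolding U_boot_def using assms(2) by (intro mult_left_mono) auto
qed

lemma weight_total_pos_imp_selected:
  assumes "weight_total n v > 0"
  shows "card (selected n v) \<ge> 2"
proof -
  have "\<exists>p\<in>offdiag n. v (fst p) * v (snd p) \<noteq> 0"
  proof (rule ccontr)
    assume "\<not> (\<exists>p\<in>offdiag n. v (fst p) * v (snd p) \<noteq> 0)"
    hence "weight_total n v = 0"
      unfolding weight_total_def case_prod_unfold by (intro sum.neutral) blast
    thus False using assms by simp
  qed
  then obtain p where p: "p \<in> offdiag n" "v (fst p) * v (snd p) \<noteq> 0" by blast
  hence "{fst p, snd p} \<subseteq> selected n v" "fst p \<noteq> snd p"
    by (auto simp: selected_def offdiag_def)
  moreover have "finite (selected n v)" by (simp add: selected_def)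
  ultimately show ?thesis using card_mono[of "selected n v" "{fst p, snd p}"] by simp
qed

text \<open>Here \<open>a\<close> is the point where \<open>N (Hn - 1 / 2) + S\<close> changes sign and \<open>b\<close> the
median of \<open>Hn\<close>. At a grid point just above \<open>a\<close> the first expression is nonnegative; replacing
\<open>S\<close> by its value at the centre \<open>\<theta>\<close>, the value 1/2 by \<open>Hn\<close> just below
\<open>b\<close>, and the increment of \<open>Hn\<close> by \<open>u\<close> times the distance yields a lower bound for \<open>a
- b\<close>; a grid point just below \<open>a\<close> gives the upper bound. Points at distance \<open>h\<close> from
\<open>a\<close> and \<open>b\<close> are used because nothing is known about the values of the step functions at their
medians.\<close>

lemma median_linearisation:
  fixes Hn U S :: "real \<Rightarrow> real"
  assumes pos: "N > 0" "u > 0" "K \<ge> 0" "\<kappa> \<ge> 0" "\<rho> \<ge> 0" "0 < h" "h \<le> q\<^sup>2" "q \<ge> 0" "R \<ge> 0" "\<rho> \<le> c"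
    and incr: "\<And>s t. \<theta> - c \<le> s \<Longrightarrow> s \<le> t \<Longrightarrow> t \<le> \<theta> + c \<Longrightarrow>
        \<bar>Hn t - Hn s - (U t - U s)\<bar> \<le> K * ((t - s) * q + q\<^sup>2)"
    and lin: "\<And>s t. \<bar>s - \<theta>\<bar> \<le> \<rho> \<Longrightarrow> \<bar>t - \<theta>\<bar> \<le> \<rho> \<Longrightarrow> \<bar>U t - U s - u * (t - s)\<bar> \<le> \<kappa> * \<rho> * \<bar>t - s\<bar>"
    and hat: "Hn (b - h) \<le> 1 / 2" "1 / 2 \<le> Hn (b + h)" "\<bar>b - h - \<theta>\<bar> \<le> \<rho>" "\<bar>b + h - \<theta>\<bar> \<le> \<rho>"
    and up: "a + h \<le> t1" "t1 \<le> a + 2 * h" "\<bar>t1 - \<theta>\<bar> \<le> \<rho>" "0 \<le> N * (Hn t1 - 1 / 2) + S t1" "\<bar>S t1 - S \<theta>\<bar> \<le> R"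
    and lo: "a - 2 * h \<le> t0" "t0 \<le> a - h" "\<bar>t0 - \<theta>\<bar> \<le> \<rho>" "N * (Hn t0 - 1 / 2) + S t0 \<le> 0" "\<bar>S t0 - S \<theta>\<bar> \<le> R"
    and close: "\<bar>a - b\<bar> \<le> \<delta>"
  shows "\<bar>a - b + S \<theta> / (N * u)\<bar> \<le> 3 * q\<^sup>2 + ((\<kappa> * \<rho> + K * q) * (\<delta> + 3 * h) + K * q\<^sup>2) / u + R / (N * u)"
proof -
  \<comment> \<open>The error of replacing an increment of \<open>Hn\<close> by \<open>u\<close> times the distance.\<close>
  define B where "B = (\<kappa> * \<rho> + K * q) * (\<delta> + 3 * h) + K * q\<^sup>2"
  have step: "\<bar>Hn t - Hn s - u * (t - s)\<bar> \<le> B"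
    if s: "\<bar>s - \<theta>\<bar> \<le> \<rho>" and t: "\<bar>t - \<theta>\<bar> \<le> \<rho>" and d: "\<bar>t - s\<bar> \<le> \<delta> + 3 * h" for s t
  proof -
    have win: "\<theta> - c \<le> s" "s \<le> \<theta> + c" "\<theta> - c \<le> t" "t \<le> \<theta> + c"
      using s t pos(10) by (simp_all add: abs_le_iff)
    have "\<bar>Hn t - Hn s - (U t - U s)\<bar> \<le> K * (\<bar>t - s\<bar> * q + q\<^sup>2)"
    proof (cases "s \<le> t")
      case True
      thus ?thesis using incr[OF win(1) True win(4)] by simp
    next
      case False
      have "\<bar>Hn s - Hn t - (U s - U t)\<bar> \<le> K * ((s - t) * q + q\<^sup>2)"
        using False win by (intro incr) simp_all
      moreover have "\<bar>Hn s - Hn t - (U s - U t)\<bar> = \<bar>Hn t - Hn s - (U t - U s)\<bar>"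
        by linarith
      moreover have "\<bar>t - s\<bar> = s - t" using False by linarith
      ultimately show ?thesis by simp
    qed
    hence "\<bar>Hn t - Hn s - u * (t - s)\<bar> \<le> K * (\<bar>t - s\<bar> * q + q\<^sup>2) + \<kappa> * \<rho> * \<bar>t - s\<bar>"
      using lin[OF s t] by linarith
    also have "\<dots> = (\<kappa> * \<rho> + K * q) * \<bar>t - s\<bar> + K * q\<^sup>2" by (simp add: algebra_simps)
    also have "\<dots> \<le> B" unfolding B_def using d pos(3,4,5,8)
      by (intro add_right_mono mult_left_mono add_nonneg_nonneg mult_nonneg_nonneg)
    finally show ?thesis .
  qed
  have div: "0 \<le> y / (N * u)" if "0 \<le> y" for y using that pos(1,2) by simp
  have upper: "- (a - b + S \<theta> / (N * u)) \<le> 3 * q\<^sup>2 + B / u + R / (N * u)"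
  proof -
    have "\<bar>Hn t1 - Hn (b - h) - u * (t1 - (b - h))\<bar> \<le> B"
    proof (rule step)
      show "\<bar>t1 - (b - h)\<bar> \<le> \<delta> + 3 * h" using close up(1,2) pos(6) by linarith
    qed fact+
    hence "Hn t1 - 1 / 2 \<le> u * (t1 - (b - h)) + B" using hat(1) by linarith
    hence "N * (Hn t1 - 1 / 2) \<le> N * (u * (t1 - (b - h)) + B)" using pos(1) by (intro mult_left_mono) auto
    hence "0 \<le> N * (u * (t1 - (b - h)) + B) + S \<theta> + R" using up(4,5) by linarith
    hence "0 \<le> (N * (u * (t1 - (b - h)) + B) + S \<theta> + R) / (N * u)" by (rule div)
    also have "\<dots> = (t1 - (b - h)) + B / u + S \<theta> / (N * u) + R / (N * u)"
      using pos(1,2) by (simp add: field_simps)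
    finally show ?thesis using up(2) pos(7) by linarith
  qed
  have lower: "a - b + S \<theta> / (N * u) \<le> 3 * q\<^sup>2 + B / u + R / (N * u)"
  proof -
    have "\<bar>Hn t0 - Hn (b + h) - u * (t0 - (b + h))\<bar> \<le> B"
    proof (rule step)
      show "\<bar>t0 - (b + h)\<bar> \<le> \<delta> + 3 * h" using close lo(1,2) pos(6) by linarith
    qed fact+
    hence "Hn t0 - 1 / 2 \<ge> u * (t0 - (b + h)) - B" using hat(2) by linarith
    hence "N * (Hn t0 - 1 / 2) \<ge> N * (u * (t0 - (b + h)) - B)" using pos(1) by (intro mult_left_mono) auto
    hence "0 \<le> - (N * (u * (t0 - (b + h)) - B) + S \<theta> - R)" using lo(4,5) by linarith
    hence "0 \<le> - (N * (u * (t0 - (b + h)) - B) + S \<theta> - R) / (N * u)" by (rule div)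
    also have "\<dots> = - (t0 - (b + h)) + B / u - S \<theta> / (N * u) + R / (N * u)"
      using pos(1,2) by (simp add: field_simps)
    finally show ?thesis using lo(1) pos(7) by linarith
  qed
  show ?thesis using upper lower unfolding B_def by linarith
qed

section \<open>Comparison of the estimators for regular data and weights\<close>

text \<open>With \<open>m = sqrt (p\<^sup>2 + q\<^sup>2)\<close>, these are the constants in the bounds on the distance of the
Hodges-Lehmann estimator from \<open>\<theta>\<close> (a multiple of \<open>q\<close>), of the bootstrap estimator from it (of
\<open>q\<^sup>2 + p\<close>), of all points in play from \<open>\<theta>\<close> (of \<open>m\<close>), on the variation of the
score over those points (of \<open>n\<^sup>2 m\<^sup>2\<close>), and on the remainder of the linearisation (of
\<open>m\<^sup>2\<close>).\<close>

definition est_const :: "real \<Rightarrow> real" where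
  "est_const \<kappa>0 = 70 / \<kappa>0 + 2"

definition dev_const :: "real \<Rightarrow> real \<Rightarrow> real" where
  "dev_const \<kappa>0 L = 4 / \<kappa>0 * (incr_const L + 22) + 1"

definition radius_const :: "real \<Rightarrow> real \<Rightarrow> real" where
  "radius_const \<kappa>0 L = est_const \<kappa>0 + 2 * dev_const \<kappa>0 L + 2"

definition score_const :: "real \<Rightarrow> real \<Rightarrow> real" where
  "score_const \<kappa>0 L = 6 * L * radius_const \<kappa>0 L + 20"

definition lin_const :: "real \<Rightarrow> real \<Rightarrow> real \<Rightarrow> real" where
  "lin_const \<kappa>0 \<kappa>1 L = 3 + ((\<kappa>1 * radius_const \<kappa>0 L + incr_const L) * (2 * dev_const \<kappa>0 L + 3)
      + incr_const L + 2 * score_const \<kappa>0 L + 2464) / \<kappa>0"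

text \<open>The scales must be so small that the stochastic part of the increments of \<open>U_stat\<close> takes away at most
half of the slope \<open>\<kappa>0\<close>, that the total weight stays above half of its mean, and that all points in play lie
well inside the window.\<close>

definition small_scales :: "real \<Rightarrow> real \<Rightarrow> real \<Rightarrow> real \<Rightarrow> real \<Rightarrow> bool" where
  "small_scales \<kappa>0 L c q p \<longleftrightarrow> 0 < q \<and> q \<le> 1 \<and> 0 < p \<and> p \<le> 1 / 44 \<and>
     incr_const L * q \<le> \<kappa>0 / 2 \<and> radius_const \<kappa>0 L * sqrt (p\<^sup>2 + q\<^sup>2) \<le> c / 2"

definition dev_radius :: "real \<Rightarrow> real \<Rightarrow> real \<Rightarrow> real \<Rightarrow> real" where
  "dev_radius \<kappa>0 L q p = dev_const \<kappa>0 L * (q\<^sup>2 + p)"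

text \<open>The score is bounded at level \<open>z\<close> only at \<open>\<theta>\<close> and at the two points at distance
\<open>dev_radius\<close> from the Hodges-Lehmann estimator; its variation over the grid points near \<open>\<theta>\<close> is of
the smaller order \<open>n\<^sup>2 (p\<^sup>2 + q\<^sup>2)\<close>.\<close>

definition regular_weights ::
   "nat \<Rightarrow> real \<Rightarrow> real \<Rightarrow> real \<Rightarrow> real \<Rightarrow> real \<Rightarrow> real \<Rightarrow> (nat \<Rightarrow> real) \<Rightarrow> (nat \<Rightarrow> real) \<Rightarrow> bool" where
  "regular_weights n \<kappa>0 L \<theta> c q p x v \<longleftrightarrow>
     (\<forall>i\<in>{1..n}. v i = 0 \<or> v i = 2) \<and>
     \<bar>weight_total n v - real n * (real n - 1)\<bar> \<le> 11 * (real n)\<^sup>2 * p \<and>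
     \<bar>boot_score n v x \<theta>\<bar> \<le> 11 * (real n)\<^sup>2 * p \<and>
     \<bar>boot_score n v x (hodges_lehmann n x - dev_radius \<kappa>0 L q p)\<bar> \<le> 11 * (real n)\<^sup>2 * p \<and>
     \<bar>boot_score n v x (hodges_lehmann n x + dev_radius \<kappa>0 L q p)\<bar> \<le> 11 * (real n)\<^sup>2 * p \<and>
     (\<forall>k\<in>{..2 * n}. \<bar>window_grid n \<theta> c k - \<theta>\<bar> \<le> radius_const \<kappa>0 L * sqrt (p\<^sup>2 + q\<^sup>2) \<longrightarrow>
        \<bar>boot_score n v x (window_grid n \<theta> c k) - boot_score n v x \<theta>\<bar>
          \<le> score_const \<kappa>0 L * (real n)\<^sup>2 * (p\<^sup>2 + q\<^sup>2))"

text \<open>The slope of \<open>U\<close> locates in turn the Hodges-Lehmann estimator and the median of \<open>U_boot\<close>;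
then \<open>median_linearisation\<close> applies, and the normalisation by the number of pairs is exchanged for that by the total
weight.\<close>

lemma bootstrap_comparison:
  fixes U :: "real \<Rightarrow> real"
  assumes n: "n \<ge> 2" and c: "0 < c" "c \<le> 1" and \<kappa>: "\<kappa>0 > 0" "\<kappa>1 > 0" and L: "L \<ge> 1"
    and scales: "small_scales \<kappa>0 L c q p" and nq: "real n * q\<^sup>2 \<ge> 1"
    and slope: "\<And>s t. \<theta> - c \<le> s \<Longrightarrow> s \<le> t \<Longrightarrow> t \<le> \<theta> + c \<Longrightarrow> \<kappa>0 * (t - s) \<le> U t - U s"
    and lin: "\<And>s t r. r \<le> c \<Longrightarrow> \<bar>s - \<theta>\<bar> \<le> r \<Longrightarrow> \<bar>t - \<theta>\<bar> \<le> r \<Longrightarrow> \<bar>U t - U s - u * (t - s)\<bar> \<le> \<kappa>1 * r * \<bar>t - s\<bar>"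
    and u: "u \<ge> \<kappa>0"
    and data: "regular_data n U \<theta> c L q x"
    and weights: "regular_weights n \<kappa>0 L \<theta> c q p x v"
  shows "card (selected n v) \<ge> 2"
    and "\<bar>cdf_median (U_boot n v x) - hodges_lehmann n x\<bar> \<le> dev_radius \<kappa>0 L q p"
    and "\<bar>cdf_median (U_boot n v x) - hodges_lehmann n x
           - 1 / weight_total n v * (\<Sum>(i, j)\<in>offdiag n. (v i * v j - 1) *
                ((U_stat n x \<theta> - of_bool ((x i + x j) / 2 \<le> \<theta>)) / u))\<bar> \<le> lin_const \<kappa>0 \<kappa>1 L * (p\<^sup>2 + q\<^sup>2)"
proof -
  define K where "K = incr_const L"
  define r where "r = est_const \<kappa>0 * q"
  define \<delta> where "\<delta> = dev_radius \<kappa>0 L q p"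
  define C2 where "C2 = dev_const \<kappa>0 L"
  define m where "m = sqrt (p\<^sup>2 + q\<^sup>2)"
  define \<rho> where "\<rho> = radius_const \<kappa>0 L * m"
  define h where "h = c / real n"
  define Hn where "Hn = U_stat n x"
  define b where "b = hodges_lehmann n x"
  define a where "a = cdf_median (U_boot n v x)"
  define W where "W = weight_total n v"
  define N where "N = real n * (real n - 1)"
  define S where "S = boot_score n v x"
  note sc = scales[unfolded small_scales_def]
  have q: "0 < q" "q \<le> 1" and p: "0 < p" "p \<le> 1 / 44" and Kq: "K * q \<le> \<kappa>0 / 2" and \<rho>c: "\<rho> \<le> c / 2"
    using sc by (auto simp: K_def \<rho>_def m_def)
  have K: "K \<ge> 80" using L by (simp add: K_def incr_const_def)
  have m: "p \<le> m" "q \<le> m" "m > 0" "m\<^sup>2 = p\<^sup>2 + q\<^sup>2"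
    using p q by (auto simp: m_def real_le_rsqrt add_pos_pos)
  have C2: "C2 \<ge> 1" "\<kappa>0 * (C2 - 1) = 4 * (K + 22)" using \<kappa> K by (auto simp: C2_def dev_const_def K_def[symmetric])
  have ec: "est_const \<kappa>0 > 0" "\<kappa>0 * est_const \<kappa>0 = 70 + 2 * \<kappa>0"
    using \<kappa> by (auto simp: est_const_def algebra_simps add_pos_pos)
  have r: "0 < r" using ec q by (simp add: r_def)
  have qq: "q\<^sup>2 \<le> q" using q by (simp add: power2_eq_square)
  have \<delta>: "\<delta> = C2 * (q\<^sup>2 + p)" "0 < \<delta>" using C2 p by (auto simp: \<delta>_def dev_radius_def C2_def intro!: mult_pos_pos add_nonneg_pos)
  have \<delta>m: "\<delta> \<le> 2 * C2 * m"
  proof -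
    have "q\<^sup>2 + p \<le> 2 * m" using qq m by linarith
    hence "C2 * (q\<^sup>2 + p) \<le> C2 * (2 * m)" using C2 by (intro mult_left_mono) auto
    thus ?thesis by (simp add: \<delta>)
  qed
  have h: "0 < h" "h \<le> q\<^sup>2"
  proof -
    have "c / real n \<le> 1 / real n" using c n by (intro divide_right_mono) auto
    also have "1 / real n \<le> q\<^sup>2" using nq n by (simp add: field_simps)
    finally show "h \<le> q\<^sup>2" by (simp add: h_def)
    show "0 < h" using c n by (simp add: h_def)
  qed
  have sum_le: "r + \<delta> + 2 * h \<le> \<rho>"
  proof -
    have "r \<le> est_const \<kappa>0 * m" using ec m by (simp add: r_def)
    moreover have "2 * h \<le> 2 * m" using h qq m by linarith
    ultimately have "r + \<delta> + 2 * h \<le> est_const \<kappa>0 * m + 2 * C2 * m + 2 * m" using \<delta>m by linarith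
    thus ?thesis by (simp add: \<rho>_def radius_const_def C2_def algebra_simps)
  qed
  have N: "N > 0" "(real n)\<^sup>2 \<le> 2 * N" using n by (auto simp: N_def power2_eq_square algebra_simps)
  note d = data[unfolded regular_data_def]
  have rd: "\<bar>Hn t - Hn s - (U t - U s)\<bar> \<le> K * ((t - s) * q + q\<^sup>2)"
    if "\<theta> - c \<le> s" "s \<le> t" "t \<le> \<theta> + c" for s t
    unfolding Hn_def K_def by (rule conjunct1[OF d, rule_format, OF that])
  have rc: "\<bar>Hn \<theta> - 1 / 2\<bar> \<le> 34 * q"
    unfolding Hn_def by (rule conjunct1[OF conjunct2[OF d]])
  note w = weights[unfolded regular_weights_def]
  have v: "v i \<ge> 0" if "i \<in> {1..n}" for i
    using conjunct1[OF w, rule_format, OF that] by auto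
  have Wc: "\<bar>W - N\<bar> \<le> 11 * (real n)\<^sup>2 * p"
    unfolding W_def N_def by (rule conjunct1[OF conjunct2[OF w]])
  have S\<theta>: "\<bar>S \<theta>\<bar> \<le> 11 * (real n)\<^sup>2 * p"
    unfolding S_def by (rule conjunct1[OF conjunct2[OF conjunct2[OF w]]])
  have Sm: "\<bar>S (b - \<delta>)\<bar> \<le> 11 * (real n)\<^sup>2 * p"
    unfolding S_def b_def \<delta>_def by (rule conjunct1[OF conjunct2[OF conjunct2[OF conjunct2[OF w]]]])
  have Sp: "\<bar>S (b + \<delta>)\<bar> \<le> 11 * (real n)\<^sup>2 * p"
    unfolding S_def b_def \<delta>_def by (rule conjunct1[OF conjunct2[OF conjunct2[OF conjunct2[OF conjunct2[OF w]]]]])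
  note w' = conjunct2[OF conjunct2[OF conjunct2[OF conjunct2[OF conjunct2[OF w]]]], rule_format]
  have Sg: "\<bar>S (window_grid n \<theta> c k) - S \<theta>\<bar> \<le> score_const \<kappa>0 L * (real n)\<^sup>2 * m\<^sup>2"
    if "k \<le> 2 * n" "\<bar>window_grid n \<theta> c k - \<theta>\<bar> \<le> \<rho>" for k
    unfolding S_def m(4) using that unfolding \<rho>_def m_def by (intro w') simp_all
  have W: "W \<ge> N / 2"
  proof -
    have "11 * (real n)\<^sup>2 * p \<le> 11 * (2 * N) * (1 / 44)" using N p by (intro mult_mono) auto
    thus ?thesis using Wc by linarith
  qed
  hence Wpos: "W > 0" using N by linarith
  show sel: "card (selected n v) \<ge> 2" using Wpos by (intro weight_total_pos_imp_selected) (simp add: W_def)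
  \<comment> \<open>The Hodges-Lehmann estimator: at \<open>\<theta> \<plusminus> r\<close> the slope of \<open>U\<close> outweighs the
    error at the centre and the error of the increment.\<close>
  have Un_mono: "mono Hn" unfolding Hn_def by (intro monoI U_stat_mono)
  have est: "q * (\<kappa>0 * est_const \<kappa>0) - K * (r * q + q\<^sup>2) - 34 * q > 0"
  proof -
    have "K * (r * q + q\<^sup>2) = (K * q) * (est_const \<kappa>0 + 1) * q" by (simp add: r_def power2_eq_square algebra_simps)
    also have "\<dots> \<le> (\<kappa>0 / 2) * (est_const \<kappa>0 + 1) * q" using Kq ec q by (intro mult_right_mono) auto
    also have "\<dots> = (35 + \<kappa>0 + \<kappa>0 / 2) * q" using ec(2) by (simp add: algebra_simps)
    finally have "q * (\<kappa>0 * est_const \<kappa>0) - K * (r * q + q\<^sup>2) - 34 * q \<ge> (1 + \<kappa>0 / 2) * q"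
      unfolding ec(2) by (simp add: algebra_simps)
    moreover have "(1 + \<kappa>0 / 2) * q > 0" using \<kappa> q by simp
    ultimately show ?thesis by linarith
  qed
  have rr: "\<kappa>0 * r = q * (\<kappa>0 * est_const \<kappa>0)" by (simp add: r_def)
  have Un_hi: "Hn (\<theta> + r) > 1 / 2"
    using rd[of \<theta> "\<theta> + r"] slope[of \<theta> "\<theta> + r"] rc est r sum_le \<rho>c c h \<delta> rr by simp
  have Un_lo: "Hn (\<theta> - r) < 1 / 2"
    using rd[of "\<theta> - r" \<theta>] slope[of "\<theta> - r" \<theta>] rc est r sum_le \<rho>c c h \<delta> rr by simp
  have b: "\<bar>b - \<theta>\<bar> \<le> r"
    using cdf_median_ge[OF Un_mono Un_lo less_imp_le[OF Un_hi]] cdf_median_le[OF Un_mono Un_lo less_imp_le[OF Un_hi]]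
    by (simp add: b_def hodges_lehmann_def Hn_def[symmetric] abs_le_iff)
  have above_b: "Hn t \<ge> 1 / 2" if "b < t" for t
    using above_cdf_median[OF Un_mono Un_lo less_imp_le[OF Un_hi]] that by (simp add: b_def hodges_lehmann_def Hn_def)
  have below_b: "Hn t < 1 / 2" if "t < b" for t
    using below_cdf_median[OF Un_mono Un_lo] that by (simp add: b_def hodges_lehmann_def Hn_def)
  \<comment> \<open>The bootstrap estimator: at \<open>b \<plusminus> \<delta>\<close> the slope of \<open>U\<close> outweighs the score.\<close>
  define Ub where "Ub = U_boot n v x"
  have Ub_mono: "mono Ub" unfolding Ub_def using v Wpos by (intro monoI U_boot_mono) (auto simp: W_def)
  have Ub: "W * (Ub t - 1 / 2) = N * (Hn t - 1 / 2) + S t" for t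
    using U_boot_score[OF n, of v x t] Wpos by (simp add: Ub_def W_def N_def Hn_def S_def)
  have sgn1: "Ub t > 1 / 2 \<longleftrightarrow> N * (Hn t - 1 / 2) + S t > 0" for t
    unfolding Ub[symmetric] using Wpos by (simp add: zero_less_mult_iff)
  have sgn2: "Ub t < 1 / 2 \<longleftrightarrow> N * (Hn t - 1 / 2) + S t < 0" for t
    unfolding Ub[symmetric] using Wpos by (simp add: mult_less_0_iff)
  have sgn3: "Ub t \<ge> 1 / 2 \<longleftrightarrow> N * (Hn t - 1 / 2) + S t \<ge> 0" for t
    unfolding Ub[symmetric] using Wpos by (simp add: zero_le_mult_iff)
  \<comment> \<open>The drift is measured from \<open>b \<plusminus> \<delta> / 2\<close>, where the sign of \<open>U_stat - 1 / 2\<close>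
    is known.\<close>
  have gain: "\<kappa>0 * (\<delta> / 2) - K * (\<delta> / 2 * q + q\<^sup>2) > 22 * p"
  proof -
    have "K * q * \<delta> \<le> \<kappa>0 / 2 * \<delta>" using Kq \<delta> by (intro mult_right_mono) auto
    moreover have "\<kappa>0 * \<delta> = \<kappa>0 * (C2 - 1) * (q\<^sup>2 + p) + \<kappa>0 * (q\<^sup>2 + p)" by (simp add: \<delta> algebra_simps)
    hence "\<kappa>0 * \<delta> = 4 * (K + 22) * (q\<^sup>2 + p) + \<kappa>0 * (q\<^sup>2 + p)" by (simp only: C2(2))
    moreover have "4 * (K + 22) * (q\<^sup>2 + p) = 4 * (K * q\<^sup>2) + 88 * q\<^sup>2 + 4 * (K * p) + 88 * p" by (simp add: algebra_simps)
    moreover have "K * (\<delta> / 2 * q + q\<^sup>2) = (K * q * \<delta>) / 2 + K * q\<^sup>2" by (simp add: algebra_simps)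
    moreover have "\<kappa>0 * (q\<^sup>2 + p) > 0" "0 \<le> K * p" "0 \<le> q\<^sup>2" using \<kappa> p K by (auto intro!: mult_pos_pos add_nonneg_pos)
    ultimately show ?thesis by linarith
  qed
  have Sbound: "11 * (real n)\<^sup>2 * p \<le> N * (22 * p)"
    using mult_right_mono[OF N(2), of "11 * p"] p by (simp add: algebra_simps)
  have rise: "\<kappa>0 * (t - s) - K * ((t - s) * q + q\<^sup>2) \<le> Hn t - Hn s"
    if "\<theta> - c \<le> s" "s \<le> t" "t \<le> \<theta> + c" for s t
    using rd[OF that] slope[OF that] by linarith
  have win: "\<theta> - c \<le> b - \<delta>" "b + \<delta> \<le> \<theta> + c" using b sum_le \<rho>c c(1) h(1) by linarith+
  have hi: "Ub (b + \<delta>) > 1 / 2"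
  proof -
    have "\<kappa>0 * (b + \<delta> - (b + \<delta> / 2)) - K * ((b + \<delta> - (b + \<delta> / 2)) * q + q\<^sup>2) \<le> Hn (b + \<delta>) - Hn (b + \<delta> / 2)"
      using win \<delta>(2) by (intro rise) linarith+
    also have "b + \<delta> - (b + \<delta> / 2) = \<delta> / 2" by simp
    finally have "Hn (b + \<delta>) - 1 / 2 > 22 * p"
      using gain above_b[of "b + \<delta> / 2"] \<delta>(2) by linarith
    hence "N * (Hn (b + \<delta>) - 1 / 2) > N * (22 * p)" using N by (intro mult_strict_left_mono) auto
    thus ?thesis unfolding sgn1 using Sp Sbound by linarith
  qed
  have lo: "Ub (b - \<delta>) < 1 / 2"
  proof -
    have "\<kappa>0 * (b - \<delta> / 2 - (b - \<delta>)) - K * ((b - \<delta> / 2 - (b - \<delta>)) * q + q\<^sup>2) \<le> Hn (b - \<delta> / 2) - Hn (b - \<delta>)"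
      using win \<delta>(2) by (intro rise) linarith+
    also have "b - \<delta> / 2 - (b - \<delta>) = \<delta> / 2" by simp
    finally have "Hn (b - \<delta>) - 1 / 2 < - (22 * p)"
      using gain below_b[of "b - \<delta> / 2"] \<delta>(2) by linarith
    hence "N * (Hn (b - \<delta>) - 1 / 2) < N * (- (22 * p))" using N by (intro mult_strict_left_mono) auto
    thus ?thesis unfolding sgn2 using Sm Sbound by linarith
  qed
  have ab: "\<bar>a - b\<bar> \<le> \<delta>"
    using cdf_median_ge[OF Ub_mono lo less_imp_le[OF hi]] cdf_median_le[OF Ub_mono lo less_imp_le[OF hi]]
    by (simp add: a_def Ub_def[symmetric] abs_le_iff)
  thus "\<bar>cdf_median (U_boot n v x) - hodges_lehmann n x\<bar> \<le> dev_radius \<kappa>0 L q p"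
    by (simp add: a_def b_def \<delta>_def)
  have above_a: "Ub t \<ge> 1 / 2" if "a < t" for t
    using above_cdf_median[OF Ub_mono lo less_imp_le[OF hi]] that by (simp add: a_def Ub_def)
  have below_a: "Ub t < 1 / 2" if "t < a" for t
    using below_cdf_median[OF Ub_mono lo] that by (simp add: a_def Ub_def)
  \<comment> \<open>The linearisation, at grid points enclosing the bootstrap estimator at distances between \<open>h\<close> and \<open>2
    h\<close>.\<close>
  define R where "R = score_const \<kappa>0 L * (real n)\<^sup>2 * m\<^sup>2"
  have a\<theta>: "\<bar>a - \<theta>\<bar> + 2 * h \<le> \<rho>" using ab b sum_le by linarith
  have npos: "0 < n" using n by simp
  have wa: "\<theta> - c \<le> a - h" "a - h \<le> \<theta> + c" "\<theta> - c \<le> a + h" "a + h \<le> \<theta> + c"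
    using a\<theta> \<rho>c c(1) h(1) by linarith+
  obtain k1 where k1: "k1 < 2 * n" "window_grid n \<theta> c k1 \<le> a + h" "a + h \<le> window_grid n \<theta> c (Suc k1)"
    using window_grid_bracket[OF c(1) npos wa(3,4)] by blast
  define t1 where "t1 = window_grid n \<theta> c (Suc k1)"
  have t1: "a + h \<le> t1" "t1 \<le> a + 2 * h" using k1 by (auto simp: t1_def window_grid_Suc h_def)
  obtain k0 where k0: "k0 < 2 * n" "window_grid n \<theta> c k0 \<le> a - h" "a - h \<le> window_grid n \<theta> c (Suc k0)"
    using window_grid_bracket[OF c(1) npos wa(1,2)] by blast
  define t0 where "t0 = window_grid n \<theta> c k0"
  have t0: "a - 2 * h \<le> t0" "t0 \<le> a - h" using k0 by (auto simp: t0_def window_grid_Suc h_def)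
  have sc_pos: "radius_const \<kappa>0 L > 0" using ec C2 by (simp add: radius_const_def C2_def)
  have sc_pos': "score_const \<kappa>0 L > 0" using sc_pos L by (simp add: score_const_def add_pos_pos)
  have \<rho>: "\<rho> \<ge> 0" using sc_pos m by (simp add: \<rho>_def)
  have main: "\<bar>a - b + S \<theta> / (N * u)\<bar> \<le> 3 * q\<^sup>2 + ((\<kappa>1 * \<rho> + K * q) * (\<delta> + 3 * h) + K * q\<^sup>2) / u + R / (N * u)"
  proof (rule median_linearisation[where S = S and \<theta> = \<theta> and Hn = Hn and U = U and c = c and ?t0.0 = t0 and ?t1.0 = t1])
    show t1\<theta>: "\<bar>t1 - \<theta>\<bar> \<le> \<rho>" using t1 a\<theta> h(1) by linarith
    show t0\<theta>: "\<bar>t0 - \<theta>\<bar> \<le> \<rho>" using t0 a\<theta> h(1) by linarith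
    show "\<bar>S t1 - S \<theta>\<bar> \<le> R"
      unfolding R_def t1_def by (rule Sg) (use k1(1) t1\<theta> in \<open>simp_all add: t1_def\<close>)
    show "\<bar>S t0 - S \<theta>\<bar> \<le> R"
      unfolding R_def t0_def by (rule Sg) (use k0(1) t0\<theta> in \<open>simp_all add: t0_def\<close>)
    show "\<bar>b - h - \<theta>\<bar> \<le> \<rho>" "\<bar>b + h - \<theta>\<bar> \<le> \<rho>" using b sum_le \<delta>(2) h(1) by linarith+
    show "\<rho> \<le> c" using \<rho>c c(1) by linarith
    show "0 < u" using u \<kappa>(1) by linarith
    show "0 \<le> K" using K by linarith
    show "0 \<le> N * (Hn t1 - 1 / 2) + S t1" using above_a[of t1] t1(1) h(1) unfolding sgn3 by linarith
    show "N * (Hn t0 - 1 / 2) + S t0 \<le> 0" using below_a[of t0] t0(2) h(1) unfolding sgn2 by linarith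
    show "Hn (b - h) \<le> 1 / 2" "1 / 2 \<le> Hn (b + h)" using below_b[of "b - h"] above_b[of "b + h"] h(1) by linarith+
    show "\<bar>U t - U s - u * (t - s)\<bar> \<le> \<kappa>1 * \<rho> * \<bar>t - s\<bar>" if "\<bar>s - \<theta>\<bar> \<le> \<rho>" "\<bar>t - \<theta>\<bar> \<le> \<rho>" for s t
      using that \<rho>c c(1) by (intro lin) linarith+
    show "0 \<le> R" using sc_pos' by (simp add: R_def)
  qed (fact N(1) less_imp_le[OF \<kappa>(2)] \<rho> h less_imp_le[OF q(1)] t1 t0 ab rd)+
  have bound1: "3 * q\<^sup>2 + ((\<kappa>1 * \<rho> + K * q) * (\<delta> + 3 * h) + K * q\<^sup>2) / u + R / (N * u)
    \<le> (3 + ((\<kappa>1 * radius_const \<kappa>0 L + K) * (2 * C2 + 3) + K + 2 * score_const \<kappa>0 L) / \<kappa>0) * m\<^sup>2"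
  proof -
    have q2: "q\<^sup>2 \<le> m\<^sup>2" using m by simp
    have "(\<kappa>1 * \<rho> + K * q) * (\<delta> + 3 * h) \<le> ((\<kappa>1 * radius_const \<kappa>0 L + K) * m) * ((2 * C2 + 3) * m)"
    proof (rule mult_mono)
      have "K * q \<le> K * m" using K m by simp
      thus "\<kappa>1 * \<rho> + K * q \<le> (\<kappa>1 * radius_const \<kappa>0 L + K) * m" by (simp add: \<rho>_def algebra_simps)
      have "3 * h \<le> 3 * m" using h qq m by linarith
      thus "\<delta> + 3 * h \<le> (2 * C2 + 3) * m" using \<delta>m by (simp add: algebra_simps)
    qed (use K \<kappa> sc_pos m \<delta> h in auto)
    also have "\<dots> = ((\<kappa>1 * radius_const \<kappa>0 L + K) * (2 * C2 + 3)) * m\<^sup>2" by (simp add: power2_eq_square algebra_simps)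
    finally have "(\<kappa>1 * \<rho> + K * q) * (\<delta> + 3 * h) + K * q\<^sup>2
        \<le> ((\<kappa>1 * radius_const \<kappa>0 L + K) * (2 * C2 + 3)) * m\<^sup>2 + K * m\<^sup>2"
      using q2 K by (intro add_mono mult_left_mono) auto
    hence "((\<kappa>1 * \<rho> + K * q) * (\<delta> + 3 * h) + K * q\<^sup>2) / u
        \<le> (((\<kappa>1 * radius_const \<kappa>0 L + K) * (2 * C2 + 3)) * m\<^sup>2 + K * m\<^sup>2) / \<kappa>0"
      using u \<kappa> K C2 sc_pos by (intro frac_le add_nonneg_nonneg mult_nonneg_nonneg) auto
    moreover have "R / (N * u) \<le> (2 * score_const \<kappa>0 L * m\<^sup>2) / \<kappa>0"
    proof -
      have "R \<le> score_const \<kappa>0 L * (2 * N) * m\<^sup>2"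
        unfolding R_def using N sc_pos' by (intro mult_right_mono mult_left_mono) auto
      hence "R / (N * u) \<le> (score_const \<kappa>0 L * (2 * N) * m\<^sup>2) / (N * \<kappa>0)"
        using N u \<kappa> sc_pos' by (intro frac_le mult_left_mono) auto
      also have "\<dots> = (2 * score_const \<kappa>0 L * m\<^sup>2) / \<kappa>0" using N by simp
      finally show ?thesis .
    qed
    ultimately have "3 * q\<^sup>2 + ((\<kappa>1 * \<rho> + K * q) * (\<delta> + 3 * h) + K * q\<^sup>2) / u + R / (N * u)
       \<le> 3 * m\<^sup>2 + (((\<kappa>1 * radius_const \<kappa>0 L + K) * (2 * C2 + 3)) * m\<^sup>2 + K * m\<^sup>2) / \<kappa>0 + (2 * score_const \<kappa>0 L * m\<^sup>2) / \<kappa>0"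
      using q2 by linarith
    also have "\<dots> = (3 + ((\<kappa>1 * radius_const \<kappa>0 L + K) * (2 * C2 + 3) + K + 2 * score_const \<kappa>0 L) / \<kappa>0) * m\<^sup>2"
      using \<kappa> by (simp add: field_simps)
    finally show ?thesis .
  qed
  \<comment> \<open>The linear statistic \<open>T / W\<close> against \<open>- S \<theta> / (N u)\<close>: centring at \<open>U_stat
    \<theta>\<close> costs \<open>(W - N) (U_stat \<theta> - 1 / 2)\<close>, and both this and the change of normalisation
    are products of two small deviations.\<close>
  define T where "T = (\<Sum>(i, j)\<in>offdiag n. (v i * v j - 1) * ((U_stat n x \<theta> - of_bool ((x i + x j) / 2 \<le> \<theta>)) / u))"
  have T: "u * T = - S \<theta> + (W - N) * (Hn \<theta> - 1 / 2)"
  proof -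
    have "u * T = (\<Sum>(i, j)\<in>offdiag n. - ((v i * v j - 1) * (of_bool ((x i + x j) / 2 \<le> \<theta>) - 1 / 2))
        + (v i * v j - 1) * (Hn \<theta> - 1 / 2))"
      unfolding T_def sum_distrib_left case_prod_unfold Hn_def using u \<kappa>
      by (intro sum.cong refl) (auto simp: field_simps)
    also have "\<dots> = - S \<theta> + (\<Sum>(i, j)\<in>offdiag n. v i * v j - 1) * (Hn \<theta> - 1 / 2)"
      unfolding case_prod_unfold sum.distrib sum_negf sum_distrib_right S_def boot_score_def ..
    also have "(\<Sum>(i, j)\<in>offdiag n. v i * v j - 1) = W - N"
    proof -
      have "(\<Sum>(i, j)\<in>offdiag n. v i * v j - 1) = W - (\<Sum>(i, j)\<in>offdiag n. 1)"
        unfolding W_def weight_total_def by (simp only: case_prod_unfold sum_subtractf)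
      thus ?thesis unfolding N_def by (simp only: sum_offdiag_const mult_1_right)
    qed
    finally show ?thesis .
  qed
  have diff: "\<bar>T / W + S \<theta> / (N * u)\<bar> \<le> 2464 / \<kappa>0 * m\<^sup>2"
  proof -
    define \<eta> where "\<eta> = 11 * (real n)\<^sup>2 * p"
    have \<eta>: "0 \<le> \<eta>" "\<eta> \<le> 22 * N * p" using Sbound p by (auto simp: \<eta>_def)
    have WN: "\<bar>W - N\<bar> \<le> 22 * N * p" using Wc \<eta>(2) unfolding \<eta>_def by linarith
    have SN: "\<bar>S \<theta>\<bar> \<le> 22 * N * p" using S\<theta> \<eta>(2) unfolding \<eta>_def by linarith
    have Np: "0 \<le> 22 * N * p" using N(1) p(1) by simp
    have upos: "u > 0" using u \<kappa> by simp
    define Y where "Y = (W - N) * (Hn \<theta> - 1 / 2)"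
    have "T / W = (u * T) / (W * u)" using upos by simp
    hence "T / W = (- S \<theta> + Y) / (W * u)" unfolding T Y_def .
    moreover have "S \<theta> / (N * u) = (S \<theta> * W / N) / (W * u)" using N(1) Wpos upos by (simp add: field_simps)
    ultimately have "T / W + S \<theta> / (N * u) = ((- S \<theta> + Y) + S \<theta> * W / N) / (W * u)"
      by (simp only: add_divide_distrib)
    also have "(- S \<theta> + Y) + S \<theta> * W / N = (W - N) * S \<theta> / N + Y" using N(1) by (simp add: field_simps)
    finally have "T / W + S \<theta> / (N * u) = ((W - N) * S \<theta> / N + (W - N) * (Hn \<theta> - 1 / 2)) / (W * u)"
      unfolding Y_def .
    hence "\<bar>T / W + S \<theta> / (N * u)\<bar> = \<bar>((W - N) * S \<theta> / N + (W - N) * (Hn \<theta> - 1 / 2)) / (W * u)\<bar>"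
      by simp
    also have "\<bar>\<dots>\<bar> = \<bar>(W - N) * S \<theta> / N + (W - N) * (Hn \<theta> - 1 / 2)\<bar> / (W * u)"
      using Wpos upos by (simp add: abs_divide)
    also have "\<dots> \<le> (968 * N * p\<^sup>2 / 2 + 748 * N * (p * q)) / (W * u)"
    proof (intro divide_right_mono)
      have "\<bar>(W - N) * S \<theta> / N\<bar> = \<bar>W - N\<bar> * \<bar>S \<theta>\<bar> / N" using N by (simp add: abs_mult)
      also have "\<dots> \<le> (22 * N * p) * (22 * N * p) / N"
        using WN SN Np N(1) by (intro divide_right_mono mult_mono) simp_all
      also have "\<dots> = 968 * N * p\<^sup>2 / 2" using N by (simp add: power2_eq_square)
      finally have 1: "\<bar>(W - N) * S \<theta> / N\<bar> \<le> 968 * N * p\<^sup>2 / 2" .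
      have "\<bar>(W - N) * (Hn \<theta> - 1 / 2)\<bar> = \<bar>W - N\<bar> * \<bar>Hn \<theta> - 1 / 2\<bar>" by (rule abs_mult)
      also have "\<dots> \<le> (22 * N * p) * (34 * q)"
        using WN rc Np q(1) by (intro mult_mono) simp_all
      finally have 2: "\<bar>(W - N) * (Hn \<theta> - 1 / 2)\<bar> \<le> 748 * N * (p * q)" by (simp add: algebra_simps)
      show "\<bar>(W - N) * S \<theta> / N + (W - N) * (Hn \<theta> - 1 / 2)\<bar> \<le> 968 * N * p\<^sup>2 / 2 + 748 * N * (p * q)"
        using 1 2 by linarith
    qed (use Wpos upos in auto)
    also have "\<dots> \<le> (1232 * N * m\<^sup>2) / (N / 2 * \<kappa>0)"
    proof (rule frac_le)
      have "p\<^sup>2 \<le> m\<^sup>2" using m by simp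
      hence "N * p\<^sup>2 \<le> N * m\<^sup>2" using N by simp
      moreover have "p * q \<le> m * m" using m p q by (intro mult_mono) auto
      hence "N * (p * q) \<le> N * m\<^sup>2" using N by (simp add: power2_eq_square)
      ultimately show "968 * N * p\<^sup>2 / 2 + 748 * N * (p * q) \<le> 1232 * N * m\<^sup>2" by simp
      show "N / 2 * \<kappa>0 \<le> W * u" using W N u \<kappa> by (intro mult_mono) auto
    qed (use N \<kappa> in auto)
    also have "\<dots> = 2464 / \<kappa>0 * m\<^sup>2" using N by (simp add: field_simps)
    finally show ?thesis by (simp only: abs_abs)
  qed
  have "\<bar>a - b - T / W\<bar> \<le> lin_const \<kappa>0 \<kappa>1 L * m\<^sup>2"
  proof -
    have "\<bar>a - b - T / W\<bar> \<le> \<bar>a - b + S \<theta> / (N * u)\<bar> + \<bar>T / W + S \<theta> / (N * u)\<bar>" by linarith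
    also have "\<dots> \<le> (3 + ((\<kappa>1 * radius_const \<kappa>0 L + K) * (2 * C2 + 3) + K + 2 * score_const \<kappa>0 L) / \<kappa>0) * m\<^sup>2
        + 2464 / \<kappa>0 * m\<^sup>2"
      using main bound1 diff by linarith
    also have "\<dots> = lin_const \<kappa>0 \<kappa>1 L * m\<^sup>2"
      unfolding lin_const_def K_def[symmetric] C2_def[symmetric] by (simp add: add_divide_distrib algebra_simps)
    finally show ?thesis .
  qed
  thus "\<bar>cdf_median (U_boot n v x) - hodges_lehmann n x
           - 1 / weight_total n v * (\<Sum>(i, j)\<in>offdiag n. (v i * v j - 1) *
                ((U_stat n x \<theta> - of_bool ((x i + x j) / 2 \<le> \<theta>)) / u))\<bar> \<le> lin_const \<kappa>0 \<kappa>1 L * (p\<^sup>2 + q\<^sup>2)"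
    unfolding m(4) a_def b_def W_def T_def by (simp only: times_divide_eq_left mult_1)
qed

section \<open>Conditional probabilities given the data\<close>

text \<open>Applied to the part of \<open>B\<close> where the conditional probability exceeds \<open>c\<close>, the hypothesis
shows that this part is a null set.\<close>

lemma (in prob_space) real_cond_exp_indicator_le_on:
  assumes sub: "subalgebra M F" and A [measurable]: "A \<in> events" and B: "B \<in> sets F"
    and le: "\<And>D. D \<in> sets F \<Longrightarrow> D \<subseteq> B \<Longrightarrow> prob (A \<inter> D) \<le> c * prob D"
  shows "AE s in M. s \<in> B \<longrightarrow> real_cond_exp M F (indicator A) s \<le> c"
proof -
  interpret sigma_finite_subalgebra M F
    using sub finite_measure_axioms by (intro finite_measure_subalgebra_is_sigma_finite) (simp add: finite_measure_subalgebra_def finite_measure_subalgebra_axioms_def)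
  let ?r = "real_cond_exp M F (indicator A)"
  have spF: "space F = space M" using sub by (simp add: subalgebra_def)
  have rm [measurable]: "?r \<in> borel_measurable F" by simp
  define D where "D = B \<inter> {s \<in> space F. c < ?r s}"
  have "{s \<in> space F. c < ?r s} \<in> sets F" using rm by measurable
  hence DF: "D \<in> sets F" unfolding D_def using B by (intro sets.Int)
  have DM [measurable]: "D \<in> events" using DF sub by (auto simp: subalgebra_def)
  have intA: "integrable M (indicator A :: 'a \<Rightarrow> real)"
    by (intro integrable_real_indicator) (auto simp: emeasure_eq_measure)
  have intr: "integrable M ?r" by (rule real_cond_exp_int(1)[OF intA])
  have int1: "integrable M (\<lambda>s. indicator D s * ?r s)"
    using integrable_mult_indicator[OF DM intr] by simp
  have int2: "integrable M (\<lambda>s. indicator D s * c)"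
    using integrable_mult_indicator[OF DM, of "\<lambda>_. c"] by simp
  have "(\<integral>s. indicator D s * ?r s \<partial>M) = (\<integral>s. indicator D s * indicator A s \<partial>M)"
    using real_cond_exp_intA[OF intA DF] by (simp add: set_lebesgue_integral_def)
  also have "\<dots> = (\<integral>s. indicator (A \<inter> D) s \<partial>M)"
    by (intro Bochner_Integration.integral_cong) (auto simp: indicator_def)
  also have "\<dots> = prob (A \<inter> D)"
    using sets.Int[OF A DM, THEN sets.sets_into_space] by (simp add: Int_absorb2)
  also have "\<dots> \<le> c * prob D" by (rule le[OF DF]) (auto simp: D_def)
  also have "\<dots> = (\<integral>s. indicator D s * c \<partial>M)"
    using sets.sets_into_space[OF DM] by (simp add: Int_absorb2 mult.commute)
  finally have "(\<integral>s. indicator D s * ?r s - indicator D s * c \<partial>M) \<le> 0"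
    using int1 int2 by simp
  moreover have nonneg: "0 \<le> indicator D s * ?r s - indicator D s * c" for s
    by (auto simp: D_def indicator_def)
  moreover have "0 \<le> (\<integral>s. indicator D s * ?r s - indicator D s * c \<partial>M)"
    by (rule integral_nonneg_AE) (intro AE_I2 nonneg)
  ultimately have "(\<integral>s. indicator D s * ?r s - indicator D s * c \<partial>M) = 0" by linarith
  hence "AE s in M. indicator D s * ?r s - indicator D s * c = 0"
    using integral_nonneg_eq_0_iff_AE[OF Bochner_Integration.integrable_diff[OF int1 int2]] nonneg by simp
  thus ?thesis
  proof (rule AE_mp, intro AE_I2 impI)
    fix s assume s: "s \<in> space M" "indicator D s * ?r s - indicator D s * c = 0" "s \<in> B"
    show "?r s \<le> c"
    proof (rule ccontr)
      assume "\<not> ?r s \<le> c"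
      hence "s \<in> D" using s spF by (simp add: D_def)
      thus False using s(2) \<open>\<not> ?r s \<le> c\<close> by simp
    qed
  qed
qed

text \<open>By independence the joint law is a product, and the inner integral over a section with \<open>y \<in> D\<close> is at
most \<open>c\<close>.\<close>

lemma (in prob_space) indep_section_bound:
  assumes ind: "indep_var P Y Q Z" and N: "N \<in> sets (P \<Otimes>\<^sub>M Q)" and D: "D \<in> sets P" and c: "c \<ge> 0"
    and section_le: "\<And>y. y \<in> D \<Longrightarrow> prob {s \<in> space M. (y, Z s) \<in> N} \<le> c"
  shows "prob {s \<in> space M. Y s \<in> D \<and> (Y s, Z s) \<in> N} \<le> c * prob {s \<in> space M. Y s \<in> D}"
proof -
  have Y [measurable]: "Y \<in> measurable M P" and Z [measurable]: "Z \<in> measurable M Q"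
    and pair: "distr M P Y \<Otimes>\<^sub>M distr M Q Z = distr M (P \<Otimes>\<^sub>M Q) (\<lambda>s. (Y s, Z s))"
    using ind unfolding indep_var_distribution_eq by auto
  interpret DZ: prob_space "distr M Q Z" by (rule prob_space_distr[OF Z])
  define N' where "N' = N \<inter> (D \<times> space Q)"
  have N': "N' \<in> sets (P \<Otimes>\<^sub>M Q)" unfolding N'_def using N D by auto
  have YZ: "(\<lambda>s. (Y s, Z s)) \<in> measurable M (P \<Otimes>\<^sub>M Q)" by measurable
  have "{s \<in> space M. Y s \<in> D \<and> (Y s, Z s) \<in> N} = (\<lambda>s. (Y s, Z s)) -` N' \<inter> space M"
    using measurable_space[OF Z] by (auto simp: N'_def)
  hence "ennreal (prob {s \<in> space M. Y s \<in> D \<and> (Y s, Z s) \<in> N}) = emeasure (distr M P Y \<Otimes>\<^sub>M distr M Q Z) N'"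
    unfolding pair by (simp only: emeasure_distr[OF YZ N'] emeasure_eq_measure)
  also have "\<dots> = (\<integral>\<^sup>+y. emeasure (distr M Q Z) (Pair y -` N') \<partial>distr M P Y)"
    using N' by (intro DZ.emeasure_pair_measure_alt) (simp cong: sets_pair_measure_cong)
  also have "\<dots> \<le> (\<integral>\<^sup>+y. ennreal c * indicator D y \<partial>distr M P Y)"
  proof (rule nn_integral_mono)
    fix y
    show "emeasure (distr M Q Z) (Pair y -` N') \<le> ennreal c * indicator D y"
    proof (cases "y \<in> D")
      case False
      hence "Pair y -` N' = {}" by (auto simp: N'_def)
      thus ?thesis by simp
    next
      case True
      have sec: "Pair y -` N' \<in> sets Q" using sets_Pair1[OF N'] .
      have "Z -` (Pair y -` N') \<inter> space M = {s \<in> space M. (y, Z s) \<in> N}"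
        using True measurable_space[OF Z] by (auto simp: N'_def)
      hence "emeasure (distr M Q Z) (Pair y -` N') = ennreal (prob {s \<in> space M. (y, Z s) \<in> N})"
        by (simp only: emeasure_distr[OF Z sec] emeasure_eq_measure)
      also have "\<dots> \<le> ennreal c" using section_le[OF True] by (rule ennreal_leI)
      finally show ?thesis using True by simp
    qed
  qed
  also have "\<dots> = ennreal c * emeasure (distr M P Y) D" using D by (intro nn_integral_cmult_indicator) simp
  also have "emeasure (distr M P Y) D = ennreal (prob {s \<in> space M. Y s \<in> D})"
  proof -
    have "Y -` D \<inter> space M = {s \<in> space M. Y s \<in> D}" by auto
    thus ?thesis by (simp only: emeasure_distr[OF Y D] emeasure_eq_measure)
  qed
  also have "ennreal c * \<dots> = ennreal (c * prob {s \<in> space M. Y s \<in> D})"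
    using c by (intro ennreal_mult[symmetric]) auto
  finally show ?thesis using c by (simp add: ennreal_le_iff)
qed

text \<open>Where \<open>Y \<in> B\<close>, the event \<open>A\<close> is covered by an event in terms of \<open>Y\<close> and
\<open>Z\<close> with small sections. A covering is used because the bootstrap estimator, having arbitrary values when fewer than
two observations are selected, is not a function of data and weights.\<close>

lemma (in prob_space) cond_prob_le_of_indep_section:
  assumes ind: "indep_var P Y Q Z" and N: "N \<in> sets (P \<Otimes>\<^sub>M Q)" and B: "B \<in> sets P" and c: "c \<ge> 0"
    and section_le: "\<And>y. y \<in> B \<Longrightarrow> prob {s \<in> space M. (y, Z s) \<in> N} \<le> c"
    and A: "A \<in> events" and cover: "\<And>s. s \<in> A \<Longrightarrow> Y s \<in> B \<Longrightarrow> (Y s, Z s) \<in> N"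
  shows "AE s in M. Y s \<in> B \<longrightarrow> real_cond_exp M (vimage_algebra (space M) Y P) (indicator A) s \<le> c"
proof -
  let ?F = "vimage_algebra (space M) Y P"
  have Y: "Y \<in> measurable M P" and Z: "Z \<in> measurable M Q"
    using ind unfolding indep_var_distribution_eq by auto
  have fn: "Y \<in> space M \<rightarrow> space P" using measurable_space[OF Y] by auto
  have sub: "subalgebra M ?F"
    unfolding subalgebra_def sets_vimage_algebra2[OF fn] using measurable_sets[OF Y] by auto
  have BF: "Y -` B \<inter> space M \<in> sets ?F" unfolding sets_vimage_algebra2[OF fn] using B by auto
  have "AE s in M. s \<in> Y -` B \<inter> space M \<longrightarrow> real_cond_exp M ?F (indicator A) s \<le> c"
  proof (rule real_cond_exp_indicator_le_on[OF sub A BF])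
    fix D assume D: "D \<in> sets ?F" "D \<subseteq> Y -` B \<inter> space M"
    then obtain D0 where D0: "D0 \<in> sets P" "D = Y -` D0 \<inter> space M"
      unfolding sets_vimage_algebra2[OF fn] by blast
    define D' where "D' = D0 \<inter> B"
    have D': "D' \<in> sets P" "D = {s \<in> space M. Y s \<in> D'}" using D0 B D(2) by (auto simp: D'_def)
    have YZ: "(\<lambda>s. (Y s, Z s)) \<in> measurable M (P \<Otimes>\<^sub>M Q)" using Y Z by (rule measurable_Pair)
    have ev: "{s \<in> space M. Y s \<in> D' \<and> (Y s, Z s) \<in> N} \<in> events"
    proof -
      have "{s \<in> space M. Y s \<in> D' \<and> (Y s, Z s) \<in> N} = (Y -` D' \<inter> space M) \<inter> ((\<lambda>s. (Y s, Z s)) -` N \<inter> space M)" by auto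
      thus ?thesis using measurable_sets[OF Y D'(1)] measurable_sets[OF YZ N] by (simp only: sets.Int)
    qed
    have "prob (A \<inter> D) \<le> prob {s \<in> space M. Y s \<in> D' \<and> (Y s, Z s) \<in> N}"
      using ev D'(2) cover by (intro finite_measure_mono) (auto simp: D'_def)
    also have "\<dots> \<le> c * prob {s \<in> space M. Y s \<in> D'}"
      using section_le by (intro indep_section_bound[OF ind N D'(1) c]) (auto simp: D'_def)
    finally show "prob (A \<inter> D) \<le> c * prob D" unfolding D'(2) .
  qed
  thus ?thesis by (rule AE_mp) (auto intro!: AE_I2)
qed

section \<open>Measurability of the estimators\<close>

lemma U_stat_eq_0:
  assumes "\<And>i j. (i, j) \<in> offdiag n \<Longrightarrow> t < (x i + x j) / 2"
  shows "U_stat n x t = 0"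
  unfolding U_stat_def using assms by (subst sum.neutral) (auto simp: not_le)

lemma U_stat_eq_1:
  assumes "n \<ge> 2" "\<And>i j. (i, j) \<in> offdiag n \<Longrightarrow> (x i + x j) / 2 \<le> t"
  shows "U_stat n x t = 1"
proof -
  have "(\<Sum>(i, j)\<in>offdiag n. of_bool ((x i + x j) / 2 \<le> t) :: real) = (\<Sum>(i, j)\<in>offdiag n. 1)"
    using assms(2) by (intro sum.cong refl) auto
  thus ?thesis unfolding U_stat_def sum_offdiag_const using assms(1) by simp
qed

text \<open>By monotonicity the infimum defining the median can be tested along the rationals, which makes the estimator
measurable.\<close>

lemma hodges_lehmann_less_iff:
  assumes n: "n \<ge> 2"
  shows "hodges_lehmann n x < t \<longleftrightarrow> (\<exists>r\<in>\<rat>. r < t \<and> U_stat n x r \<ge> 1 / 2)"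
proof -
  define P where "P = (\<lambda>p. (x (fst p) + x (snd p)) / 2) ` offdiag n"
  have fin: "finite P" by (simp add: P_def)
  obtain lo where lo: "\<And>y. y \<in> P \<Longrightarrow> lo \<le> y" using bounded_imp_bdd_below[OF finite_imp_bounded[OF fin]] by (auto simp: bdd_below_def)
  obtain hi where hi: "\<And>y. y \<in> P \<Longrightarrow> y \<le> hi" using bounded_imp_bdd_above[OF finite_imp_bounded[OF fin]] by (auto simp: bdd_above_def)
  have mem: "(x i + x j) / 2 \<in> P" if "(i, j) \<in> offdiag n" for i j
    using that unfolding P_def by force
  have a: "U_stat n x (lo - 1) < 1 / 2"
  proof -
    have "U_stat n x (lo - 1) = 0" by (rule U_stat_eq_0) (use mem lo in fastforce)
    thus ?thesis by simp
  qed
  have b: "U_stat n x hi \<ge> 1 / 2"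
  proof -
    have "U_stat n x hi = 1" by (rule U_stat_eq_1[OF n]) (use mem hi in blast)
    thus ?thesis by simp
  qed
  have mono: "mono (U_stat n x)" by (intro monoI U_stat_mono)
  show ?thesis
  proof
    assume lt: "hodges_lehmann n x < t"
    obtain r where r: "r \<in> \<rat>" "hodges_lehmann n x < r" "r < t" using Rats_dense_in_real[OF lt] by blast
    have "U_stat n x r \<ge> 1 / 2" using above_cdf_median[OF mono a b] r(2) by (simp add: hodges_lehmann_def)
    thus "\<exists>r\<in>\<rat>. r < t \<and> U_stat n x r \<ge> 1 / 2" using r by blast
  next
    assume "\<exists>r\<in>\<rat>. r < t \<and> U_stat n x r \<ge> 1 / 2"
    then obtain r where r: "r < t" "U_stat n x r \<ge> 1 / 2" by blast
    have "hodges_lehmann n x \<le> r" using cdf_median_le[OF mono a r(2)] by (simp add: hodges_lehmann_def)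
    thus "hodges_lehmann n x < t" using r by simp
  qed
qed

lemma measurable_U_stat [measurable]:
  "(\<lambda>x. U_stat n x t) \<in> borel_measurable (PiM {1..n} (\<lambda>_. borel))"
  unfolding U_stat_def
  by (intro borel_measurable_times borel_measurable_const measurable_sum_offdiag) measurable

lemma measurable_hodges_lehmann [measurable]:
  assumes "n \<ge> 2"
  shows "hodges_lehmann n \<in> borel_measurable (PiM {1..n} (\<lambda>_. borel))"
proof (rule borel_measurableI_less)
  fix t
  have "{x \<in> space (PiM {1..n} (\<lambda>_. borel)). hodges_lehmann n x < t}
     = (\<Union>r\<in>{r\<in>\<rat>. r < t}. {x \<in> space (PiM {1..n} (\<lambda>_. borel)). U_stat n x r \<ge> 1 / 2})"
    by (auto simp: hodges_lehmann_less_iff[OF assms])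
  also have "\<dots> \<in> sets (PiM {1..n} (\<lambda>_. borel))"
  proof (intro sets.countable_UN'')
    show "countable {r \<in> \<rat>. r < t}" by (rule countable_subset[OF _ countable_rat]) auto
  qed measurable
  finally show "{x \<in> space (PiM {1..n} (\<lambda>_. borel)). hodges_lehmann n x < t} \<in> sets (PiM {1..n} (\<lambda>_. borel))" .
qed

lemma measurable_boot_score:
  assumes T: "T \<in> borel_measurable (PiM {1..n} (\<lambda>_. borel))"
  shows "(\<lambda>z. boot_score n (snd z) (fst z) (T (fst z)))
    \<in> borel_measurable (PiM {1..n} (\<lambda>_. borel) \<Otimes>\<^sub>M PiM {1..n} (\<lambda>_. borel))"
  unfolding boot_score_def
proof (rule measurable_sum_offdiag)
  note T [measurable]
  fix i j assume [measurable]: "i \<in> {1..n}" "j \<in> {1..n}"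
  show "(\<lambda>z. (snd z i * snd z j - 1) * ((of_bool ((fst z i + fst z j) / 2 \<le> T (fst z)) :: real) - 1 / 2))
    \<in> borel_measurable (PiM {1..n} (\<lambda>_. borel) \<Otimes>\<^sub>M PiM {1..n} (\<lambda>_. borel))"
    by measurable
qed

lemma measurable_weight_total [measurable]:
  "weight_total n \<in> borel_measurable (PiM {1..n} (\<lambda>_. borel))"
  unfolding weight_total_def by (rule measurable_sum_offdiag) measurable

lemma sets_irregular_weights:
  assumes "n \<ge> 2"
  shows "{z \<in> space (PiM {1..n} (\<lambda>_. borel) \<Otimes>\<^sub>M PiM {1..n} (\<lambda>_. borel)).
      \<not> regular_weights n \<kappa>0 L \<theta> c q p (fst z) (snd z)}
    \<in> sets (PiM {1..n} (\<lambda>_. borel) \<Otimes>\<^sub>M PiM {1..n} (\<lambda>_. borel))"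
proof -
  note measurable_hodges_lehmann[OF assms, measurable]
  have [measurable]: "(\<lambda>z. boot_score n (snd z) (fst z) t)
      \<in> borel_measurable (PiM {1..n} (\<lambda>_. borel) \<Otimes>\<^sub>M PiM {1..n} (\<lambda>_. borel))" for t
    by (rule measurable_boot_score) simp
  have [measurable]: "(\<lambda>z. boot_score n (snd z) (fst z) (hodges_lehmann n (fst z) - \<delta>))
      \<in> borel_measurable (PiM {1..n} (\<lambda>_. borel) \<Otimes>\<^sub>M PiM {1..n} (\<lambda>_. borel))" for \<delta>
    by (rule measurable_boot_score) measurable
  have [measurable]: "(\<lambda>z. boot_score n (snd z) (fst z) (hodges_lehmann n (fst z) + \<delta>))
      \<in> borel_measurable (PiM {1..n} (\<lambda>_. borel) \<Otimes>\<^sub>M PiM {1..n} (\<lambda>_. borel))" for \<delta>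
    by (rule measurable_boot_score) measurable
  show ?thesis unfolding regular_weights_def by measurable
qed

section \<open>Regular weights are typical\<close>

lemma (in prob_space) weighted_pair_sum_le:
  fixes \<omega> :: "nat \<Rightarrow> 'a \<Rightarrow> real" and a :: "nat \<Rightarrow> nat \<Rightarrow> real"
  assumes n: "n > 0" and ind: "indep_vars (\<lambda>_. borel) \<omega> {1..n}"
    and w0: "\<And>i. i \<in> {1..n} \<Longrightarrow> prob {s \<in> space M. \<omega> i s = 0} = 1 / 2"
    and w2: "\<And>i. i \<in> {1..n} \<Longrightarrow> prob {s \<in> space M. \<omega> i s = 2} = 1 / 2"
    and bound: "\<And>i j. \<bar>a i j\<bar> \<le> 1" and sym: "\<And>i j. a i j = a j i"
    and rows: "\<And>i. i \<in> {1..n} \<Longrightarrow> \<bar>\<Sum>j\<in>{1..n} - {i}. a i j\<bar> \<le> \<beta>" and pos: "\<beta> > 0" "y \<ge> 0"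
    and m: "m \<ge> 0" "y \<le> real n * m\<^sup>2"
  shows "prob {s \<in> space M. \<bar>\<Sum>(i, j)\<in>offdiag n. (\<omega> i s * \<omega> j s - 1) * a i j\<bar>
            > 3 * \<beta> * real n * m + 8 * (real n)\<^sup>2 * m\<^sup>2} \<le> 30 * exp (- y)"
proof -
  have [measurable]: "\<omega> i \<in> borel_measurable M" if "i \<in> {1..n}" for i
    using ind that by (auto simp: indep_vars_def)
  have [measurable]: "(\<lambda>s. \<Sum>(i, j)\<in>offdiag n. (\<omega> i s * \<omega> j s - 1) * a i j) \<in> borel_measurable M"
    by (rule measurable_sum_offdiag) measurable
  have "sqrt (2 * real n * y) \<le> 3 / 2 * (real n * m)"
  proof (rule real_le_lsqrt)
    have "2 * real n * y \<le> 2 * real n * (real n * m\<^sup>2)" using m(2) by (intro mult_left_mono) auto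
    also have "\<dots> = 2 * (real n * m)\<^sup>2" by (simp add: power2_eq_square)
    also have "\<dots> \<le> (3 / 2)\<^sup>2 * (real n * m)\<^sup>2" by (intro mult_right_mono) (auto simp: power2_eq_square)
    finally show "2 * real n * y \<le> (3 / 2 * (real n * m))\<^sup>2" by (simp only: power_mult_distrib)
  qed (use m pos in auto)
  hence "2 * \<beta> * sqrt (2 * real n * y) \<le> 2 * \<beta> * (3 / 2 * (real n * m))" using pos by (intro mult_left_mono) auto
  moreover have "8 * real n * y \<le> 8 * real n * (real n * m\<^sup>2)" using m(2) by (intro mult_left_mono) auto
  moreover have "8 * real n * (real n * m\<^sup>2) = 8 * (real n)\<^sup>2 * m\<^sup>2" "2 * \<beta> * (3 / 2 * (real n * m)) = 3 * \<beta> * real n * m"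
    by (simp_all add: power2_eq_square)
  ultimately have le: "2 * \<beta> * sqrt (2 * real n * y) + 8 * real n * y \<le> 3 * \<beta> * real n * m + 8 * (real n)\<^sup>2 * m\<^sup>2"
    by linarith
  have "prob {s \<in> space M. \<bar>\<Sum>(i, j)\<in>offdiag n. (\<omega> i s * \<omega> j s - 1) * a i j\<bar>
            > 3 * \<beta> * real n * m + 8 * (real n)\<^sup>2 * m\<^sup>2}
     \<le> prob {s \<in> space M. \<bar>\<Sum>(i, j)\<in>offdiag n. (\<omega> i s * \<omega> j s - 1) * a i j\<bar>
            > 2 * \<beta> * sqrt (2 * real n * y) + 8 * real n * y}"
    using le by (intro finite_measure_mono) auto
  also have "\<dots> \<le> 30 * exp (- y)" by (rule weighted_pair_sum_tail[OF n ind w0 w2 bound sym rows pos])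
  finally show ?thesis .
qed

text \<open>The total weight and the score at three fixed points have row sums at most \<open>n\<close>, and level \<open>z = n
p\<^sup>2\<close> suffices. For the difference of the scores at a grid point and at \<open>\<theta>\<close> the row sums are
counts of pair means in a short interval, small by regularity of the sample; there the level is raised to \<open>z + log n\<close>
to pay for the grid.\<close>

lemma (in prob_space) irregular_weights_probability:
  fixes \<omega> :: "nat \<Rightarrow> 'a \<Rightarrow> real"
  assumes n: "n \<ge> 2" and ind: "indep_vars (\<lambda>_. borel) \<omega> {1..n}"
    and w0: "\<And>i. i \<in> {1..n} \<Longrightarrow> prob {s \<in> space M. \<omega> i s = 0} = 1 / 2"
    and w2: "\<And>i. i \<in> {1..n} \<Longrightarrow> prob {s \<in> space M. \<omega> i s = 2} = 1 / 2"
    and \<kappa>0: "\<kappa>0 > 0" and L: "L \<ge> 1" and scales: "small_scales \<kappa>0 L c q p"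
    and logn: "ln (real n) \<le> real n * q\<^sup>2"
    and data: "regular_data n U \<theta> c L q x"
  shows "prob {s \<in> space M. \<not> regular_weights n \<kappa>0 L \<theta> c q p x (\<lambda>i. \<omega> i s)} \<le> 210 * exp (- (real n * p\<^sup>2))"
proof -
  have q: "0 < q" and p: "0 < p" "p \<le> 1" using scales by (auto simp: small_scales_def)
  have n0: "n > 0" using n by simp
  have [measurable]: "\<omega> i \<in> borel_measurable M" if "i \<in> {1..n}" for i
    using ind that by (auto simp: indep_vars_def)
  have sumM [measurable]: "(\<lambda>s. \<Sum>(i, j)\<in>offdiag n. (\<omega> i s * \<omega> j s - 1) * a i j) \<in> borel_measurable M" for a
    by (rule measurable_sum_offdiag) measurable
  define z where "z = real n * p\<^sup>2"
  define m where "m = sqrt (p\<^sup>2 + q\<^sup>2)"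
  have m: "m > 0" "m\<^sup>2 = p\<^sup>2 + q\<^sup>2" "q \<le> m" using p q by (auto simp: m_def add_pos_pos real_le_rsqrt)
  define \<rho> where "\<rho> = radius_const \<kappa>0 L * m"
  have rad: "radius_const \<kappa>0 L > 0"
    using \<kappa>0 L by (auto simp: radius_const_def est_const_def dev_const_def incr_const_def intro!: add_pos_pos mult_pos_pos add_nonneg_pos)
  define h where "h = (\<lambda>t i j. of_bool ((x i + x j) / 2 \<le> t) :: real)"
  define Q where "Q = (\<lambda>a s. \<Sum>(i, j)\<in>offdiag n. (\<omega> i s * \<omega> j s - 1) * a i j)"
  have Qm [measurable]: "Q a \<in> borel_measurable M" for a unfolding Q_def by (rule sumM)
  have score: "boot_score n (\<lambda>i. \<omega> i s) x t = Q (\<lambda>i j. h t i j - 1 / 2) s" for t s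
    unfolding boot_score_def Q_def h_def ..
  have total: "weight_total n (\<lambda>i. \<omega> i s) - real n * (real n - 1) = Q (\<lambda>_ _. 1) s" for s
    unfolding weight_total_def Q_def mult_1_right case_prod_unfold sum_subtractf
    using sum_offdiag_const[of 1 n] by (simp only: case_prod_unfold mult_1_right)
  have score_diff: "boot_score n (\<lambda>i. \<omega> i s) x t - boot_score n (\<lambda>i. \<omega> i s) x t'
      = Q (\<lambda>i j. h t i j - h t' i j) s" for t t' s
    unfolding boot_score_def Q_def h_def case_prod_unfold sum_subtractf[symmetric]
    by (intro sum.cong refl) (simp add: algebra_simps)
  have hsym: "h t i j = h t j i" for t i j by (simp add: h_def add.commute)
  have coarse: "prob {s \<in> space M. \<bar>Q a s\<bar> > 11 * (real n)\<^sup>2 * p} \<le> 30 * exp (- z)"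
    if a: "\<And>i j. \<bar>a i j\<bar> \<le> 1" "\<And>i j. a i j = a j i" for a
  proof -
    have rows: "\<bar>\<Sum>j\<in>{1..n} - {i}. a i j\<bar> \<le> real n" if "i \<in> {1..n}" for i
    proof -
      have "\<bar>\<Sum>j\<in>{1..n} - {i}. a i j\<bar> \<le> (\<Sum>j\<in>{1..n} - {i}. \<bar>a i j\<bar>)" by (rule sum_abs)
      also have "\<dots> \<le> (\<Sum>j\<in>{1..n} - {i}. 1)" using a(1) by (intro sum_mono) auto
      finally show ?thesis using that by simp
    qed
    have "3 * real n * real n * p + 8 * (real n)\<^sup>2 * p\<^sup>2 \<le> 11 * (real n)\<^sup>2 * p"
    proof -
      have "8 * (real n)\<^sup>2 * p\<^sup>2 \<le> 8 * (real n)\<^sup>2 * p"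
        using p by (intro mult_left_mono) (auto simp: power2_eq_square mult_left_le)
      moreover have "3 * real n * real n * p = 3 * ((real n)\<^sup>2 * p)" by (simp add: power2_eq_square)
      ultimately show ?thesis by linarith
    qed
    hence "prob {s \<in> space M. \<bar>Q a s\<bar> > 11 * (real n)\<^sup>2 * p}
       \<le> prob {s \<in> space M. \<bar>Q a s\<bar> > 3 * real n * real n * p + 8 * (real n)\<^sup>2 * p\<^sup>2}"
      by (intro finite_measure_mono) auto
    also have "\<dots> \<le> 30 * exp (- z)"
      unfolding Q_def using p n0
      by (intro weighted_pair_sum_le[OF n0 ind w0 w2 a rows]) (auto simp: z_def)
    finally show ?thesis .
  qed
  have fine: "prob {s \<in> space M. \<bar>Q (\<lambda>i j. h t i j - h \<theta> i j) s\<bar> > score_const \<kappa>0 L * (real n)\<^sup>2 * (p\<^sup>2 + q\<^sup>2)}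
      \<le> 30 * (exp (- z) / real n)" if t: "\<bar>t - \<theta>\<bar> \<le> \<rho>" for t
  proof -
    define \<beta> where "\<beta> = 2 * L * real n * \<rho> + 4 * real n * q"
    have \<rho>0: "0 \<le> \<rho>" using rad m by (simp add: \<rho>_def)
    have \<beta>: "\<beta> > 0" unfolding \<beta>_def using \<rho>0 L q n0 by (intro add_nonneg_pos) auto
    have cnt: "(\<Sum>j\<in>{1..n} - {i}. h t2 i j - h t1 i j) \<le> 2 * L * real n * (t2 - t1) + 4 * real n * q"
      if "i \<in> {1..n}" "t1 \<le> t2" for i t1 t2
      using conjunct2[OF conjunct2[OF data[unfolded regular_data_def]], rule_format, OF that] by (simp only: h_def)
    have hm: "h t1 i j \<le> h t2 i j" if "t1 \<le> t2" for t1 t2 i j using that by (auto simp: h_def)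
    have rows: "\<bar>\<Sum>j\<in>{1..n} - {i}. h t i j - h \<theta> i j\<bar> \<le> \<beta>" if i: "i \<in> {1..n}" for i
    proof (cases "\<theta> \<le> t")
      case True
      have "0 \<le> (\<Sum>j\<in>{1..n} - {i}. h t i j - h \<theta> i j)" using hm[OF True] by (intro sum_nonneg) auto
      moreover have "2 * L * real n * (t - \<theta>) \<le> 2 * L * real n * \<rho>" using t L by (intro mult_left_mono) auto
      ultimately show ?thesis using cnt[OF i True] by (simp add: \<beta>_def)
    next
      case False
      hence le: "t \<le> \<theta>" by simp
      have "0 \<le> (\<Sum>j\<in>{1..n} - {i}. h \<theta> i j - h t i j)" using hm[OF le] by (intro sum_nonneg) auto
      moreover have "2 * L * real n * (\<theta> - t) \<le> 2 * L * real n * \<rho>" using t L by (intro mult_left_mono) auto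
      moreover have "(\<Sum>j\<in>{1..n} - {i}. h t i j - h \<theta> i j) = - (\<Sum>j\<in>{1..n} - {i}. h \<theta> i j - h t i j)"
        by (simp add: sum_negf[symmetric])
      ultimately show ?thesis using cnt[OF i le] by (simp add: \<beta>_def)
    qed
    have "3 * \<beta> * real n * m + 8 * (real n)\<^sup>2 * m\<^sup>2 \<le> score_const \<kappa>0 L * (real n)\<^sup>2 * (p\<^sup>2 + q\<^sup>2)"
    proof -
      have "\<beta> \<le> (2 * L * radius_const \<kappa>0 L + 4) * (real n * m)"
        unfolding \<beta>_def \<rho>_def using m n0 by (simp add: algebra_simps)
      hence "3 * \<beta> * (real n * m) \<le> 3 * ((2 * L * radius_const \<kappa>0 L + 4) * (real n * m)) * (real n * m)"
        using m by (intro mult_right_mono mult_left_mono) auto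
      thus ?thesis unfolding m(2)[symmetric] by (simp add: score_const_def power2_eq_square algebra_simps)
    qed
    hence "prob {s \<in> space M. \<bar>Q (\<lambda>i j. h t i j - h \<theta> i j) s\<bar> > score_const \<kappa>0 L * (real n)\<^sup>2 * (p\<^sup>2 + q\<^sup>2)}
       \<le> prob {s \<in> space M. \<bar>Q (\<lambda>i j. h t i j - h \<theta> i j) s\<bar> > 3 * \<beta> * real n * m + 8 * (real n)\<^sup>2 * m\<^sup>2}"
      by (intro finite_measure_mono) auto
    also have "\<dots> \<le> 30 * exp (- (z + ln (real n)))"
      unfolding Q_def
    proof (rule weighted_pair_sum_le[OF n0 ind w0 w2 _ _ rows \<beta>])
      show "\<bar>h t i j - h \<theta> i j\<bar> \<le> 1" for i j by (simp add: h_def)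
      show "h t i j - h \<theta> i j = h t j i - h \<theta> j i" for i j by (simp add: hsym[of _ i j])
      show "0 \<le> z + ln (real n)" using n0 by (simp add: z_def)
      show "z + ln (real n) \<le> real n * m\<^sup>2" using logn by (simp add: z_def m(2) algebra_simps)
    qed (use m in auto)
    also have "exp (- (z + ln (real n))) = exp (- z) / real n" using n0 by (simp add: exp_diff)
    finally show ?thesis .
  qed
  define C where "C = (\<lambda>a. {s \<in> space M. \<bar>Q a s\<bar> > 11 * (real n)\<^sup>2 * p})"
  define Fi where "Fi = (\<lambda>k. {s \<in> space M. \<bar>Q (\<lambda>i j. h (window_grid n \<theta> c k) i j - h \<theta> i j) s\<bar>
      > score_const \<kappa>0 L * (real n)\<^sup>2 * (p\<^sup>2 + q\<^sup>2)})"
  define Nu where "Nu = {s \<in> space M. \<not> (\<forall>i\<in>{1..n}. \<omega> i s = 0 \<or> \<omega> i s = 2)}"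
  have Cm: "C a \<in> events" for a unfolding C_def by measurable
  have Fm: "Fi k \<in> events" for k unfolding Fi_def by measurable
  have Nm: "Nu \<in> events" unfolding Nu_def by measurable
  have pN: "prob Nu \<le> 0"
  proof -
    have "AE s in M. \<forall>i\<in>{1..n}. \<omega> i s = 0 \<or> \<omega> i s = 2"
      using w0 w2 by (intro AE_finite_allI doubled_bernoulli_AE) auto
    hence "AE s in M. s \<notin> Nu" by eventually_elim (simp add: Nu_def)
    hence "prob Nu = 0" using Nm by (simp add: prob_eq_0)
    thus ?thesis by simp
  qed
  \<comment> \<open>Four coarse events at level \<open>z\<close> and at most \<open>3 n\<close> fine ones at level \<open>z + log n\<close>.\<close>
  define lo where "lo = hodges_lehmann n x - dev_radius \<kappa>0 L q p"
  define hi where "hi = hodges_lehmann n x + dev_radius \<kappa>0 L q p"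
  define K where "K = {k \<in> {..2 * n}. \<bar>window_grid n \<theta> c k - \<theta>\<bar> \<le> \<rho>}"
  define Bad where "Bad = Nu \<union> (C (\<lambda>_ _. 1) \<union> (C (\<lambda>i j. h \<theta> i j - 1 / 2) \<union> (C (\<lambda>i j. h lo i j - 1 / 2) \<union>
      (C (\<lambda>i j. h hi i j - 1 / 2) \<union> (\<Union>k\<in>K. Fi k)))))"
  have finK: "finite K" by (simp add: K_def)
  have Bm: "Bad \<in> events" unfolding Bad_def using Cm Fm Nm finK by (intro sets.Un sets.finite_UN) auto
  have pC: "prob (C (\<lambda>i j. h t i j - 1 / 2)) \<le> 30 * exp (- z)" for t
    unfolding C_def using hsym by (intro coarse) (auto simp: h_def)
  have pU: "prob (\<Union>k\<in>K. Fi k) \<le> (3 * real n) * (30 * (exp (- z) / real n))"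
  proof (rule prob_finite_union_le[OF finK Fm])
    have "card K \<le> card {..2 * n}" unfolding K_def by (intro card_mono) auto
    also have "\<dots> \<le> 3 * n" using n by simp
    finally show "real (card K) \<le> 3 * real n" by linarith
    show "prob (Fi k) \<le> 30 * (exp (- z) / real n)" if "k \<in> K" for k
      using that unfolding Fi_def K_def by (intro fine) simp
  qed auto
  have "{s \<in> space M. \<not> regular_weights n \<kappa>0 L \<theta> c q p x (\<lambda>i. \<omega> i s)} \<subseteq> Bad"
  proof
    fix s assume s: "s \<in> {s \<in> space M. \<not> regular_weights n \<kappa>0 L \<theta> c q p x (\<lambda>i. \<omega> i s)}"
    show "s \<in> Bad"
    proof (rule ccontr)
      assume not: "s \<notin> Bad"
      have sp: "s \<in> space M" using s by simp
      have 1: "\<forall>i\<in>{1..n}. \<omega> i s = 0 \<or> \<omega> i s = 2" using not sp unfolding Bad_def Nu_def by blast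
      have c: "\<bar>Q a s\<bar> \<le> 11 * (real n)\<^sup>2 * p" if "s \<notin> C a" for a using that sp unfolding C_def by auto
      have 2: "\<bar>Q (\<lambda>_ _. 1) s\<bar> \<le> 11 * (real n)\<^sup>2 * p"
        and 3: "\<bar>Q (\<lambda>i j. h \<theta> i j - 1 / 2) s\<bar> \<le> 11 * (real n)\<^sup>2 * p"
        and 4: "\<bar>Q (\<lambda>i j. h lo i j - 1 / 2) s\<bar> \<le> 11 * (real n)\<^sup>2 * p"
        and 5: "\<bar>Q (\<lambda>i j. h hi i j - 1 / 2) s\<bar> \<le> 11 * (real n)\<^sup>2 * p"
        using not unfolding Bad_def by (auto intro!: c)
      have 6: "\<bar>Q (\<lambda>i j. h (window_grid n \<theta> c k) i j - h \<theta> i j) s\<bar> \<le> score_const \<kappa>0 L * (real n)\<^sup>2 * (p\<^sup>2 + q\<^sup>2)"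
        if "k \<in> {..2 * n}" "\<bar>window_grid n \<theta> c k - \<theta>\<bar> \<le> radius_const \<kappa>0 L * sqrt (p\<^sup>2 + q\<^sup>2)" for k
      proof -
        have "k \<in> K" using that by (simp add: K_def \<rho>_def m_def)
        hence "s \<notin> Fi k" using not unfolding Bad_def by blast
        thus ?thesis using sp unfolding Fi_def by auto
      qed
      have "regular_weights n \<kappa>0 L \<theta> c q p x (\<lambda>i. \<omega> i s)"
        unfolding regular_weights_def total score_diff unfolding score lo_def[symmetric] hi_def[symmetric]
        using 1 2 3 4 5 6 by blast
      thus False using s by simp
    qed
  qed
  hence "prob {s \<in> space M. \<not> regular_weights n \<kappa>0 L \<theta> c q p x (\<lambda>i. \<omega> i s)} \<le> prob Bad"
    using Bm by (intro finite_measure_mono)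
  also have "\<dots> \<le> 0 + (30 * exp (- z) + (30 * exp (- z) + (30 * exp (- z) + (30 * exp (- z)
      + (3 * real n) * (30 * (exp (- z) / real n))))))"
    unfolding Bad_def
    by (intro order_trans[OF measure_Un_le] add_mono pN pC pU coarse[folded C_def] sets.Un sets.finite_UN Cm Fm Nm finK)
       (auto simp: C_def intro!: coarse)
  also have "\<dots> = 210 * exp (- z)" using n0 by simp
  finally show ?thesis by (simp add: z_def)
qed

section \<open>Increments of a function with bounded derivatives\<close>

lemma increments_of_derivative_bounds:
  fixes U :: "real \<Rightarrow> real"
  assumes d1: "\<And>\<delta>. \<bar>\<delta>\<bar> \<le> c \<Longrightarrow> U differentiable at (\<theta> + \<delta>) \<and> deriv U (\<theta> + \<delta>) \<ge> \<kappa>0"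
    and d2: "\<And>\<delta>. \<bar>\<delta>\<bar> \<le> c \<Longrightarrow> deriv U differentiable at (\<theta> + \<delta>) \<and> \<bar>deriv (deriv U) (\<theta> + \<delta>)\<bar> \<le> \<kappa>1"
  shows "\<And>s t. \<theta> - c \<le> s \<Longrightarrow> s \<le> t \<Longrightarrow> t \<le> \<theta> + c \<Longrightarrow> \<kappa>0 * (t - s) \<le> U t - U s"
    and "\<And>s t r. r \<le> c \<Longrightarrow> \<bar>s - \<theta>\<bar> \<le> r \<Longrightarrow> \<bar>t - \<theta>\<bar> \<le> r \<Longrightarrow>
           \<bar>U t - U s - deriv U \<theta> * (t - s)\<bar> \<le> \<kappa>1 * r * \<bar>t - s\<bar>"
proof -
  have D1: "(U has_real_derivative deriv U y) (at y)" "deriv U y \<ge> \<kappa>0" if "\<bar>y - \<theta>\<bar> \<le> c" for y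
    using d1[of "y - \<theta>"] that by (auto simp: DERIV_deriv_iff_real_differentiable)
  have D2: "(deriv U has_real_derivative deriv (deriv U) y) (at y)" "\<bar>deriv (deriv U) y\<bar> \<le> \<kappa>1" if "\<bar>y - \<theta>\<bar> \<le> c" for y
    using d2[of "y - \<theta>"] that by (auto simp: DERIV_deriv_iff_real_differentiable)
  have mvt: "\<exists>y. \<bar>y - \<theta>\<bar> \<le> r \<and> f t - f s = (t - s) * f' y"
    if "s \<le> t" "\<bar>s - \<theta>\<bar> \<le> r" "\<bar>t - \<theta>\<bar> \<le> r" "\<And>y. \<bar>y - \<theta>\<bar> \<le> r \<Longrightarrow> (f has_real_derivative f' y) (at y)"
    for s t r and f f' :: "real \<Rightarrow> real"
  proof (cases "s = t")
    case True thus ?thesis using that(2) by auto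
  next
    case False
    hence "s < t" using that(1) by simp
    moreover have "(f has_real_derivative f' y) (at y)" if "s \<le> y" "y \<le> t" for y
      using \<open>\<bar>s - \<theta>\<bar> \<le> r\<close> \<open>\<bar>t - \<theta>\<bar> \<le> r\<close> that by (intro \<open>\<And>y. \<bar>y - \<theta>\<bar> \<le> r \<Longrightarrow> _\<close>) linarith
    ultimately obtain y where "s < y" "y < t" "f t - f s = (t - s) * f' y"
      using MVT2[of s t f f'] by blast
    moreover have "\<bar>y - \<theta>\<bar> \<le> r" using \<open>s < y\<close> \<open>y < t\<close> that(2,3) by linarith
    ultimately show ?thesis by blast
  qed
  show "\<kappa>0 * (t - s) \<le> U t - U s" if "\<theta> - c \<le> s" "s \<le> t" "t \<le> \<theta> + c" for s t
  proof -
    have st: "\<bar>s - \<theta>\<bar> \<le> c" "\<bar>t - \<theta>\<bar> \<le> c" "s \<le> t" using that by linarith+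
    obtain y where y: "\<bar>y - \<theta>\<bar> \<le> c" "U t - U s = (t - s) * deriv U y"
      using mvt[OF st(3,1,2), of U "deriv U"] D1 by blast
    show ?thesis unfolding y(2) using that D1(2)[OF y(1)] by (subst mult.commute) (intro mult_left_mono, auto)
  qed
  have main: "\<bar>U t - U s - deriv U \<theta> * (t - s)\<bar> \<le> \<kappa>1 * r * (t - s)"
    if r: "r \<le> c" and s: "\<bar>s - \<theta>\<bar> \<le> r" and t: "\<bar>t - \<theta>\<bar> \<le> r" and st: "s \<le> t" for s t r
  proof -
    have r0: "0 \<le> r" "0 \<le> c" using r s by linarith+
    have k1: "0 \<le> \<kappa>1" using D2(2)[of \<theta>] r0 by simp
    obtain y where y: "\<bar>y - \<theta>\<bar> \<le> r" "U t - U s = (t - s) * deriv U y"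
      using mvt[OF st s t, of U "deriv U"] D1 r by fastforce
    have "\<bar>deriv U y - deriv U \<theta>\<bar> \<le> \<kappa>1 * r"
    proof -
      have d: "(deriv U has_real_derivative deriv (deriv U) x) (at x)" if "\<bar>x - \<theta>\<bar> \<le> r" for x
        using D2(1)[of x] that r by linarith
      have "\<exists>x. \<bar>x - \<theta>\<bar> \<le> r \<and> \<bar>deriv U y - deriv U \<theta>\<bar> = \<bar>y - \<theta>\<bar> * \<bar>deriv (deriv U) x\<bar>"
      proof (cases "y \<le> \<theta>")
        case True
        obtain x where x: "\<bar>x - \<theta>\<bar> \<le> r" "deriv U \<theta> - deriv U y = (\<theta> - y) * deriv (deriv U) x"
          using mvt[OF True y(1), of "deriv U" "deriv (deriv U)"] d r0 by auto
        have "\<bar>deriv U y - deriv U \<theta>\<bar> = \<bar>deriv U \<theta> - deriv U y\<bar>" by (rule abs_minus_commute)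
        also have "\<dots> = \<bar>y - \<theta>\<bar> * \<bar>deriv (deriv U) x\<bar>" unfolding x(2) abs_mult by (simp add: abs_minus_commute)
        finally show ?thesis using x(1) by blast
      next
        case False
        hence le: "\<theta> \<le> y" by simp
        obtain x where x: "\<bar>x - \<theta>\<bar> \<le> r" "deriv U y - deriv U \<theta> = (y - \<theta>) * deriv (deriv U) x"
          using mvt[OF le _ y(1), of "deriv U" "deriv (deriv U)"] d r0 by auto
        thus ?thesis by (auto simp: abs_mult)
      qed
      then obtain x where x: "\<bar>x - \<theta>\<bar> \<le> r" "\<bar>deriv U y - deriv U \<theta>\<bar> = \<bar>y - \<theta>\<bar> * \<bar>deriv (deriv U) x\<bar>" by blast
      have "\<bar>x - \<theta>\<bar> \<le> c" using x(1) r by linarith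
      hence "\<bar>y - \<theta>\<bar> * \<bar>deriv (deriv U) x\<bar> \<le> r * \<kappa>1"
        using D2(2) y(1) r0 k1 by (intro mult_mono) auto
      thus ?thesis using x(2) by (simp add: mult.commute)
    qed
    hence "\<bar>deriv U y - deriv U \<theta>\<bar> * (t - s) \<le> \<kappa>1 * r * (t - s)" using st by (intro mult_right_mono) auto
    moreover have "U t - U s - deriv U \<theta> * (t - s) = (deriv U y - deriv U \<theta>) * (t - s)"
      unfolding y(2) by (simp add: algebra_simps)
    ultimately show ?thesis using st by (simp add: abs_mult)
  qed
  show "\<bar>U t - U s - deriv U \<theta> * (t - s)\<bar> \<le> \<kappa>1 * r * \<bar>t - s\<bar>"
    if "r \<le> c" "\<bar>s - \<theta>\<bar> \<le> r" "\<bar>t - \<theta>\<bar> \<le> r" for s t r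
  proof (cases "s \<le> t")
    case True thus ?thesis using main[OF that True] by simp
  next
    case False
    hence "\<bar>U s - U t - deriv U \<theta> * (s - t)\<bar> \<le> \<kappa>1 * r * (s - t)" using main[OF that(1,3,2)] by simp
    moreover have "U s - U t - deriv U \<theta> * (s - t) = - (U t - U s - deriv U \<theta> * (t - s))" by (simp add: algebra_simps)
    moreover have "\<bar>t - s\<bar> = s - t" using False by simp
    ultimately show ?thesis by (simp only: abs_minus_cancel)
  qed
qed

section \<open>The bootstrap model\<close>

lemma U_stat_cong: "(\<And>i. i \<in> {1..n} \<Longrightarrow> x i = y i) \<Longrightarrow> U_stat n x t = U_stat n y t"
  unfolding U_stat_def by (intro arg_cong2[of _ _ _ _ "(*)"] refl sum.cong) (auto simp: offdiag_def)

lemma hodges_lehmann_cong: "(\<And>i. i \<in> {1..n} \<Longrightarrow> x i = y i) \<Longrightarrow> hodges_lehmann n x = hodges_lehmann n y"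
  unfolding hodges_lehmann_def by (intro arg_cong[of _ _ cdf_median] ext U_stat_cong)

lemma weight_total_cong: "(\<And>i. i \<in> {1..n} \<Longrightarrow> v i = w i) \<Longrightarrow> weight_total n v = weight_total n w"
  unfolding weight_total_def by (intro sum.cong refl) (auto simp: offdiag_def)

lemma boot_score_cong:
  "(\<And>i. i \<in> {1..n} \<Longrightarrow> v i = w i) \<Longrightarrow> (\<And>i. i \<in> {1..n} \<Longrightarrow> x i = y i) \<Longrightarrow> boot_score n v x t = boot_score n w y t"
  unfolding boot_score_def by (intro sum.cong refl) (auto simp: offdiag_def)

lemma regular_weights_cong:
  assumes "\<And>i. i \<in> {1..n} \<Longrightarrow> v i = w i" "\<And>i. i \<in> {1..n} \<Longrightarrow> x i = y i"
  shows "regular_weights n \<kappa>0 L \<theta> c q p x v \<longleftrightarrow> regular_weights n \<kappa>0 L \<theta> c q p y w"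
proof -
  have 1: "(\<forall>i\<in>{1..n}. v i = 0 \<or> v i = 2) \<longleftrightarrow> (\<forall>i\<in>{1..n}. w i = 0 \<or> w i = 2)"
    using assms(1) by (intro ball_cong) auto
  have 2: "boot_score n v x t = boot_score n w y t" for t by (rule boot_score_cong) (simp_all add: assms)
  have 3: "weight_total n v = weight_total n w" by (rule weight_total_cong) (rule assms)
  have 4: "hodges_lehmann n x = hodges_lehmann n y" by (rule hodges_lehmann_cong) (rule assms)
  show ?thesis unfolding regular_weights_def 1 2 3 4 ..
qed

lemma regular_data_cong:
  assumes "\<And>i. i \<in> {1..n} \<Longrightarrow> x i = y i"
  shows "regular_data n U \<theta> c L q x \<longleftrightarrow> regular_data n U \<theta> c L q y"
proof -
  have count: "(\<Sum>j\<in>{1..n} - {i}. of_bool ((x i + x j) / 2 \<le> t) - of_bool ((x i + x j) / 2 \<le> s) :: real)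
      = (\<Sum>j\<in>{1..n} - {i}. of_bool ((y i + y j) / 2 \<le> t) - of_bool ((y i + y j) / 2 \<le> s))"
    if "i \<in> {1..n}" for i s t using assms that by (intro sum.cong) auto
  have us: "U_stat n x t = U_stat n y t" for t by (rule U_stat_cong) (rule assms)
  show ?thesis unfolding regular_data_def us
    by (intro arg_cong2[of _ _ _ _ "(\<and>)"] refl ball_cong) (simp only: count)
qed

context hl_bootstrap
begin

lemma data_measurable: "i \<in> {1..n} \<Longrightarrow> X i \<in> borel_measurable M"
proof -
  assume i: "i \<in> {1..n}"
  hence [measurable]: "\<xi> i \<in> borel_measurable M" using noise_indep by (auto simp: indep_vars_def)
  have "(\<lambda>s. \<theta> + \<xi> i s) \<in> borel_measurable M" by measurable
  thus ?thesis using measurable_cong[of M "X i" "\<lambda>s. \<theta> + \<xi> i s"] X_eq[OF i] by blast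
qed

lemma weights_measurable: "i \<in> {1..n} \<Longrightarrow> \<omega> i \<in> borel_measurable M"
  using weights_indep by (auto simp: indep_vars_def)

lemma noise_measurable: "i \<in> {1..n} \<Longrightarrow> \<xi> i \<in> borel_measurable M"
  using noise_indep by (auto simp: indep_vars_def)

lemma data_indep: "indep_vars (\<lambda>_. borel) X {1..n}"
proof -
  have ind: "indep_vars (\<lambda>_. borel) (\<lambda>i s. \<theta> + \<xi> i s) {1..n}"
    by (rule indep_vars_compose2[OF noise_indep, where Y = "\<lambda>_ e. \<theta> + e"]) simp
  have vim: "X i -` A \<inter> space M = (\<lambda>s. \<theta> + \<xi> i s) -` A \<inter> space M" if "i \<in> {1..n}" for i A
    using X_eq[OF that] by auto
  have "indep_sets (\<lambda>i. {X i -` A \<inter> space M | A. A \<in> sets borel}) {1..n}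
     \<longleftrightarrow> indep_sets (\<lambda>i. {(\<lambda>s. \<theta> + \<xi> i s) -` A \<inter> space M | A. A \<in> sets borel}) {1..n}"
    by (rule indep_sets_cong[OF refl]) (simp only: vim)
  thus ?thesis using ind data_measurable unfolding indep_vars_def2 by blast
qed

lemma data_distr:
  assumes "i \<in> {1..n}" "j \<in> {1..n}"
  shows "distr M borel (X i) = distr M borel (X j)"
proof -
  have shift: "distr M borel (X k) = distr (distr M borel (\<xi> k)) borel (\<lambda>e. \<theta> + e)" if k: "k \<in> {1..n}" for k
  proof -
    have "distr (distr M borel (\<xi> k)) borel (\<lambda>e. \<theta> + e) = distr M borel (\<lambda>s. \<theta> + \<xi> k s)"
      using noise_measurable[OF k] by (subst distr_distr) (auto simp: comp_def)
    also have "\<dots> = distr M borel (X k)" by (intro distr_cong) (auto simp: X_eq[OF k])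
    finally show ?thesis ..
  qed
  have "distr M borel (\<xi> i) = distr M borel (\<xi> j)"
    using assms noise_cdf by (intro cdf_unique) (auto simp: noise_measurable)
  thus ?thesis using assms by (simp only: shift)
qed

lemma data_cdf_lipschitz:
  assumes i: "i \<in> {1..n}" and f: "\<And>t. f t \<le> L" and L: "0 \<le> L" and st: "s \<le> t"
  shows "cdf (distr M borel (X i)) t - cdf (distr M borel (X i)) s \<le> L * (t - s)"
proof -
  interpret R: real_distribution "distr M borel (X i)" using data_measurable[OF i] by simp
  show ?thesis
  proof (cases "s = t")
    case True thus ?thesis by simp
  next
    case False
    hence lt: "s < t" using st by simp
    have "cdf (distr M borel (X i)) t - cdf (distr M borel (X i)) s = measure (distr M borel (X i)) {s<..t}"
      by (rule R.cdf_diff_eq[OF lt])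
    also have "\<dots> = prob (X i -` {s<..t} \<inter> space M)"
      using data_measurable[OF i] by (subst measure_distr) auto
    also have "X i -` {s<..t} \<inter> space M = \<xi> i -` {s - \<theta><..t - \<theta>} \<inter> space M"
      using X_eq[OF i] by (auto simp: algebra_simps)
    finally have eq: "cdf (distr M borel (X i)) t - cdf (distr M borel (X i)) s
       = prob (\<xi> i -` {s - \<theta><..t - \<theta>} \<inter> space M)" .
    have "ennreal (prob (\<xi> i -` {s - \<theta><..t - \<theta>} \<inter> space M))
       = (\<integral>\<^sup>+e. ennreal (f e) * indicator {s - \<theta><..t - \<theta>} e \<partial>lborel)"
      unfolding emeasure_eq_measure[symmetric]
      by (rule distributed_emeasure[OF noise_density[OF i]]) simp
    also have "\<dots> \<le> (\<integral>\<^sup>+e. ennreal L * indicator {s - \<theta><..t - \<theta>} e \<partial>lborel)"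
      using f by (intro nn_integral_mono mult_right_mono ennreal_leI) auto
    also have "\<dots> = ennreal L * emeasure lborel {s - \<theta><..t - \<theta>}" by (intro nn_integral_cmult_indicator) simp
    also have "\<dots> = ennreal L * ennreal (t - s)" using st by (subst emeasure_lborel_Ioc) auto
    also have "\<dots> = ennreal (L * (t - s))" using L st by (intro ennreal_mult[symmetric]) auto
    finally show ?thesis unfolding eq using L st by (subst (asm) ennreal_le_iff) auto
  qed
qed

text \<open>The infimum defining the pseudomedian gives values at least 1/2 to the right of \<open>\<theta>\<close> and below 1/2
to the left, and continuity decides the value at \<open>\<theta>\<close> itself.\<close>

lemma mean_cdf_at_centre:
  assumes cont: "isCont (mean_cdf M X) \<theta>"
  shows "mean_cdf M X \<theta> = 1 / 2"
proof -
  have in12: "(1::nat) \<in> {1..n}" "(2::nat) \<in> {1..n}" using n_ge_2 by auto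
  define Z where "Z = (\<lambda>s. (\<xi> 1 s + \<xi> 2 s) / 2)"
  have [measurable]: "Z \<in> borel_measurable M" unfolding Z_def using in12[THEN noise_measurable] by measurable
  interpret Z: real_distribution "distr M borel Z" by simp
  define G where "G = mean_cdf M \<xi>"
  have G: "G t = cdf (distr M borel Z) t" for t
  proof -
    have "Z -` {..t} \<inter> space M = {s \<in> space M. (\<xi> 1 s + \<xi> 2 s) / 2 \<le> t}" by (auto simp: Z_def)
    thus ?thesis unfolding G_def mean_cdf_def cdf_def2 by (simp add: measure_distr)
  qed
  have shift: "mean_cdf M X t = G (t - \<theta>)" for t
    unfolding G_def mean_cdf_def
    using X_eq[OF in12(1)] X_eq[OF in12(2)] by (intro arg_cong[of _ _ prob] Collect_cong conj_cong refl) (auto simp: field_simps)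
  have mono: "mono G" unfolding G by (intro monoI Z.cdf_nondecreasing)
  have "eventually (\<lambda>x. G x < 1 / 2) at_bot" unfolding G by (rule order_tendstoD(2)[OF Z.cdf_lim_at_bot]) simp
  then obtain a where a: "G a < 1 / 2" using eventually_happens'[OF trivial_limit_at_bot_linorder] by blast
  have "eventually (\<lambda>x. 1 / 2 < G x) at_top" unfolding G by (rule order_tendstoD(1)[OF Z.cdf_lim_at_top_prob]) simp
  then obtain b where b: "1 / 2 < G b" using eventually_happens'[OF trivial_limit_at_top_linorder] by blast
  have med: "cdf_median G = 0" using pseudomedian_zero by (simp add: G_def)
  have hi: "G t \<ge> 1 / 2" if "0 < t" for t using above_cdf_median[OF mono a less_imp_le[OF b]] med that by simp
  have lo: "G t < 1 / 2" if "t < 0" for t using below_cdf_median[OF mono a] med that by simp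
  have lim: "((mean_cdf M X) \<longlongrightarrow> mean_cdf M X \<theta>) (at \<theta>)" using cont by (simp add: isCont_def)
  have r: "((mean_cdf M X) \<longlongrightarrow> mean_cdf M X \<theta>) (at_right \<theta>)"
    and l: "((mean_cdf M X) \<longlongrightarrow> mean_cdf M X \<theta>) (at_left \<theta>)"
    using lim by (auto intro: tendsto_within_subset)
  have "1 / 2 \<le> mean_cdf M X \<theta>"
  proof (rule tendsto_lowerbound[OF r])
    show "\<forall>\<^sub>F t in at_right \<theta>. 1 / 2 \<le> mean_cdf M X t"
      using eventually_at_right_less by (rule eventually_mono) (unfold shift, rule hi, simp)
  qed simp
  moreover have "mean_cdf M X \<theta> \<le> 1 / 2"
  proof (rule tendsto_upperbound[OF l])
    have "\<forall>\<^sub>F t in at_left \<theta>. t < \<theta>" unfolding eventually_at_filter by simp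
    thus "\<forall>\<^sub>F t in at_left \<theta>. mean_cdf M X t \<le> 1 / 2"
      by (rule eventually_mono) (unfold shift, rule less_imp_le, rule lo, simp)
  qed simp
  ultimately show ?thesis by simp
qed

lemma bootstrap_events_measurable:
  shows "{r \<in> space M. \<bar>\<theta>s r - hodges_lehmann n (\<lambda>i. X i r)\<bar> > C} \<in> events"
    and "{r \<in> space M. \<bar>\<theta>s r - hodges_lehmann n (\<lambda>i. X i r)
           - Binv r * (\<Sum>(i, j)\<in>offdiag n. (\<omega> i r * \<omega> j r - 1) * V_term n u \<theta> (\<lambda>i. X i r) (\<lambda>i. \<xi> i r) i j)\<bar> > C} \<in> events"
proof -
  let ?P = "PiM {1..n} (\<lambda>_. borel :: real measure)"
  have Y: "sample_vec n X \<in> measurable M ?P"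
    unfolding sample_vec_def by (intro measurable_restrict data_measurable)
  have agree: "sample_vec n X r i = X i r" if "i \<in> {1..n}" for r i using that by (simp add: sample_vec_def)
  have "(\<lambda>r. hodges_lehmann n (sample_vec n X r)) \<in> borel_measurable M"
    by (rule measurable_compose[OF Y measurable_hodges_lehmann[OF n_ge_2]])
  moreover have "hodges_lehmann n (sample_vec n X r) = hodges_lehmann n (\<lambda>i. X i r)" for r
    by (rule hodges_lehmann_cong) (rule agree)
  ultimately have [measurable]: "(\<lambda>r. hodges_lehmann n (\<lambda>i. X i r)) \<in> borel_measurable M" by simp
  have "(\<lambda>r. U_stat n (sample_vec n X r) t) \<in> borel_measurable M" for t
    by (rule measurable_compose[OF Y measurable_U_stat])
  moreover have "U_stat n (sample_vec n X r) t = U_stat n (\<lambda>i. X i r) t" for r t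
    by (rule U_stat_cong) (rule agree)
  ultimately have [measurable]: "(\<lambda>r. U_stat n (\<lambda>i. X i r) t) \<in> borel_measurable M" for t by simp
  have [measurable]: "(\<lambda>r. \<Sum>(i, j)\<in>offdiag n. (\<omega> i r * \<omega> j r - 1) * V_term n u \<theta> (\<lambda>i. X i r) (\<lambda>i. \<xi> i r) i j)
     \<in> borel_measurable M"
    unfolding V_term_def
  proof (rule measurable_sum_offdiag)
    fix i j assume ij: "i \<in> {1..n}" "j \<in> {1..n}"
    note [measurable] = ij[THEN noise_measurable] ij[THEN weights_measurable]
    show "(\<lambda>r. (\<omega> i r * \<omega> j r - 1) * ((U_stat n (\<lambda>i. X i r) \<theta> - of_bool (\<xi> i r + \<xi> j r \<le> 0)) / u))
        \<in> borel_measurable M"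
      by measurable
  qed
  note [measurable] = boot_est_measurable Binv_measurable
  show "{r \<in> space M. \<bar>\<theta>s r - hodges_lehmann n (\<lambda>i. X i r)\<bar> > C} \<in> events" by measurable
  show "{r \<in> space M. \<bar>\<theta>s r - hodges_lehmann n (\<lambda>i. X i r)
           - Binv r * (\<Sum>(i, j)\<in>offdiag n. (\<omega> i r * \<omega> j r - 1) * V_term n u \<theta> (\<lambda>i. X i r) (\<lambda>i. \<xi> i r) i j)\<bar> > C} \<in> events"
    by measurable
qed

text \<open>For a sample in the regular set and weights outside an exceptional set that depends on the sample,
\<open>bootstrap_comparison\<close> excludes both deviation events; the exceptional sets have probability at most \<open>210 exp
(- n p\<^sup>2)\<close>, and this bound passes to the conditional probabilities almost surely on the regular set.\<close>

lemma bootstrap_probability_bounds: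
  fixes L c \<kappa>0 \<kappa>1 q p :: real
  defines "U \<equiv> mean_cdf M X"
  assumes f: "\<And>t. f t \<le> L" and L: "L \<ge> 1" and c: "0 < c" "c \<le> 1" and \<kappa>: "\<kappa>0 > 0" "\<kappa>1 > 0"
    and d1: "\<And>\<delta>. \<bar>\<delta>\<bar> \<le> c \<Longrightarrow> U differentiable at (\<theta> + \<delta>) \<and> deriv U (\<theta> + \<delta>) \<ge> \<kappa>0"
    and d2: "\<And>\<delta>. \<bar>\<delta>\<bar> \<le> c \<Longrightarrow> deriv U differentiable at (\<theta> + \<delta>) \<and> \<bar>deriv (deriv U) (\<theta> + \<delta>)\<bar> \<le> \<kappa>1"
    and scales: "small_scales \<kappa>0 L c q p" and nq: "real n * q\<^sup>2 \<ge> 1" "ln (real n) \<le> real n * q\<^sup>2"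
  shows "prob {s \<in> space M.
       cond_prob_data M n X (\<lambda>r. \<bar>\<theta>s r - hodges_lehmann n (\<lambda>i. X i r)\<bar> > dev_radius \<kappa>0 L q p) s
         \<le> 210 * exp (- (real n * p\<^sup>2)) \<and>
       cond_prob_data M n X (\<lambda>r. \<bar>\<theta>s r - hodges_lehmann n (\<lambda>i. X i r)
           - Binv r * (\<Sum>(i, j)\<in>offdiag n. (\<omega> i r * \<omega> j r - 1) *
               V_term n (deriv U \<theta>) \<theta> (\<lambda>i. X i r) (\<lambda>i. \<xi> i r) i j)\<bar> > lin_const \<kappa>0 \<kappa>1 L * (p\<^sup>2 + q\<^sup>2)) s
         \<le> 210 * exp (- (real n * p\<^sup>2))}
     \<ge> 1 - 106 * (real n * exp (- (real n * q\<^sup>2)))"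
proof -
  let ?P = "PiM {1..n} (\<lambda>_. borel :: real measure)"
  have q: "0 < q" "q \<le> 1" using scales by (auto simp: small_scales_def)
  have n0: "real n > 0" using n_ge_2 by simp
  have one_in: "(1::nat) \<in> {1..n}" using n_ge_2 by auto
  \<comment> \<open>Differentiability at \<open>\<theta>\<close> gives the continuity that makes the value there exactly 1/2.\<close>
  have "isCont U \<theta>" using d1[of 0] c by (auto intro: differentiable_imp_continuous_within)
  hence median: "U \<theta> = 1 / 2" unfolding U_def by (rule mean_cdf_at_centre)
  have small: "real n * exp (- (real n * q\<^sup>2)) \<le> 1"
  proof -
    have "real n = exp (ln (real n))" using n0 by simp
    also have "\<dots> \<le> exp (real n * q\<^sup>2)" using nq by simp
    finally show ?thesis by (simp add: exp_minus field_simps)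
  qed
  obtain A where A: "A \<in> sets ?P" "\<And>x. x \<in> A \<Longrightarrow> regular_data n U \<theta> c L q x"
    "prob {s \<in> space M. sample_vec n X s \<in> A} \<ge> 1 - 106 * (real n * exp (- (real n * q\<^sup>2)))"
  proof (rule regular_data_probability[OF n_ge_2 data_indep, where \<nu> = "distr M borel (X 1)" and L = L and c = c and q = q and \<theta> = \<theta>])
    show "cdf (distr M borel (X 1)) t - cdf (distr M borel (X 1)) s \<le> L * (t - s)" if "s \<le> t" for s t
      using L that by (intro data_cdf_lipschitz[OF one_in f]) auto
    show "distr M borel (X i) = distr M borel (X 1)" if "i \<in> {1..n}" for i by (rule data_distr[OF that one_in])
  qed (use L c q nq small median in \<open>auto simp: U_def\<close>)
  define N where "N = {z \<in> space (?P \<Otimes>\<^sub>M ?P). \<not> regular_weights n \<kappa>0 L \<theta> c q p (fst z) (snd z)}"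
  have N: "N \<in> sets (?P \<Otimes>\<^sub>M ?P)" unfolding N_def by (rule sets_irregular_weights[OF n_ge_2])
  define e where "e = 210 * exp (- (real n * p\<^sup>2))"
  have section_le: "prob {s \<in> space M. (x, sample_vec n \<omega> s) \<in> N} \<le> e" if x: "x \<in> A" for x
  proof -
    have "regular_weights n \<kappa>0 L \<theta> c q p x (sample_vec n \<omega> s) \<longleftrightarrow> regular_weights n \<kappa>0 L \<theta> c q p x (\<lambda>i. \<omega> i s)" for s
      by (rule regular_weights_cong) (auto simp: sample_vec_def)
    moreover have "(x, sample_vec n \<omega> s) \<in> space (?P \<Otimes>\<^sub>M ?P)" for s
      using sets.sets_into_space[OF A(1)] x by (auto simp: space_pair_measure space_PiM sample_vec_def)
    ultimately have "{s \<in> space M. (x, sample_vec n \<omega> s) \<in> N}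
        = {s \<in> space M. \<not> regular_weights n \<kappa>0 L \<theta> c q p x (\<lambda>i. \<omega> i s)}" by (simp add: N_def)
    thus ?thesis unfolding e_def
      using irregular_weights_probability[OF n_ge_2 weights_indep weights_0 weights_2 \<kappa>(1) L scales nq(2) A(2)[OF x]]
      by simp
  qed
  define E1 where "E1 = {r \<in> space M. \<bar>\<theta>s r - hodges_lehmann n (\<lambda>i. X i r)\<bar> > dev_radius \<kappa>0 L q p}"
  define E2 where "E2 = {r \<in> space M. \<bar>\<theta>s r - hodges_lehmann n (\<lambda>i. X i r)
           - Binv r * (\<Sum>(i, j)\<in>offdiag n. (\<omega> i r * \<omega> j r - 1) *
               V_term n (deriv U \<theta>) \<theta> (\<lambda>i. X i r) (\<lambda>i. \<xi> i r) i j)\<bar> > lin_const \<kappa>0 \<kappa>1 L * (p\<^sup>2 + q\<^sup>2)}"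
  have E: "E1 \<in> events" "E2 \<in> events" unfolding E1_def E2_def by (rule bootstrap_events_measurable)+
  have slopeU: "\<kappa>0 * (t - s) \<le> U t - U s" if "\<theta> - c \<le> s" "s \<le> t" "t \<le> \<theta> + c" for s t
    using increments_of_derivative_bounds(1)[of c U \<theta> \<kappa>0 \<kappa>1 s t] d1 d2 that by blast
  have linU: "\<bar>U t - U s - deriv U \<theta> * (t - s)\<bar> \<le> \<kappa>1 * r * \<bar>t - s\<bar>"
    if "r \<le> c" "\<bar>s - \<theta>\<bar> \<le> r" "\<bar>t - \<theta>\<bar> \<le> r" for s t r
    using increments_of_derivative_bounds(2)[of c U \<theta> \<kappa>0 \<kappa>1 r s t] d1 d2 that by blast
  have good: "s \<notin> E1 \<and> s \<notin> E2"
    if s: "s \<in> space M" "sample_vec n X s \<in> A" "(sample_vec n X s, sample_vec n \<omega> s) \<notin> N" for s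
  proof -
    let ?x = "\<lambda>i. X i s" and ?v = "\<lambda>i. \<omega> i s"
    have data: "regular_data n U \<theta> c L q ?x"
      using A(2)[OF s(2)] regular_data_cong[of n "sample_vec n X s" ?x] by (simp add: sample_vec_def)
    have "(sample_vec n X s, sample_vec n \<omega> s) \<in> space (?P \<Otimes>\<^sub>M ?P)"
      by (auto simp: space_pair_measure space_PiM sample_vec_def)
    hence "regular_weights n \<kappa>0 L \<theta> c q p (sample_vec n X s) (sample_vec n \<omega> s)" using s(3) by (simp add: N_def)
    hence weights: "regular_weights n \<kappa>0 L \<theta> c q p ?x ?v"
      using regular_weights_cong[of n "sample_vec n \<omega> s" ?v "sample_vec n X s" ?x] by (simp add: sample_vec_def)
    have slope: "\<kappa>0 \<le> deriv U \<theta>" using d1[of 0] c by simp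
    note comp = bootstrap_comparison[OF n_ge_2 c \<kappa> L scales nq(1) _ _ slope data weights]
    have sel: "card (selected n ?v) \<ge> 2" by (rule comp(1)) (fact slopeU linU)+
    have close: "\<bar>cdf_median (U_boot n ?v ?x) - hodges_lehmann n ?x\<bar> \<le> dev_radius \<kappa>0 L q p"
      by (rule comp(2)) (fact slopeU linU)+
    have linear: "\<bar>cdf_median (U_boot n ?v ?x) - hodges_lehmann n ?x
           - 1 / weight_total n ?v * (\<Sum>(i, j)\<in>offdiag n. (\<omega> i s * \<omega> j s - 1) *
                ((U_stat n ?x \<theta> - of_bool ((X i s + X j s) / 2 \<le> \<theta>)) / deriv U \<theta>))\<bar> \<le> lin_const \<kappa>0 \<kappa>1 L * (p\<^sup>2 + q\<^sup>2)"
      by (rule comp(3)) (fact slopeU linU)+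
    have V: "V_term n (deriv U \<theta>) \<theta> ?x (\<lambda>i. \<xi> i s) i j = (U_stat n ?x \<theta> - of_bool ((X i s + X j s) / 2 \<le> \<theta>)) / deriv U \<theta>"
      if "(i, j) \<in> offdiag n" for i j
    proof -
      have "i \<in> {1..n}" "j \<in> {1..n}" using that by (auto simp: offdiag_def)
      hence "(X i s + X j s) / 2 \<le> \<theta> \<longleftrightarrow> \<xi> i s + \<xi> j s \<le> 0" using X_eq s(1) by (simp add: field_simps)
      thus ?thesis by (simp only: V_term_def)
    qed
    have sumV: "(\<Sum>(i, j)\<in>offdiag n. (\<omega> i s * \<omega> j s - 1) * V_term n (deriv U \<theta>) \<theta> ?x (\<lambda>i. \<xi> i s) i j)
       = (\<Sum>(i, j)\<in>offdiag n. (\<omega> i s * \<omega> j s - 1) * ((U_stat n ?x \<theta> - of_bool ((X i s + X j s) / 2 \<le> \<theta>)) / deriv U \<theta>))"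
      by (intro sum.cong refl) (auto simp: V)
    have "s \<notin> E1" using close by (simp add: E1_def boot_est_eq[OF s(1) sel])
    moreover have "s \<notin> E2" using linear unfolding E2_def mem_Collect_eq sumV boot_est_eq[OF s(1) sel] Binv_eq[OF s(1) sel]
      by linarith
    ultimately show ?thesis ..
  qed
  have e0: "e \<ge> 0" by (simp add: e_def)
  have ae: "AE s in M. sample_vec n X s \<in> A \<longrightarrow> real_cond_exp M (data_algebra M n X) (indicator Ev) s \<le> e"
    if "Ev \<in> events" "\<And>s. s \<in> space M \<Longrightarrow> sample_vec n X s \<in> A \<Longrightarrow> (sample_vec n X s, sample_vec n \<omega> s) \<notin> N \<Longrightarrow> s \<notin> Ev" for Ev
    unfolding data_algebra_def
  proof (rule cond_prob_le_of_indep_section[OF data_weights_indep N A(1) e0 section_le that(1)])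
    fix s assume "s \<in> Ev" "sample_vec n X s \<in> A"
    thus "(sample_vec n X s, sample_vec n \<omega> s) \<in> N"
      using that(2)[of s] sets.sets_into_space[OF that(1)] by blast
  qed
  have Y: "sample_vec n X \<in> measurable M ?P"
    using data_weights_indep unfolding indep_var_distribution_eq by blast
  have sub: "subalgebra M (data_algebra M n X)"
  proof -
    have fn: "sample_vec n X \<in> space M \<rightarrow> space ?P" using measurable_space[OF Y] by auto
    show ?thesis unfolding subalgebra_def data_algebra_def sets_vimage_algebra2[OF fn] using measurable_sets[OF Y] by auto
  qed
  have rm [measurable]: "real_cond_exp M (data_algebra M n X) g \<in> borel_measurable M" for g
    by (rule measurable_from_subalg[OF sub]) simp
  define R where "R = (\<lambda>Ev. real_cond_exp M (data_algebra M n X) (indicator Ev))"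
  have Rm [measurable]: "R Ev \<in> borel_measurable M" for Ev unfolding R_def by (rule rm)
  have "AE s in M. sample_vec n X s \<in> A \<longrightarrow> R E1 s \<le> e" unfolding R_def using E good by (intro ae) auto
  moreover have "AE s in M. sample_vec n X s \<in> A \<longrightarrow> R E2 s \<le> e" unfolding R_def using E good by (intro ae) auto
  ultimately have "AE s in M. s \<in> {s \<in> space M. sample_vec n X s \<in> A} \<longrightarrow> s \<in> {s \<in> space M. R E1 s \<le> e \<and> R E2 s \<le> e}"
    by eventually_elim auto
  hence "prob {s \<in> space M. sample_vec n X s \<in> A} \<le> prob {s \<in> space M. R E1 s \<le> e \<and> R E2 s \<le> e}"
    by (intro finite_measure_mono_AE) measurable
  hence "1 - 106 * (real n * exp (- (real n * q\<^sup>2))) \<le> prob {s \<in> space M. R E1 s \<le> e \<and> R E2 s \<le> e}" using A(3) by linarith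
  thus ?thesis unfolding cond_prob_data_def R_def E1_def E2_def e_def .
qed

end

lemma small_scales_eventually:
  fixes w z :: "nat \<Rightarrow> real"
  assumes "\<And>n. w n > 0" "\<And>n. z n > 0" "(\<lambda>n. max (w n) (z n)) \<in> o(\<lambda>n. real n)"
    and "\<kappa>0 > 0" "L \<ge> 1" "c > 0"
  shows "\<forall>\<^sub>F n in sequentially. small_scales \<kappa>0 L c (sqrt ((w n + ln (real n)) / real n)) (sqrt (z n / real n))"
proof -
  define q where "q = (\<lambda>n. sqrt ((w n + ln (real n)) / real n))"
  define p where "p = (\<lambda>n. sqrt (z n / real n))"
  have m: "(\<lambda>n. max (w n) (z n) / real n) \<longlonglongrightarrow> 0" using assms(3) by (rule smalloD_tendsto)
  have wn: "(\<lambda>n. w n / real n) \<longlonglongrightarrow> 0"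
    by (rule tendsto_sandwich[OF _ _ tendsto_const m]) (auto intro!: always_eventually divide_right_mono divide_nonneg_nonneg simp: less_imp_le[OF assms(1)])
  have zn: "(\<lambda>n. z n / real n) \<longlonglongrightarrow> 0"
    by (rule tendsto_sandwich[OF _ _ tendsto_const m]) (auto intro!: always_eventually divide_right_mono divide_nonneg_nonneg simp: less_imp_le[OF assms(2)])
  have ln: "(\<lambda>n. ln (real n) / real n) \<longlonglongrightarrow> 0" by real_asymp
  have "(\<lambda>n. w n / real n + ln (real n) / real n) \<longlonglongrightarrow> 0 + 0" by (intro tendsto_add wn ln)
  hence "(\<lambda>n. (w n + ln (real n)) / real n) \<longlonglongrightarrow> 0" by (simp add: add_divide_distrib)
  hence "(\<lambda>n. sqrt ((w n + ln (real n)) / real n)) \<longlonglongrightarrow> sqrt 0" by (intro tendsto_real_sqrt)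
  hence q: "q \<longlonglongrightarrow> 0" unfolding q_def by simp
  have "(\<lambda>n. sqrt (z n / real n)) \<longlonglongrightarrow> sqrt 0" by (intro tendsto_real_sqrt zn)
  hence p: "p \<longlonglongrightarrow> 0" unfolding p_def by simp
  have K: "(\<lambda>n. incr_const L * q n) \<longlonglongrightarrow> incr_const L * 0" by (intro tendsto_intros q)
  have R: "(\<lambda>n. radius_const \<kappa>0 L * sqrt ((p n)\<^sup>2 + (q n)\<^sup>2)) \<longlonglongrightarrow> radius_const \<kappa>0 L * sqrt (0\<^sup>2 + 0\<^sup>2)"
    by (intro tendsto_intros q p)
  have "\<forall>\<^sub>F n in sequentially. q n < 1" using order_tendstoD(2)[OF q, of 1] by simp
  moreover have "\<forall>\<^sub>F n in sequentially. p n < 1 / 44" using order_tendstoD(2)[OF p, of "1 / 44"] by simp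
  moreover have "\<forall>\<^sub>F n in sequentially. incr_const L * q n < \<kappa>0 / 2" using order_tendstoD(2)[OF K, of "\<kappa>0 / 2"] assms(4) by simp
  moreover have "\<forall>\<^sub>F n in sequentially. radius_const \<kappa>0 L * sqrt ((p n)\<^sup>2 + (q n)\<^sup>2) < c / 2"
    using order_tendstoD(2)[OF R, of "c / 2"] assms(6) by simp
  moreover have "\<forall>\<^sub>F n in sequentially. n \<ge> (1::nat)" by (rule eventually_ge_at_top)
  ultimately have "\<forall>\<^sub>F n in sequentially. small_scales \<kappa>0 L c (q n) (p n)"
  proof eventually_elim
    case (elim n)
    have "0 \<le> ln (real n)" using elim(5) by simp
    hence "0 < w n + ln (real n)" using assms(1)[of n] by linarith
    hence "0 < q n" using elim(5) by (simp add: q_def)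
    moreover have "0 < p n" using elim(5) assms(2)[of n] by (simp add: p_def)
    ultimately show ?case using elim by (simp add: small_scales_def)
  qed
  thus ?thesis unfolding q_def p_def .
qed

theorem theorem3p1:
  fixes c\<^sub>0 \<kappa>\<^sub>0 c\<^sub>1 \<kappa>\<^sub>1 L :: real
  assumes "c\<^sub>0 > 0" "\<kappa>\<^sub>0 > 0" "c\<^sub>1 > 0" "\<kappa>\<^sub>1 > 0"
  shows "\<exists>C\<^sub>1>0. \<exists>C\<^sub>2>0. \<exists>C\<^sub>3>0. \<exists>C\<^sub>4>0. \<exists>C\<^sub>5>0.
    \<forall>(F :: real \<Rightarrow> real) (f :: real \<Rightarrow> real) (\<theta> :: real) (w :: nat \<Rightarrow> real) (z :: nat \<Rightarrow> real).
      bdd_above (range (\<lambda>t. \<bar>f t\<bar>)) \<longrightarrow> (SUP t. \<bar>f t\<bar>) = L \<longrightarrow>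
      (\<forall>n. w n > 0) \<longrightarrow> (\<forall>n. z n > 0) \<longrightarrow>
      (\<lambda>n. max (w n) (z n)) \<in> o(\<lambda>n. real n) \<longrightarrow>
      (\<forall>\<^sub>F n in sequentially.
        \<forall>(M :: 'a measure) X \<xi> \<omega> \<theta>s Binv.
          hl_bootstrap M n F f \<theta> X \<xi> \<omega> \<theta>s Binv \<longrightarrow>
          (\<forall>\<delta>. \<bar>\<delta>\<bar> \<le> c\<^sub>0 \<longrightarrow>
            mean_cdf M X differentiable at (\<theta> + \<delta>) \<and>
            deriv (mean_cdf M X) (\<theta> + \<delta>) \<ge> \<kappa>\<^sub>0) \<longrightarrow>
          (\<forall>\<delta>. \<bar>\<delta>\<bar> \<le> c\<^sub>1 \<longrightarrow>
            deriv (mean_cdf M X) differentiable at (\<theta> + \<delta>) \<and>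
            \<bar>deriv (deriv (mean_cdf M X)) (\<theta> + \<delta>)\<bar> \<le> \<kappa>\<^sub>1) \<longrightarrow>
          measure M {s \<in> space M.
            cond_prob_data M n X
              (\<lambda>r. \<bar>\<theta>s r - hodges_lehmann n (\<lambda>i. X i r)\<bar>
                     > C\<^sub>2 * ((w n + ln (real n)) / real n + sqrt (z n / real n))) s
              \<le> C\<^sub>3 * exp (- z n) \<and>
            cond_prob_data M n X
              (\<lambda>r. \<bar>\<theta>s r - hodges_lehmann n (\<lambda>i. X i r)
                     - Binv r * (\<Sum>(i, j)\<in>offdiag n. (\<omega> i r * \<omega> j r - 1) *
                         V_term n (deriv (mean_cdf M X) \<theta>) \<theta> (\<lambda>i. X i r) (\<lambda>i. \<xi> i r) i j)\<bar>
                     > C\<^sub>4 * (z n + w n + ln (real n)) / real n) s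
              \<le> C\<^sub>5 * exp (- z n)}
          \<ge> 1 - C\<^sub>1 * exp (- w n))"
proof -
  \<comment> \<open>Enlarging the Lipschitz constant and shrinking the window keep the hypotheses true, and the bounds are simpler when the
    former is at least 1 and the radius of the latter at most 1.\<close>
  define L' where "L' = max L 1"
  define c where "c = min (min c\<^sub>0 c\<^sub>1) 1"
  have L': "L' \<ge> 1" "L \<le> L'" by (auto simp: L'_def)
  have c: "0 < c" "c \<le> 1" "c \<le> c\<^sub>0" "c \<le> c\<^sub>1" using assms by (auto simp: c_def)
  have dev: "dev_const \<kappa>\<^sub>0 L' > 0"
    using assms L' by (auto simp: dev_const_def incr_const_def intro!: add_nonneg_pos mult_nonneg_nonneg)
  have est: "est_const \<kappa>\<^sub>0 > 0" using assms by (auto simp: est_const_def intro!: add_pos_pos)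
  have rad: "radius_const \<kappa>\<^sub>0 L' > 0" using dev est by (simp add: radius_const_def)
  have lin: "lin_const \<kappa>\<^sub>0 \<kappa>\<^sub>1 L' > 0"
    using dev rad assms L'
    by (auto simp: lin_const_def score_const_def incr_const_def intro!: add_pos_nonneg divide_nonneg_pos add_nonneg_nonneg mult_nonneg_nonneg)
  have bounds: "1 - 106 * exp (- w n) \<le> measure M {s \<in> space M.
      cond_prob_data M n X
        (\<lambda>r. \<bar>\<theta>s r - hodges_lehmann n (\<lambda>i. X i r)\<bar>
               > dev_const \<kappa>\<^sub>0 L' * ((w n + ln (real n)) / real n + sqrt (z n / real n))) s
        \<le> 210 * exp (- z n) \<and>
      cond_prob_data M n X
        (\<lambda>r. \<bar>\<theta>s r - hodges_lehmann n (\<lambda>i. X i r)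
               - Binv r * (\<Sum>(i, j)\<in>offdiag n. (\<omega> i r * \<omega> j r - 1) *
                   V_term n (deriv (mean_cdf M X) \<theta>) \<theta> (\<lambda>i. X i r) (\<lambda>i. \<xi> i r) i j)\<bar>
               > lin_const \<kappa>\<^sub>0 \<kappa>\<^sub>1 L' * (z n + w n + ln (real n)) / real n) s
        \<le> 210 * exp (- z n)}"
    if wz: "\<forall>n. w n > 0" "\<forall>n. z n > 0" and f: "\<And>t. f t \<le> L'"
      and scales: "small_scales \<kappa>\<^sub>0 L' c (sqrt ((w n + ln (real n)) / real n)) (sqrt (z n / real n)) \<and> 3 \<le> n"
      and hl: "hl_bootstrap M n F f \<theta> X \<xi> \<omega> \<theta>s Binv"
      and d1: "\<forall>\<delta>. \<bar>\<delta>\<bar> \<le> c\<^sub>0 \<longrightarrow> mean_cdf M X differentiable at (\<theta> + \<delta>) \<and> deriv (mean_cdf M X) (\<theta> + \<delta>) \<ge> \<kappa>\<^sub>0"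
      and d2: "\<forall>\<delta>. \<bar>\<delta>\<bar> \<le> c\<^sub>1 \<longrightarrow> deriv (mean_cdf M X) differentiable at (\<theta> + \<delta>) \<and>
            \<bar>deriv (deriv (mean_cdf M X)) (\<theta> + \<delta>)\<bar> \<le> \<kappa>\<^sub>1"
    for F f \<theta> w z n and M :: "'a measure" and X \<xi> \<omega> \<theta>s Binv
  proof -
    interpret hl_bootstrap M n F f \<theta> X \<xi> \<omega> \<theta>s Binv by (rule hl)
    define q where "q = sqrt ((w n + ln (real n)) / real n)"
    define p where "p = sqrt (z n / real n)"
    have n0: "real n > 0" using scales by simp
    have ln1: "1 \<le> ln (real n)"
    proof -
      have "exp 1 \<le> (3::real)" by (rule exp_le)
      also have "\<dots> \<le> real n" using scales by simp
      finally have "ln (exp 1) \<le> ln (real n)" using n0 by (subst ln_le_cancel_iff) auto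
      thus ?thesis by simp
    qed
    have wn: "w n > 0" and zn: "z n > 0" using wz by auto
    have q2: "q\<^sup>2 = (w n + ln (real n)) / real n" using wn ln1 n0 by (simp add: q_def)
    have p2: "p\<^sup>2 = z n / real n" using zn n0 by (simp add: p_def)
    have nq: "real n * q\<^sup>2 = w n + ln (real n)" and np: "real n * p\<^sup>2 = z n" using n0 by (simp_all add: q2 p2)
    have level: "real n * exp (- (real n * q\<^sup>2)) = exp (- w n)"
      using n0 unfolding nq by (simp add: exp_diff exp_minus field_simps)
    have lc: "lin_const \<kappa>\<^sub>0 \<kappa>\<^sub>1 L' * (p\<^sup>2 + q\<^sup>2) = lin_const \<kappa>\<^sub>0 \<kappa>\<^sub>1 L' * (z n + w n + ln (real n)) / real n"
      unfolding p2 q2 by (simp add: add_divide_distrib[symmetric] add.assoc)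
    have dr: "dev_radius \<kappa>\<^sub>0 L' q p = dev_const \<kappa>\<^sub>0 L' * ((w n + ln (real n)) / real n + sqrt (z n / real n))"
      unfolding dev_radius_def q2 p_def ..
    have "1 - 106 * (real n * exp (- (real n * q\<^sup>2))) \<le> prob {s \<in> space M.
       cond_prob_data M n X (\<lambda>r. \<bar>\<theta>s r - hodges_lehmann n (\<lambda>i. X i r)\<bar> > dev_radius \<kappa>\<^sub>0 L' q p) s
         \<le> 210 * exp (- (real n * p\<^sup>2)) \<and>
       cond_prob_data M n X (\<lambda>r. \<bar>\<theta>s r - hodges_lehmann n (\<lambda>i. X i r)
           - Binv r * (\<Sum>(i, j)\<in>offdiag n. (\<omega> i r * \<omega> j r - 1) *
               V_term n (deriv (mean_cdf M X) \<theta>) \<theta> (\<lambda>i. X i r) (\<lambda>i. \<xi> i r) i j)\<bar> > lin_const \<kappa>\<^sub>0 \<kappa>\<^sub>1 L' * (p\<^sup>2 + q\<^sup>2)) s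
         \<le> 210 * exp (- (real n * p\<^sup>2))}"
    proof (rule bootstrap_probability_bounds[OF f L'(1) c(1,2) assms(2,4)])
      show "small_scales \<kappa>\<^sub>0 L' c q p" unfolding q_def p_def using scales by blast
      show "1 \<le> real n * q\<^sup>2" "ln (real n) \<le> real n * q\<^sup>2" unfolding nq using wn ln1 by linarith+
    qed (use d1 d2 c in auto)
    thus ?thesis unfolding level lc dr np .
  qed
  show ?thesis
  proof (rule exI[of _ 106], rule conjI, simp, rule exI[of _ "dev_const \<kappa>\<^sub>0 L'"], rule conjI, fact dev,
      rule exI[of _ 210], rule conjI, simp, rule exI[of _ "lin_const \<kappa>\<^sub>0 \<kappa>\<^sub>1 L'"], rule conjI, fact lin,
      rule exI[of _ 210], rule conjI, simp, intro allI impI, goal_cases)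
    case (1 F f \<theta> w z)
    have f: "f t \<le> L'" for t
    proof -
      have "\<bar>f t\<bar> \<le> L" unfolding 1(2)[symmetric] using 1(1) by (intro cSUP_upper) auto
      thus ?thesis using L' by linarith
    qed
    have "\<forall>\<^sub>F n in sequentially. small_scales \<kappa>\<^sub>0 L' c (sqrt ((w n + ln (real n)) / real n)) (sqrt (z n / real n))"
      using 1(3,4) by (intro small_scales_eventually 1(5) assms L' c) auto
    hence ev: "\<forall>\<^sub>F n in sequentially. small_scales \<kappa>\<^sub>0 L' c (sqrt ((w n + ln (real n)) / real n)) (sqrt (z n / real n))
        \<and> 3 \<le> n"
      by (intro eventually_conj eventually_ge_at_top)
    show ?case
      by (rule eventually_mono[OF ev], intro allI impI, rule bounds[OF 1(3,4) f])
  qed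
qed

end
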